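(* Let $\theta\in\mathbb R$. There exist $\mathfrak a_0>0$ and a finite constant $\mathfrak c_0$ such that $$H_n(f_t\,|\,\nu^n_U)+\int_0^t\mathscr G_n(f_s;\nu^n_U)\,ds\;\le\;H_n(f_0\,|\,\nu^n_U)+a\,\mathfrak c_0\,\sqrt n\,t$$ for all $0<a\le\mathfrak a_0$, all $t\ge0$, all $n$, and all initial probability measures $\mu_n$ on $\Omega_n$, where $f_t=\frac{d\,\mu_nS^n(t)}{d\nu^n_U}$.
   Context: Setting. $\mathbb T_n=\mathbb Z/n\mathbb Z$, $\Omega_n=\{0,1\}^{\mathbb T_n}$; indices are modulo $n$. For $\eta\in\Omega_n$: $\eta^{i,j}$ is $\eta$ with the values at $i,j$ exchanged, $\eta^i$ is $\eta$ with $\eta_i$ replaced by $1-\eta_i$, $\bar\eta_i=\eta_i-\tfrac12$, $\sigma_i=2\eta_i-1$. Parameters: $a>0$, $\theta\in\mathbb R$, $\gamma=\gamma_n=\frac12\big(1-\frac{\theta}{\sqrt n}\big)$; only $n\ge3$ with $n>\theta^2$ are considered, so that $\gamma_n\in(0,1)$. Jump rates: $c(\tau_i\eta)=1-\gamma\sigma_i(\sigma_{i-1}+\sigma_{i+1})+\gamma^2\sigma_{i-1}\sigma_{i+1}$. Generator: $$L_nf(\eta)=n^2\sum_{i\in\mathbb T_n}[f(\eta^{i,i+1})-f(\eta)]+a\sum_{i\in\mathbb T_n}c(\tau_i\eta)[f(\eta^i)-f(\eta)].$$ $S^n(t)$ is the semigroup of the Markov chain on $\Omega_n$ with generator $\mathscr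 L_n=\sqrt n\,L_n$. Reference measure: with $\mathfrak m=\sum_i\bar\eta_i$, $\nu^n_U(\eta)=\frac1{Z^n_U}e^{nU(\mathfrak m/n)}\nu^n_{1/2}(\eta)$, where $\nu^n_{1/2}$ is the uniform measure on $\Omega_n$, $Z^n_U$ normalises, and for $\varrho\in[-\frac12,\frac12]$ $$U(\varrho)=\frac1\gamma\Big\{(1+2\gamma\varrho)\log(1+2\gamma\varrho)+(1-2\gamma\varrho)\log(1-2\gamma\varrho)\Big\}.$$ For a density $h$ with respect to $\nu$: $H_n(h|\nu)=\int h\log h\,d\nu$ and $$\mathscr G_n(h;\nu)=\int\tfrac12\big\{\mathscr L_nh-2\sqrt h\,\mathscr L_n\sqrt h\big\}\,d\nu.$$ *)

theory Defs
  imports "HOL-Probability.Probability"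
begin

text \<open>Sites are \<open>{..<n}\<close>, standing for the integers modulo \<open>n\<close>.  Configurations are extensional
  functions on the sites; exchanges and flips at sites preserve this.\<close>

definition Configs :: "nat \<Rightarrow> (nat \<Rightarrow> nat) set" where
  "Configs n = {..<n} \<rightarrow>\<^sub>E {0, 1}"

definition succ_site :: "nat \<Rightarrow> nat \<Rightarrow> nat" where
  "succ_site n i = (i + 1) mod n"

definition pred_site :: "nat \<Rightarrow> nat \<Rightarrow> nat" where
  "pred_site n i = (i + n - 1) mod n"

definition exchange :: "(nat \<Rightarrow> nat) \<Rightarrow> nat \<Rightarrow> nat \<Rightarrow> (nat \<Rightarrow> nat)" where
  "exchange \<eta> i j = \<eta>(i := \<eta> j, j := \<eta> i)"

definition flip :: "(nat \<Rightarrow> nat) \<Rightarrow> nat \<Rightarrow> (nat \<Rightarrow> nat)" where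
  "flip \<eta> i = \<eta>(i := 1 - \<eta> i)"

definition centred :: "(nat \<Rightarrow> nat) \<Rightarrow> nat \<Rightarrow> real" where
  "centred \<eta> i = real (\<eta> i) - 1 / 2"

definition spin :: "(nat \<Rightarrow> nat) \<Rightarrow> nat \<Rightarrow> real" where
  "spin \<eta> i = 2 * real (\<eta> i) - 1"

definition gam :: "real \<Rightarrow> nat \<Rightarrow> real" where
  "gam \<theta> n = 1 / 2 * (1 - \<theta> / sqrt (real n))"

definition flip_rate :: "real \<Rightarrow> nat \<Rightarrow> nat \<Rightarrow> (nat \<Rightarrow> nat) \<Rightarrow> real" where
  "flip_rate \<theta> n i \<eta> =
     1 - gam \<theta> n * spin \<eta> i * (spin \<eta> (pred_site n i) + spin \<eta> (succ_site n i))
       + (gam \<theta> n)\<^sup>2 * spin \<eta> (pred_site n i) * spin \<eta> (succ_site n i)"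

definition gen :: "real \<Rightarrow> real \<Rightarrow> nat \<Rightarrow> ((nat \<Rightarrow> nat) \<Rightarrow> real) \<Rightarrow> (nat \<Rightarrow> nat) \<Rightarrow> real" where
  "gen \<theta> a n f \<eta> =
     (real n)\<^sup>2 * (\<Sum>i<n. f (exchange \<eta> i (succ_site n i)) - f \<eta>)
     + a * (\<Sum>i<n. flip_rate \<theta> n i \<eta> * (f (flip \<eta> i) - f \<eta>))"

definition fast_gen :: "real \<Rightarrow> real \<Rightarrow> nat \<Rightarrow> ((nat \<Rightarrow> nat) \<Rightarrow> real) \<Rightarrow> (nat \<Rightarrow> nat) \<Rightarrow> real" where
  "fast_gen \<theta> a n f \<eta> = sqrt (real n) * gen \<theta> a n f \<eta>"

text \<open>On the finite state space the semigroup generated by \<open>fast_gen\<close> is its exponential;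
  the series converges at every configuration.\<close>

definition semigroup_op ::
  "real \<Rightarrow> real \<Rightarrow> nat \<Rightarrow> real \<Rightarrow> ((nat \<Rightarrow> nat) \<Rightarrow> real) \<Rightarrow> (nat \<Rightarrow> nat) \<Rightarrow> real" where
  "semigroup_op \<theta> a n t f \<eta> = (\<Sum>k. t ^ k / fact k * (fast_gen \<theta> a n ^^ k) f \<eta>)"

definition evolve ::
  "real \<Rightarrow> real \<Rightarrow> nat \<Rightarrow> (nat \<Rightarrow> nat) measure \<Rightarrow> real \<Rightarrow> (nat \<Rightarrow> nat) measure" where
  "evolve \<theta> a n \<mu> t =
     point_measure (Configs n) (\<lambda>\<xi>. ennreal (\<integral>\<eta>. semigroup_op \<theta> a n t (indicator {\<xi>}) \<eta> \<partial>\<mu>))"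

definition magnetization :: "nat \<Rightarrow> (nat \<Rightarrow> nat) \<Rightarrow> real" where
  "magnetization n \<eta> = (\<Sum>i<n. centred \<eta> i)"

definition potential :: "real \<Rightarrow> nat \<Rightarrow> real \<Rightarrow> real" where
  "potential \<theta> n r = (let g = gam \<theta> n in
     1 / g * ((1 + 2 * g * r) * ln (1 + 2 * g * r) + (1 - 2 * g * r) * ln (1 - 2 * g * r)))"

definition tilt :: "real \<Rightarrow> nat \<Rightarrow> (nat \<Rightarrow> nat) \<Rightarrow> real" where
  "tilt \<theta> n \<eta> = exp (real n * potential \<theta> n (magnetization n \<eta> / real n))"

definition partition_const :: "real \<Rightarrow> nat \<Rightarrow> real" where
  "partition_const \<theta> n = (\<integral>\<eta>. tilt \<theta> n \<eta> \<partial>uniform_count_measure (Configs n))"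

definition ref_measure :: "real \<Rightarrow> nat \<Rightarrow> (nat \<Rightarrow> nat) measure" where
  "ref_measure \<theta> n =
     density (uniform_count_measure (Configs n)) (\<lambda>\<eta>. ennreal (tilt \<theta> n \<eta> / partition_const \<theta> n))"

text \<open>The reference measure charges every configuration, so the derivative below is
  determined at every configuration and finite there.\<close>

definition dens ::
  "real \<Rightarrow> real \<Rightarrow> nat \<Rightarrow> (nat \<Rightarrow> nat) measure \<Rightarrow> real \<Rightarrow> (nat \<Rightarrow> nat) \<Rightarrow> real" where
  "dens \<theta> a n \<mu> t \<eta> = enn2real (RN_deriv (ref_measure \<theta> n) (evolve \<theta> a n \<mu> t) \<eta>)"

text \<open>The usual convention \<open>0 log 0 = 0\<close> holds, since \<open>0 * ln 0 = 0\<close>.\<close>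

definition rel_entropy :: "((nat \<Rightarrow> nat) \<Rightarrow> real) \<Rightarrow> (nat \<Rightarrow> nat) measure \<Rightarrow> real" where
  "rel_entropy h \<nu> = (\<integral>\<eta>. h \<eta> * ln (h \<eta>) \<partial>\<nu>)"

definition carre_energy ::
  "real \<Rightarrow> real \<Rightarrow> nat \<Rightarrow> ((nat \<Rightarrow> nat) \<Rightarrow> real) \<Rightarrow> (nat \<Rightarrow> nat) measure \<Rightarrow> real" where
  "carre_energy \<theta> a n h \<nu> =
     (\<integral>\<eta>. 1 / 2 * (fast_gen \<theta> a n h \<eta>
              - 2 * sqrt (h \<eta>) * fast_gen \<theta> a n (\<lambda>\<xi>. sqrt (h \<xi>)) \<eta>) \<partial>\<nu>)"

end

(* The law of the chain is strictly positive at positive times, and y (ln z - ln y) <= 2 sqrt y (sqrt z - sqrt y)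
   bounds the entropy production by the integral of the generator applied to the density, minus twice the
   energy.  It remains to bound that integral by the energy plus a constant multiple of a sqrt n.  Exchanges do not
   contribute.  The flips contribute a function V of the configuration integrated against the density.

   The potential makes the flips reversible when the two neighbours are replaced by the mean spin.
   Hence, up to a bounded error, V is a combination of sum_i A_i x_(i+1), where x_i is the spin minus its
   mean, A_i is x_i, x_(i-1) or x_(i-1) x_i, and the coefficients depend only on the mean spin.

   Telescoping writes such a sum as sum_k (x_k - x_(k+1)) h_k with h_k almost invariant under the exchange
   across the bond.  Integrating by parts there costs a small multiple of n^2 times the Dirichlet form
   and a / n^2 times sum_k of the integral of h_k^2.  The latter is not controlled through a logarithmic Sobolev
   inequality: h_k has bounded increments and is, up to a bounded error, an eigenfunction of the
   exchange dynamics on the complete graph, so integrating its square by parts on the complete graph bounds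
   it by n times (Dirichlet form of the complete graph plus a constant), and moving particles along the
   circle compares this form with n^2 times that of the circle.  Small a lets the energy absorb it. *)
theory Submission
  imports Defs "HOL-Real_Asymp.Real_Asymp"
begin

section \<open>Entropy dissipation of a finite Markov chain\<close>

text \<open>Each sum making up V has n terms of order one, yet beyond the energy only an O(1) excess
  is allowed, so the powers of n have to match exactly. The second moment of one \<open>h_k\<close>
  costs n times the mass plus n^3 times the circle form \<open>dirichlet\<close>. Young's inequality
  with weight \<open>b * (real n)\<^sup>2\<close> divides this by n^2, and summing over the n bonds
  brings back n^2, which is the scale of the exchange energy; the mass terms come out of order one.

  Coefficients depending on the mean spin pass through every integration by parts like constants,
  because all exchanges conserve it. For the same reason the reference weights enter that part only
  through their invariance under exchanges.

  With \<open>b\<close> proportional to 1/a, the Young term takes a fixed share of the energy and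
  the n^3 term a share of order a^2; this is what the smallness of \<open>a\<close> buys. All
  constants depend on \<theta> only through one \<open>g < 1\<close> that dominates every admissible
  \<open>gam \<theta> n\<close>.\<close>

locale finite_chain =
  fixes X :: "'a set" and B :: "'b set" and r :: "'b \<Rightarrow> 'a \<Rightarrow> real" and T :: "'b \<Rightarrow> 'a \<Rightarrow> 'a"
  assumes finX: "finite X" and finB: "finite B"
    and TX: "\<And>b \<eta>. b \<in> B \<Longrightarrow> \<eta> \<in> X \<Longrightarrow> T b \<eta> \<in> X"
    and r_nonneg: "\<And>b \<eta>. b \<in> B \<Longrightarrow> \<eta> \<in> X \<Longrightarrow> 0 \<le> r b \<eta>"
begin

definition generator :: "('a \<Rightarrow> real) \<Rightarrow> 'a \<Rightarrow> real" where
  "generator f \<eta> = (\<Sum>b\<in>B. r b \<eta> * (f (T b \<eta>) - f \<eta>))"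

definition total_rate :: real where "total_rate = (\<Sum>\<eta>\<in>X. \<Sum>b\<in>B. r b \<eta>)"

text \<open>All exit rates are at most \<open>total_rate\<close>, so this operator preserves nonnegativity and
  positivity of the semigroup can be read off its power series.\<close>

definition uniformized :: "('a \<Rightarrow> real) \<Rightarrow> 'a \<Rightarrow> real" where
  "uniformized f \<eta> = generator f \<eta> + total_rate * f \<eta>"

definition semigroup :: "real \<Rightarrow> ('a \<Rightarrow> real) \<Rightarrow> 'a \<Rightarrow> real" where
  "semigroup t f \<eta> = (\<Sum>k. t ^ k / fact k * (generator ^^ k) f \<eta>)"

lemma rate_le_total_rate: "\<eta> \<in> X \<Longrightarrow> (\<Sum>b\<in>B. r b \<eta>) \<le> total_rate"
  unfolding total_rate_def
  by (rule member_le_sum) (auto intro!: sum_nonneg r_nonneg finX)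

lemma uniformized_eq: "uniformized f \<eta> = (\<Sum>b\<in>B. r b \<eta> * f (T b \<eta>)) + (total_rate - (\<Sum>b\<in>B. r b \<eta>)) * f \<eta>"
  by (simp add: uniformized_def generator_def right_diff_distrib left_diff_distrib sum_subtractf sum_distrib_right)

lemma uniformized_mono:
  assumes "\<And>\<xi>. \<xi> \<in> X \<Longrightarrow> f \<xi> \<le> g \<xi>" "\<eta> \<in> X"
  shows "uniformized f \<eta> \<le> uniformized g \<eta>"
  unfolding uniformized_eq using assms rate_le_total_rate[of \<eta>]
  by (intro add_mono sum_mono mult_left_mono) (auto intro: TX r_nonneg)

lemma uniformized_funpow_mono:
  assumes "\<And>\<xi>. \<xi> \<in> X \<Longrightarrow> f \<xi> \<le> g \<xi>" "\<eta> \<in> X"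
  shows "(uniformized ^^ k) f \<eta> \<le> (uniformized ^^ k) g \<eta>"
  using assms(2) by (induction k arbitrary: \<eta>) (auto intro: assms uniformized_mono)

lemma uniformized_zero: "uniformized (\<lambda>_. 0) = (\<lambda>_. 0)"
  by (auto simp: uniformized_def generator_def)

lemma uniformized_funpow_zero: "(uniformized ^^ k) (\<lambda>_. 0) = (\<lambda>_. 0)"
  by (induction k) (auto simp: uniformized_zero)

lemma uniformized_funpow_nonneg:
  assumes "\<And>\<xi>. \<xi> \<in> X \<Longrightarrow> 0 \<le> f \<xi>" "\<eta> \<in> X"
  shows "0 \<le> (uniformized ^^ k) f \<eta>"
  using uniformized_funpow_mono[of "\<lambda>_. 0" f \<eta> k] assms by (simp add: uniformized_funpow_zero)

lemma uniformized_scale: "uniformized (\<lambda>\<xi>. c * f \<xi>) = (\<lambda>\<xi>. c * uniformized f \<xi>)"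
  unfolding uniformized_eq by (rule ext) (simp add: algebra_simps sum_distrib_left)

lemma uniformized_funpow_scale: "(uniformized ^^ k) (\<lambda>\<xi>. c * f \<xi>) = (\<lambda>\<xi>. c * (uniformized ^^ k) f \<xi>)"
  by (induction k) (auto simp: uniformized_scale)

section \<open>The semigroup as a power series\<close>

lemma generator_bound:
  assumes "\<And>\<xi>. \<xi> \<in> X \<Longrightarrow> \<bar>f \<xi>\<bar> \<le> F" "\<eta> \<in> X"
  shows "\<bar>generator f \<eta>\<bar> \<le> 2 * total_rate * F"
proof -
  have F: "0 \<le> F" using assms by (meson abs_ge_zero order_trans)
  have "\<bar>generator f \<eta>\<bar> \<le> (\<Sum>b\<in>B. r b \<eta> * (2 * F))"
    unfolding generator_def
  proof (rule order_trans[OF sum_abs] , rule sum_mono)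
    fix b assume b: "b \<in> B"
    have "\<bar>f (T b \<eta>) - f \<eta>\<bar> \<le> 2 * F"
      using assms(1)[OF TX[OF b assms(2)]] assms(1)[OF assms(2)] by linarith
    then show "\<bar>r b \<eta> * (f (T b \<eta>) - f \<eta>)\<bar> \<le> r b \<eta> * (2 * F)"
      using r_nonneg[OF b assms(2)] by (simp add: abs_mult mult_left_mono)
  qed
  also have "\<dots> = (\<Sum>b\<in>B. r b \<eta>) * (2 * F)" by (simp add: sum_distrib_right)
  also have "\<dots> \<le> total_rate * (2 * F)" using rate_le_total_rate[OF assms(2)] F by (intro mult_right_mono) auto
  finally show ?thesis by simp
qed

lemma generator_funpow_bound:
  assumes "\<And>\<xi>. \<xi> \<in> X \<Longrightarrow> \<bar>f \<xi>\<bar> \<le> F" "\<eta> \<in> X"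
  shows "\<bar>(generator ^^ k) f \<eta>\<bar> \<le> (2 * total_rate) ^ k * F"
  using assms(2)
proof (induction k arbitrary: \<eta>)
  case (Suc k)
  have "\<bar>generator ((generator ^^ k) f) \<eta>\<bar> \<le> 2 * total_rate * ((2 * total_rate) ^ k * F)"
    using generator_bound[OF Suc.IH Suc.prems] .
  then show ?case by (simp add: mult.assoc)
qed (use assms in auto)

text \<open>Convergence is needed in the absolute sense because the series is later multiplied with
  an exponential series in a Cauchy product.\<close>

lemma summable_P:
  assumes "\<eta> \<in> X"
  shows "summable (\<lambda>k. \<bar>t ^ k / fact k * (generator ^^ k) f \<eta>\<bar>)"
proof -
  define F where "F = (\<Sum>\<xi>\<in>X. \<bar>f \<xi>\<bar>)"
  have F: "\<bar>f \<xi>\<bar> \<le> F" if "\<xi> \<in> X" for \<xi>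
    unfolding F_def using that by (intro member_le_sum) (auto simp: finX)
  have S: "summable (\<lambda>k. F * (inverse (fact k) * (\<bar>t\<bar> * (2 * total_rate)) ^ k))"
    by (rule summable_mult, rule summable_exp)
  show ?thesis
  proof (rule summable_comparison_test'[OF S])
    fix k
    show "norm \<bar>t ^ k / fact k * (generator ^^ k) f \<eta>\<bar> \<le> F * (inverse (fact k) * (\<bar>t\<bar> * (2 * total_rate)) ^ k)"
      using mult_left_mono[OF generator_funpow_bound[OF F assms, where k=k], where c = "\<bar>t\<bar> ^ k / fact k"]
      by (simp add: abs_mult power_abs power_mult_distrib divide_inverse mult_ac)
  qed
qed

lemma semigroup_sums:
  assumes "\<eta> \<in> X"
  shows "(\<lambda>k. t ^ k / fact k * (generator ^^ k) f \<eta>) sums semigroup t f \<eta>"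
  unfolding semigroup_def using summable_P[OF assms] by (rule summable_rabs_cancel[THEN summable_sums])

text \<open>On a finite space the series is entire in time, so it may be differentiated termwise.
  Differentiation shifts the power of the generator by one, and the extra factor is placed next to
  \<open>f\<close>.\<close>

lemma semigroup_deriv:
  assumes "\<eta> \<in> X"
  shows "((\<lambda>t. semigroup t f \<eta>) has_real_derivative semigroup t (generator f) \<eta>) (at t)"
proof -
  define c where "c k = (generator ^^ k) f \<eta> / fact k" for k
  have s: "summable (\<lambda>k. c k * y ^ k)" for y
    using sums_summable[OF semigroup_sums[OF assms, of y f]] by (simp add: c_def mult_ac)
  have "((\<lambda>t. \<Sum>k. c k * t ^ k) has_real_derivative (\<Sum>k. diffs c k * t ^ k)) (at t)"
    by (rule termdiffs_strong_converges_everywhere) (rule s)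
  moreover have "(\<lambda>t. \<Sum>k. c k * t ^ k) = (\<lambda>t. semigroup t f \<eta>)"
    by (simp add: semigroup_def c_def mult_ac)
  moreover have "(\<Sum>k. diffs c k * t ^ k) = semigroup t (generator f) \<eta>"
  proof -
    have "diffs c k = (generator ^^ k) (generator f) \<eta> / fact k" for k
    proof -
      have "(generator ^^ Suc k) f = (generator ^^ k) (generator f)" by (simp add: funpow_Suc_right del: funpow.simps)
      then show ?thesis by (simp add: diffs_def c_def del: funpow.simps of_nat_Suc)
    qed
    then show ?thesis by (simp add: semigroup_def mult_ac)
  qed
  ultimately show ?thesis by simp
qed

section \<open>Positivity by uniformization\<close>

text \<open>The generator commutes with multiples of the identity, so the binomial theorem applies;
  the induction step is Pascal's rule.\<close>

lemma uniformized_funpow_binomial: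
  "(uniformized ^^ k) f \<eta> = (\<Sum>j\<le>k. real (k choose j) * total_rate ^ (k - j) * (generator ^^ j) f \<eta>)"
proof (induction k arbitrary: \<eta>)
  case (Suc k)
  have Llin: "generator ((uniformized ^^ k) f) \<eta> = (\<Sum>j\<le>k. real (k choose j) * total_rate ^ (k - j) * (generator ^^ Suc j) f \<eta>)"
  proof -
    have "generator ((uniformized ^^ k) f) \<eta> = (\<Sum>b\<in>B. \<Sum>j\<le>k. real (k choose j) * total_rate ^ (k - j)
        * (r b \<eta> * ((generator ^^ j) f (T b \<eta>) - (generator ^^ j) f \<eta>)))"
      unfolding generator_def[of "(uniformized ^^ k) f"] Suc.IH
      by (simp only: sum_subtractf[symmetric] sum_distrib_left right_diff_distrib mult_ac)
    also have "\<dots> = (\<Sum>j\<le>k. \<Sum>b\<in>B. real (k choose j) * total_rate ^ (k - j)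
        * (r b \<eta> * ((generator ^^ j) f (T b \<eta>) - (generator ^^ j) f \<eta>)))"
      by (rule sum.swap)
    finally show ?thesis unfolding funpow.simps comp_apply generator_def[of "(generator ^^ _) f"] by (simp only: sum_distrib_left)
  qed
  define g where "g j = (generator ^^ j) f \<eta>" for j
  have "(uniformized ^^ Suc k) f \<eta> = (\<Sum>j\<le>k. real (k choose j) * total_rate ^ (k - j) * g (Suc j))
      + (\<Sum>j\<le>k. real (k choose j) * total_rate ^ (Suc k - j) * g j)"
    using Llin by (simp add: uniformized_def Suc.IH sum_distrib_left g_def Suc_diff_le mult_ac)
  also have "(\<Sum>j\<le>k. real (k choose j) * total_rate ^ (Suc k - j) * g j)
     = (\<Sum>j\<le>Suc k. real (k choose j) * total_rate ^ (Suc k - j) * g j)" by simp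
  also have "\<dots> = total_rate ^ Suc k * g 0 + (\<Sum>j\<le>k. real (k choose Suc j) * total_rate ^ (k - j) * g (Suc j))"
    by (subst sum.atMost_Suc_shift) simp
  also have "(\<Sum>j\<le>k. real (k choose j) * total_rate ^ (k - j) * g (Suc j)) + \<dots>
     = total_rate ^ Suc k * g 0 + (\<Sum>j\<le>k. real (Suc k choose Suc j) * total_rate ^ (k - j) * g (Suc j))"
    by (simp add: sum.distrib[symmetric] algebra_simps)
  also have "\<dots> = (\<Sum>j\<le>Suc k. real (Suc k choose j) * total_rate ^ (Suc k - j) * g j)"
    by (simp only: sum.atMost_Suc_shift) simp
  finally show ?case by (simp add: g_def del: funpow.simps)
qed simp

text \<open>The exponential of a sum of commuting operators factorises. For nonnegative
  \<open>f\<close> and \<open>t\<close> the series on the left has nonnegative terms, which the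
  series in powers of \<open>generator\<close> does not show.\<close>

lemma semigroup_uniformized:
  assumes "\<eta> \<in> X"
  shows "(\<lambda>k. t ^ k / fact k * (uniformized ^^ k) f \<eta>) sums (exp (total_rate * t) * semigroup t f \<eta>)"
proof -
  define A where "A k = (total_rate * t) ^ k / fact k" for k
  define D where "D k = t ^ k / fact k * (generator ^^ k) f \<eta>" for k
  have A: "summable (\<lambda>k. norm (A k))"
  proof -
    have "(\<lambda>k. norm (A k)) = (\<lambda>k. inverse (fact k) * \<bar>total_rate * t\<bar> ^ k)"
      by (auto simp: A_def abs_mult power_abs divide_inverse)
    then show ?thesis using summable_exp[of "\<bar>total_rate * t\<bar>"] by simp
  qed
  have D: "summable (\<lambda>k. norm (D k))"
    using summable_P[OF assms] by (simp add: D_def)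
  have "(\<lambda>k. \<Sum>i\<le>k. D i * A (k - i)) sums ((\<Sum>k. D k) * (\<Sum>k. A k))"
    by (rule Cauchy_product_sums[OF D A])
  moreover have "(\<Sum>k. A k) = exp (total_rate * t)"
    by (simp add: A_def exp_def divide_inverse mult_ac)
  moreover have "(\<Sum>k. D k) = semigroup t f \<eta>"
    by (simp add: D_def semigroup_def)
  moreover have "(\<Sum>i\<le>k. D i * A (k - i)) = t ^ k / fact k * (uniformized ^^ k) f \<eta>" for k
  proof -
    have "D i * A (k - i) = t ^ k / fact k * (real (k choose i) * total_rate ^ (k - i) * (generator ^^ i) f \<eta>)"
      if "i \<le> k" for i
    proof -
      have "t ^ k = t ^ i * t ^ (k - i)" using that by (simp add: power_add[symmetric])
      then show ?thesis
        using that by (simp add: D_def A_def power_mult_distrib binomial_fact)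
    qed
    then show ?thesis by (simp add: uniformized_funpow_binomial sum_distrib_left)
  qed
  ultimately show ?thesis by (simp add: mult_ac)
qed

text \<open>Reduces the action on functions to matrix entries, since \<open>law\<close> sees the
  semigroup only through indicators. The expansion holds at points of \<open>X\<close>, which the
  moves never leave.\<close>

lemma generator_funpow_linear:
  assumes "\<eta> \<in> X"
  shows "(generator ^^ k) f \<eta> = (\<Sum>\<xi>\<in>X. f \<xi> * (generator ^^ k) (indicator {\<xi>}) \<eta>)"
  using assms
proof (induction k arbitrary: \<eta>)
  case 0
  then show ?case using finX by (simp add: indicator_def if_distrib sum.delta' cong: if_cong)
next
  case (Suc k)
  have "(generator ^^ Suc k) f \<eta> = (\<Sum>b\<in>B. \<Sum>\<xi>\<in>X. f \<xi> * (r b \<eta> *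
     ((generator ^^ k) (indicator {\<xi>}) (T b \<eta>) - (generator ^^ k) (indicator {\<xi>}) \<eta>)))"
    unfolding funpow.simps comp_apply generator_def[of "(generator ^^ k) f"] using Suc.prems
    by (intro sum.cong refl)
      (simp add: Suc.IH TX sum_distrib_left sum_subtractf[symmetric] right_diff_distrib mult_ac)
  also have "\<dots> = (\<Sum>\<xi>\<in>X. \<Sum>b\<in>B. f \<xi> * (r b \<eta> *
     ((generator ^^ k) (indicator {\<xi>}) (T b \<eta>) - (generator ^^ k) (indicator {\<xi>}) \<eta>)))"
    by (rule sum.swap)
  finally show ?case unfolding funpow.simps comp_apply generator_def[of "(generator ^^ k) (indicator _)"] by (simp only: sum_distrib_left)
qed

lemma semigroup_linear:
  assumes "\<eta> \<in> X"
  shows "semigroup t f \<eta> = (\<Sum>\<xi>\<in>X. f \<xi> * semigroup t (indicator {\<xi>}) \<eta>)"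
proof -
  have "(\<lambda>k. \<Sum>\<xi>\<in>X. f \<xi> * (t ^ k / fact k * (generator ^^ k) (indicator {\<xi>}) \<eta>))
      sums (\<Sum>\<xi>\<in>X. f \<xi> * semigroup t (indicator {\<xi>}) \<eta>)"
    by (intro sums_sum sums_mult semigroup_sums assms)
  moreover have "(\<Sum>\<xi>\<in>X. f \<xi> * (t ^ k / fact k * (generator ^^ k) (indicator {\<xi>}) \<eta>))
     = t ^ k / fact k * (generator ^^ k) f \<eta>" for k
    by (subst generator_funpow_linear[OF assms, of k f]) (simp add: sum_distrib_left mult_ac)
  ultimately show ?thesis using semigroup_sums[OF assms, of t f] sums_unique2 by simp
qed

lemma semigroup_one:
  shows "semigroup t (\<lambda>_. 1) \<eta> = 1"
proof -
  have L1: "generator (\<lambda>_. c) = (\<lambda>_. 0)" for c by (auto simp: generator_def)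
  have "(generator ^^ k) (\<lambda>_. 1) \<eta> = (if k = 0 then 1 else 0)" for k
  proof (cases k)
    case (Suc j)
    have "(generator ^^ j) (\<lambda>_. 0) = (\<lambda>_. 0)" by (induction j) (auto simp: L1)
    then show ?thesis by (simp add: Suc funpow_Suc_right L1 del: funpow.simps)
  qed simp
  then have "semigroup t (\<lambda>_. 1) \<eta> = (\<Sum>k. if k = 0 then 1 else 0)"
    unfolding semigroup_def by (intro arg_cong[where f=suminf] ext) auto
  also have "\<dots> = 1" using suminf_finite[of "{0}" "\<lambda>k. if k = 0 then 1 else (0::real)"] by simp
  finally show ?thesis .
qed


section \<open>The law of the chain\<close>

definition law :: "('a \<Rightarrow> real) \<Rightarrow> real \<Rightarrow> 'a \<Rightarrow> real" where
  "law \<mu> t \<xi> = (\<Sum>\<eta>\<in>X. \<mu> \<eta> * semigroup t (indicator {\<xi>}) \<eta>)"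

lemma law_integral: "(\<Sum>\<xi>\<in>X. law \<mu> t \<xi> * f \<xi>) = (\<Sum>\<eta>\<in>X. \<mu> \<eta> * semigroup t f \<eta>)"
proof -
  have "(\<Sum>\<xi>\<in>X. law \<mu> t \<xi> * f \<xi>) = (\<Sum>\<xi>\<in>X. \<Sum>\<eta>\<in>X. \<mu> \<eta> * (f \<xi> * semigroup t (indicator {\<xi>}) \<eta>))"
    by (simp add: law_def sum_distrib_left sum_distrib_right mult_ac)
  also have "\<dots> = (\<Sum>\<eta>\<in>X. \<Sum>\<xi>\<in>X. \<mu> \<eta> * (f \<xi> * semigroup t (indicator {\<xi>}) \<eta>))"
    by (rule sum.swap)
  also have "\<dots> = (\<Sum>\<eta>\<in>X. \<mu> \<eta> * semigroup t f \<eta>)"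
    by (intro sum.cong refl) (simp add: semigroup_linear[of _ t f] sum_distrib_left)
  finally show ?thesis .
qed

lemma sum_law: "(\<Sum>\<xi>\<in>X. law \<mu> t \<xi>) = (\<Sum>\<eta>\<in>X. \<mu> \<eta>)"
  using law_integral[of \<mu> t "\<lambda>_. 1"] by (simp add: semigroup_one)

text \<open>Kolmogorov's forward equation at a single point; \<open>sum_law_deriv\<close> is its
  version tested against a function.\<close>

lemma law_deriv:
  "((\<lambda>t. law \<mu> t \<xi>) has_real_derivative (\<Sum>\<zeta>\<in>X. law \<mu> t \<zeta> * generator (indicator {\<xi>}) \<zeta>)) (at t)"
  unfolding law_integral unfolding law_def
  by (intro DERIV_sum DERIV_cmult semigroup_deriv)

lemma generator_linear: "\<eta> \<in> X \<Longrightarrow> generator f \<eta> = (\<Sum>\<xi>\<in>X. f \<xi> * generator (indicator {\<xi>}) \<eta>)"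
  using generator_funpow_linear[of \<eta> 1 f] by simp

lemma sum_law_deriv:
  "(\<Sum>\<xi>\<in>X. g \<xi> * (\<Sum>\<zeta>\<in>X. law \<mu> t \<zeta> * generator (indicator {\<xi>}) \<zeta>)) = (\<Sum>\<zeta>\<in>X. law \<mu> t \<zeta> * generator g \<zeta>)"
proof -
  have "(\<Sum>\<xi>\<in>X. g \<xi> * (\<Sum>\<zeta>\<in>X. law \<mu> t \<zeta> * generator (indicator {\<xi>}) \<zeta>))
    = (\<Sum>\<xi>\<in>X. \<Sum>\<zeta>\<in>X. law \<mu> t \<zeta> * (g \<xi> * generator (indicator {\<xi>}) \<zeta>))"
    by (simp add: sum_distrib_left mult_ac)
  also have "\<dots> = (\<Sum>\<zeta>\<in>X. \<Sum>\<xi>\<in>X. law \<mu> t \<zeta> * (g \<xi> * generator (indicator {\<xi>}) \<zeta>))"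
    by (rule sum.swap)
  also have "\<dots> = (\<Sum>\<zeta>\<in>X. law \<mu> t \<zeta> * generator g \<zeta>)"
    by (intro sum.cong refl) (simp add: generator_linear[of _ g] sum_distrib_left)
  finally show ?thesis .
qed

lemma law_uniformized:
  "(\<lambda>k. t ^ k / fact k * (\<Sum>\<eta>\<in>X. \<mu> \<eta> * (uniformized ^^ k) (indicator {\<xi>}) \<eta>)) sums (exp (total_rate * t) * law \<mu> t \<xi>)"
proof -
  have "(\<lambda>k. \<Sum>\<eta>\<in>X. \<mu> \<eta> * (t ^ k / fact k * (uniformized ^^ k) (indicator {\<xi>}) \<eta>)) sums
      (\<Sum>\<eta>\<in>X. \<mu> \<eta> * (exp (total_rate * t) * semigroup t (indicator {\<xi>}) \<eta>))"
    by (intro sums_sum sums_mult semigroup_uniformized)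
  then show ?thesis by (simp add: law_def sum_distrib_left mult_ac)
qed

lemma law_nonneg:
  assumes "\<And>\<eta>. \<eta> \<in> X \<Longrightarrow> 0 \<le> \<mu> \<eta>" "0 \<le> t"
  shows "0 \<le> law \<mu> t \<xi>"
proof -
  have "0 \<le> exp (total_rate * t) * law \<mu> t \<xi>"
    using assms by (intro sums_le[OF _ sums_zero law_uniformized])
      (intro mult_nonneg_nonneg divide_nonneg_nonneg sum_nonneg uniformized_funpow_nonneg, auto)
  then show ?thesis by (simp add: zero_le_mult_iff)
qed

text \<open>\<open>irr\<close> is irreducibility phrased through closed sets. The points charged by
  some power of \<open>uniformized\<close> form a nonempty closed set, hence all of
  \<open>X\<close>; one positive term then makes a nonnegative series positive for
  \<open>t > 0\<close>.\<close>

lemma law_pos: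
  assumes nn: "\<And>\<eta>. \<eta> \<in> X \<Longrightarrow> 0 \<le> \<mu> \<eta>" and tot: "(\<Sum>\<eta>\<in>X. \<mu> \<eta>) = 1" and t: "0 < t"
    and irr: "\<And>S. S \<subseteq> X \<Longrightarrow> S \<noteq> {} \<Longrightarrow>
      (\<And>\<eta> b. \<eta> \<in> S \<Longrightarrow> b \<in> B \<Longrightarrow> 0 < r b \<eta> \<Longrightarrow> T b \<eta> \<in> S) \<Longrightarrow> S = X"
    and \<xi>: "\<xi> \<in> X"
  shows "0 < law \<mu> t \<xi>"
proof -
  define c where "c k \<zeta> = (\<Sum>\<eta>\<in>X. \<mu> \<eta> * (uniformized ^^ k) (indicator {\<zeta>}) \<eta>)" for k \<zeta>
  define S where "S = {\<zeta>\<in>X. \<exists>k. 0 < c k \<zeta>}"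
  have "S = X"
  proof (rule irr)
    obtain \<eta> where \<eta>: "\<eta> \<in> X" "\<mu> \<eta> \<noteq> 0" using tot by (metis sum.neutral zero_neq_one)
    have "c 0 \<eta> = \<mu> \<eta>"
      using finX \<eta>(1) by (simp add: c_def indicator_def if_distrib sum.delta' cong: if_cong)
    then have "\<eta> \<in> S" using \<eta> nn[of \<eta>] unfolding S_def by (auto intro!: exI[of _ 0])
    then show "S \<noteq> {}" by auto
  next
    fix \<eta> b assume "\<eta> \<in> S" and b: "b \<in> B" "0 < r b \<eta>"
    then obtain k where \<eta>: "\<eta> \<in> X" and k: "0 < c k \<eta>" by (auto simp: S_def)
    \<comment> \<open>A single jump: all other contributions to \<open>uniformized\<close> are
      nonnegative, so the one made by \<open>b\<close> may be kept alone.\<close>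
    have le: "r b \<eta> * indicator {\<eta>} \<zeta> \<le> uniformized (indicator {T b \<eta>}) \<zeta>" if \<zeta>: "\<zeta> \<in> X" for \<zeta>
    proof (cases "\<zeta> = \<eta>")
      case True
      have "r b \<eta> * indicator {T b \<eta>} (T b \<eta>) \<le> (\<Sum>b'\<in>B. r b' \<eta> * indicator {T b \<eta>} (T b' \<eta>))"
        using b finB \<eta> by (intro member_le_sum[where f="\<lambda>b'. r b' \<eta> * indicator {T b \<eta>} (T b' \<eta>)"])
          (auto intro!: mult_nonneg_nonneg r_nonneg)
      moreover have "0 \<le> (total_rate - (\<Sum>b\<in>B. r b \<eta>)) * indicator {T b \<eta>} \<eta>"
        using rate_le_total_rate[OF \<eta>] by (intro mult_nonneg_nonneg) auto
      ultimately show ?thesis using True by (simp add: uniformized_eq)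
    next
      case False
      have "0 \<le> uniformized (indicator {T b \<eta>}) \<zeta>"
        using uniformized_funpow_nonneg[of "indicator {T b \<eta>}" \<zeta> 1] \<zeta> by simp
      then show ?thesis using False by simp
    qed
    have "r b \<eta> * c k \<eta> \<le> c (Suc k) (T b \<eta>)"
    proof -
      have "r b \<eta> * c k \<eta> = (\<Sum>\<zeta>\<in>X. \<mu> \<zeta> * (uniformized ^^ k) (\<lambda>\<xi>. r b \<eta> * indicator {\<eta>} \<xi>) \<zeta>)"
        by (simp add: c_def uniformized_funpow_scale sum_distrib_left mult_ac)
      also have "\<dots> \<le> c (Suc k) (T b \<eta>)"
        unfolding c_def funpow_Suc_right comp_apply
        by (intro sum_mono mult_left_mono uniformized_funpow_mono le nn)
      finally show ?thesis .
    qed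
    moreover have "0 < r b \<eta> * c k \<eta>" using b k by simp
    ultimately show "T b \<eta> \<in> S" using TX[OF b(1) \<eta>] unfolding S_def by (auto intro!: exI[of _ "Suc k"])
  qed (auto simp: S_def)
  then obtain k where k: "0 < c k \<xi>" using \<xi> by (auto simp: S_def)
  have c0: "0 \<le> c j \<xi>" for j
    unfolding c_def by (intro sum_nonneg mult_nonneg_nonneg uniformized_funpow_nonneg nn) auto
  note sm = law_uniformized[of t \<mu> \<xi>, folded c_def]
  have "0 < (\<Sum>j. t ^ j / fact j * c j \<xi>)"
    using t k c0 by (intro suminf_pos2[OF sums_summable[OF sm], of k]) auto
  then have "0 < exp (total_rate * t) * law \<mu> t \<xi>" using sums_unique[OF sm] by simp
  then show ?thesis by (simp add: zero_less_mult_iff)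
qed

end

section \<open>Differentiating the relative entropy\<close>

text \<open>The initial law may vanish at some configurations, so differentiability of the entropy
  is available only at positive times. Continuity of x ln x up to 0 connects these to time
  zero.\<close>

lemma continuous_on_mult_ln: "continuous_on {0..} (\<lambda>x::real. x * ln x)"
proof -
  have "continuous (at x within {0..}) (\<lambda>x::real. x * ln x)" if "0 \<le> x" for x :: real
  proof (cases "x = 0")
    case True
    have "((\<lambda>x::real. x * ln x) \<longlongrightarrow> 0) (at_right 0)" by real_asymp
    then show ?thesis using True
      by (simp add: continuous_within at_within_Ici_at_right)
  next
    case False
    then show ?thesis using that
      by (intro continuous_at_imp_continuous_at_within[OF isCont_mult] continuous_ident isCont_ln)
  qed
  then show ?thesis by (auto simp: continuous_on_eq_continuous_within)
qed

text \<open>The entropy plus the accumulated energy minus \<open>\<kappa> * u\<close> is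
  nonincreasing in \<open>u\<close>; the mean value argument asks for derivatives in the open
  interval only.\<close>

lemma set_lebesgue_integral_decreasing:
  fixes H G :: "real \<Rightarrow> real"
  assumes t: "0 \<le> t" and cH: "continuous_on {0..t} H" and cG: "continuous_on {0..t} G"
    and d: "\<And>s. 0 < s \<Longrightarrow> s < t \<Longrightarrow> (H has_real_derivative H' s) (at s)"
    and le: "\<And>s. 0 < s \<Longrightarrow> s < t \<Longrightarrow> H' s + G s \<le> \<kappa>"
  shows "H t + (LBINT s:{0..t}. G s) \<le> H 0 + \<kappa> * t"
proof -
  have int: "set_integrable lborel {0..t} G"
    by (rule borel_integrable_atLeastAtMost') (use cG in auto)
  have eq: "(LBINT s:{0..t}. G s) = integral {0..t} G"
    using set_borel_integral_eq_integral(2)[OF int] .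
  define J where "J u = H u + integral {0..u} G - \<kappa> * u" for u
  have "J t \<le> J 0"
  proof (rule DERIV_nonpos_imp_decreasing_open[OF t])
    fix s assume s: "0 < s" "s < t"
    have "((\<lambda>u. integral {0..u} G) has_real_derivative G s) (at s within {0..t})"
      by (rule integral_has_real_derivative[OF cG]) (use s in auto)
    then have "((\<lambda>u. integral {0..u} G) has_real_derivative G s) (at s)"
      using s at_within_interior[of s "{0..t}"] by (simp add: interior_atLeastAtMost_real)
    then have "(J has_real_derivative (H' s + G s - \<kappa> * 1)) (at s)"
      unfolding J_def by (intro DERIV_add DERIV_diff DERIV_cmult DERIV_ident d s)
    then show "\<exists>y. (J has_real_derivative y) (at s) \<and> y \<le> 0" using le[OF s] by auto
  next
    show "continuous_on {0..t} J"
      unfolding J_def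
      by (intro continuous_on_add continuous_on_diff continuous_on_mult continuous_on_const continuous_on_id
        cH indefinite_integral_continuous_1[OF integrable_continuous_real[OF cG]])
  qed
  then show ?thesis by (simp add: J_def eq)
qed

context finite_chain begin

definition entropy :: "('a \<Rightarrow> real) \<Rightarrow> ('a \<Rightarrow> real) \<Rightarrow> real" where
  "entropy \<nu> h = (\<Sum>\<eta>\<in>X. \<nu> \<eta> * (h \<eta> * ln (h \<eta>)))"

definition energy :: "('a \<Rightarrow> real) \<Rightarrow> ('a \<Rightarrow> real) \<Rightarrow> real" where
  "energy \<nu> h = (\<Sum>\<eta>\<in>X. \<nu> \<eta> * (1 / 2 * (generator h \<eta> - 2 * sqrt (h \<eta>) * generator (\<lambda>\<xi>. sqrt (h \<xi>)) \<eta>)))"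

text \<open>The left side of \<open>key\<close> vanishes when \<open>\<nu>\<close> is stationary; in
  general one copy of the energy has to pay for it. Differentiating the entropy releases two copies,
  so one is left for the conclusion.\<close>

theorem entropy_energy_bound:
  assumes \<mu>: "\<And>\<eta>. \<eta> \<in> X \<Longrightarrow> 0 \<le> \<mu> \<eta>" "(\<Sum>\<eta>\<in>X. \<mu> \<eta>) = 1"
    and \<nu>: "\<And>\<eta>. \<eta> \<in> X \<Longrightarrow> 0 < \<nu> \<eta>"
    and irr: "\<And>S. S \<subseteq> X \<Longrightarrow> S \<noteq> {} \<Longrightarrow>
      (\<And>\<eta> b. \<eta> \<in> S \<Longrightarrow> b \<in> B \<Longrightarrow> 0 < r b \<eta> \<Longrightarrow> T b \<eta> \<in> S) \<Longrightarrow> S = X"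
    and key: "\<And>h. (\<And>\<eta>. \<eta> \<in> X \<Longrightarrow> 0 \<le> h \<eta>) \<Longrightarrow>
      (\<Sum>\<eta>\<in>X. \<nu> \<eta> * generator h \<eta>) \<le> energy \<nu> h + \<kappa> * (\<Sum>\<eta>\<in>X. \<nu> \<eta> * h \<eta>)"
    and t: "0 \<le> t"
  defines "f \<equiv> \<lambda>s \<eta>. law \<mu> s \<eta> / \<nu> \<eta>"
  shows "entropy \<nu> (f t) + (LBINT s:{0..t}. energy \<nu> (f s)) \<le> entropy \<nu> (f 0) + \<kappa> * t"
proof -
  define dm where "dm s \<xi> = (\<Sum>\<zeta>\<in>X. law \<mu> s \<zeta> * generator (indicator {\<xi>}) \<zeta>)" for s \<xi>
  have cm: "continuous_on S (\<lambda>s. law \<mu> s \<xi>)" for S \<xi>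
    by (intro continuous_at_imp_continuous_on ballI) (rule DERIV_isCont[OF law_deriv])
  have f0: "0 \<le> f s \<eta>" if "0 \<le> s" "\<eta> \<in> X" for s \<eta>
    unfolding f_def using law_nonneg[of \<mu> s \<eta>] \<mu>(1) that(1) \<nu>[OF that(2)] by (simp add: divide_nonneg_pos)
  have fpos: "0 < f s \<eta>" if "0 < s" "\<eta> \<in> X" for s \<eta>
  proof -
    have "0 < law \<mu> s \<eta>" by (rule law_pos) (fact \<mu> that irr)+
    then show ?thesis using \<nu>[OF that(2)] by (simp add: f_def)
  qed
  have cf: "continuous_on S (\<lambda>s. f s \<xi>)" if "\<xi> \<in> X" for S \<xi>
    unfolding f_def using \<nu>[OF that] by (intro continuous_on_divide[OF cm continuous_on_const]) auto
  have df: "((\<lambda>s. f s \<xi>) has_real_derivative dm s \<xi> / \<nu> \<xi>) (at s)" for s \<xi>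
    unfolding f_def dm_def by (rule DERIV_cdivide[OF law_deriv])
  define H' where "H' s = (\<Sum>\<eta>\<in>X. \<nu> \<eta> * (dm s \<eta> / \<nu> \<eta> * ln (f s \<eta>) + dm s \<eta> / \<nu> \<eta>))" for s
  show ?thesis
  proof (rule set_lebesgue_integral_decreasing[OF t, where G = "\<lambda>s. energy \<nu> (f s)" and \<kappa> = \<kappa> and H = "\<lambda>s. entropy \<nu> (f s)" and H' = H'])
    have "continuous_on {0..t} (\<lambda>s. f s \<eta> * ln (f s \<eta>))" if "\<eta> \<in> X" for \<eta>
    proof (rule continuous_on_compose2[of "{0..}" "\<lambda>x. x * ln x" "{0..t}" "\<lambda>s. f s \<eta>"])
      show "continuous_on {0..} (\<lambda>x::real. x * ln x)" by (rule continuous_on_mult_ln)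
      show "continuous_on {0..t} (\<lambda>s. f s \<eta>)" by (rule cf[OF that])
      show "(\<lambda>s. f s \<eta>) ` {0..t} \<subseteq> {0..}" unfolding image_subset_iff atLeast_iff
        by (intro ballI f0 that) simp
    qed
    then show "continuous_on {0..t} (\<lambda>s. entropy \<nu> (f s))"
      unfolding entropy_def by (intro continuous_on_sum continuous_on_mult_left)
    show "continuous_on {0..t} (\<lambda>s. energy \<nu> (f s))"
      unfolding energy_def generator_def
      by (intro continuous_on_sum continuous_on_mult continuous_on_diff continuous_on_real_sqrt
          continuous_on_const cf TX)
  next
    fix s assume s: "0 < s" "s < t"
    show "((\<lambda>s. entropy \<nu> (f s)) has_real_derivative H' s) (at s)"
      unfolding entropy_def H'_def
    proof (intro DERIV_sum DERIV_cmult)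
      fix \<eta> assume \<eta>: "\<eta> \<in> X"
      have "((\<lambda>s. ln (f s \<eta>)) has_real_derivative (dm s \<eta> / \<nu> \<eta>) * inverse (f s \<eta>)) (at s)"
        using DERIV_chain2[OF DERIV_ln[OF fpos[OF s(1) \<eta>]] df[of \<eta> s]] by (simp add: mult_ac)
      from DERIV_mult[OF df[of \<eta> s] this]
      show "((\<lambda>s. f s \<eta> * ln (f s \<eta>)) has_real_derivative
        (dm s \<eta> / \<nu> \<eta> * ln (f s \<eta>) + dm s \<eta> / \<nu> \<eta>)) (at s)"
        using fpos[OF s(1) \<eta>] by (simp add: mult_ac)
    qed
    define h where "h = f s"
    have h: "0 < h \<eta>" if "\<eta> \<in> X" for \<eta> using fpos s that by (simp add: h_def)
    have mh: "law \<mu> s \<eta> = \<nu> \<eta> * h \<eta>" if "\<eta> \<in> X" for \<eta>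
      using \<nu>[OF that] by (simp add: h_def f_def)
    have "H' s = (\<Sum>\<eta>\<in>X. ln (h \<eta>) * dm s \<eta>) + (\<Sum>\<eta>\<in>X. 1 * dm s \<eta>)"
      unfolding H'_def sum.distrib[symmetric]
    proof (rule sum.cong[OF refl])
      fix x assume "x \<in> X"
      then show "\<nu> x * (dm s x / \<nu> x * ln (f s x) + dm s x / \<nu> x) = ln (h x) * dm s x + 1 * dm s x"
        using \<nu>[of x] by (simp add: h_def field_simps)
    qed
    \<comment> \<open>The forward equation tested against ln h and against 1; the second test gives
      zero because the generator annihilates constants.\<close>
    also have "\<dots> = (\<Sum>\<eta>\<in>X. law \<mu> s \<eta> * generator (\<lambda>\<xi>. ln (h \<xi>)) \<eta>)"
      unfolding dm_def sum_law_deriv by (simp add: generator_def)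
    also have "\<dots> \<le> (\<Sum>\<eta>\<in>X. \<nu> \<eta> * (2 * sqrt (h \<eta>) * generator (\<lambda>\<xi>. sqrt (h \<xi>)) \<eta>))"
    proof (rule sum_mono)
      fix \<eta> assume \<eta>: "\<eta> \<in> X"
      have "h \<eta> * (r b \<eta> * (ln (h (T b \<eta>)) - ln (h \<eta>))) \<le>
          2 * sqrt (h \<eta>) * (r b \<eta> * (sqrt (h (T b \<eta>)) - sqrt (h \<eta>)))" if b: "b \<in> B" for b
      proof -
        define u v where "u = sqrt (h \<eta>)" and "v = sqrt (h (T b \<eta>))"
        have uv: "0 < u" "0 < v" using h[OF \<eta>] h[OF TX[OF b \<eta>]] by (auto simp: u_def v_def)
        have hu: "h \<eta> = u * u" "h (T b \<eta>) = v * v"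
          using h[OF \<eta>] h[OF TX[OF b \<eta>]] by (auto simp: u_def v_def)
        \<comment> \<open>Applied to the square roots rather than to the densities: ln (v * v) is
          twice ln v, and this produces the factor \<open>2 * u\<close> that occurs in the
          energy.\<close>
        have "ln (v / u) \<le> v / u - 1" using uv by (intro ln_le_minus_one) auto
        then have "ln v - ln u \<le> v / u - 1" using uv by (simp add: ln_div)
        then have "(u * u) * (2 * (ln v - ln u)) \<le> (u * u) * (2 * (v / u - 1))"
          using uv by (intro mult_left_mono) auto
        also have "\<dots> = 2 * u * (v - u)" using uv by (simp add: field_simps)
        finally have "(u * u) * (ln (v * v) - ln (u * u)) \<le> 2 * u * (v - u)"
          using uv by (simp add: ln_mult)
        from mult_left_mono[OF this r_nonneg[OF b \<eta>]]
        show ?thesis unfolding hu by (simp add: u_def[symmetric] v_def[symmetric] hu[symmetric] algebra_simps)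
      qed
      then have "h \<eta> * generator (\<lambda>\<xi>. ln (h \<xi>)) \<eta> \<le> 2 * sqrt (h \<eta>) * generator (\<lambda>\<xi>. sqrt (h \<xi>)) \<eta>"
        unfolding generator_def sum_distrib_left by (intro sum_mono) auto
      from mult_left_mono[OF this less_imp_le[OF \<nu>[OF \<eta>]]]
      show "law \<mu> s \<eta> * generator (\<lambda>\<xi>. ln (h \<xi>)) \<eta> \<le> \<nu> \<eta> * (2 * sqrt (h \<eta>) * generator (\<lambda>\<xi>. sqrt (h \<xi>)) \<eta>)"
        by (simp add: mh[OF \<eta>] mult_ac)
    qed
    also have "\<dots> = (\<Sum>\<eta>\<in>X. \<nu> \<eta> * generator h \<eta>) - 2 * energy \<nu> h"
      unfolding energy_def sum_distrib_left sum_subtractf[symmetric]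
      by (intro sum.cong refl) (simp add: algebra_simps)
    also have "\<dots> \<le> \<kappa> * (\<Sum>\<eta>\<in>X. \<nu> \<eta> * h \<eta>) - energy \<nu> h"
      using key[of h] h by (simp add: less_imp_le)
    also have "(\<Sum>\<eta>\<in>X. \<nu> \<eta> * h \<eta>) = 1"
      using mh sum_law[of \<mu> s] \<mu>(2) by simp
    finally show "H' s + energy \<nu> (f s) \<le> \<kappa>" by (simp add: h_def)
  qed
qed

end

section \<open>Weights invariant under exchanges\<close>

lemma exchange_exchange: "exchange (exchange \<eta> i j) i j = \<eta>"
  by (auto simp: exchange_def)

lemma exchange_commute: "exchange \<eta> i j = exchange \<eta> j i"
  by (auto simp: exchange_def fun_upd_twist)

lemma exchange_same [simp]: "exchange \<eta> i i = \<eta>"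
  by (simp add: exchange_def)

lemma exchange_in_Configs: "\<eta> \<in> Configs n \<Longrightarrow> i < n \<Longrightarrow> j < n \<Longrightarrow> exchange \<eta> i j \<in> Configs n"
  unfolding Configs_def exchange_def PiE_def Pi_def extensional_def by (auto simp: fun_upd_def)

lemma finite_Configs: "finite (Configs n)"
  unfolding Configs_def by (intro finite_PiE) auto

lemma Configs_cases: "\<eta> \<in> Configs n \<Longrightarrow> i < n \<Longrightarrow> \<eta> i = 0 \<or> \<eta> i = 1"
  by (auto simp: Configs_def PiE_def Pi_def)

lemma abs_spin: "\<eta> \<in> Configs n \<Longrightarrow> i < n \<Longrightarrow> \<bar>spin \<eta> i\<bar> = 1"
  using Configs_cases[of \<eta> n i] by (auto simp: spin_def)

text \<open>Invariance is demanded for exchanges of arbitrary pairs, because the complete graph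
  serves as an intermediate dynamics.\<close>

locale exchangeable =
  fixes n :: nat and \<nu> :: "(nat \<Rightarrow> nat) \<Rightarrow> real"
  assumes n3: "3 \<le> n"
    and nu_nonneg: "\<And>\<eta>. \<eta> \<in> Configs n \<Longrightarrow> 0 \<le> \<nu> \<eta>"
    and nu_exchange: "\<And>\<eta> i j. \<eta> \<in> Configs n \<Longrightarrow> i < n \<Longrightarrow> j < n \<Longrightarrow> \<nu> (exchange \<eta> i j) = \<nu> \<eta>"
begin

definition ev :: "((nat \<Rightarrow> nat) \<Rightarrow> real) \<Rightarrow> real" where
  "ev g = (\<Sum>\<eta>\<in>Configs n. \<nu> \<eta> * g \<eta>)"

lemma ev_add: "ev (\<lambda>\<eta>. f \<eta> + g \<eta>) = ev f + ev g"
  by (simp add: ev_def sum.distrib distrib_left)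

lemma ev_diff: "ev (\<lambda>\<eta>. f \<eta> - g \<eta>) = ev f - ev g"
  by (simp add: ev_def sum_subtractf right_diff_distrib)

lemma ev_cmult: "ev (\<lambda>\<eta>. c * f \<eta>) = c * ev f"
  by (simp add: ev_def sum_distrib_left mult_ac)

lemma ev_sum: "ev (\<lambda>\<eta>. \<Sum>i\<in>I. f i \<eta>) = (\<Sum>i\<in>I. ev (f i))"
  unfolding ev_def sum_distrib_left by (rule sum.swap)

lemma ev_mono: "(\<And>\<eta>. \<eta> \<in> Configs n \<Longrightarrow> f \<eta> \<le> g \<eta>) \<Longrightarrow> ev f \<le> ev g"
  unfolding ev_def by (intro sum_mono mult_left_mono nu_nonneg)

lemma ev_cong: "(\<And>\<eta>. \<eta> \<in> Configs n \<Longrightarrow> f \<eta> = g \<eta>) \<Longrightarrow> ev f = ev g"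
  unfolding ev_def by (intro sum.cong) auto

lemma ev_nonneg: "(\<And>\<eta>. \<eta> \<in> Configs n \<Longrightarrow> 0 \<le> f \<eta>) \<Longrightarrow> 0 \<le> ev f"
  unfolding ev_def by (intro sum_nonneg mult_nonneg_nonneg nu_nonneg)

lemma ev_exchange:
  assumes "i < n" "j < n"
  shows "ev (\<lambda>\<eta>. g (exchange \<eta> i j)) = ev g"
proof -
  have "bij_betw (\<lambda>\<eta>. exchange \<eta> i j) (Configs n) (Configs n)"
    by (rule bij_betwI[where g="\<lambda>\<eta>. exchange \<eta> i j"])
      (auto simp: exchange_exchange intro: exchange_in_Configs assms)
  from sum.reindex_bij_betw[OF this, of "\<lambda>\<eta>. \<nu> \<eta> * g \<eta>"]
  show ?thesis by (simp add: ev_def nu_exchange assms)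
qed

text \<open>Encoded by \<open>L2_set\<close> in order to inherit Minkowski's inequality.\<close>

definition nrm :: "((nat \<Rightarrow> nat) \<Rightarrow> real) \<Rightarrow> real" where
  "nrm f = L2_set (\<lambda>\<eta>. sqrt (\<nu> \<eta>) * f \<eta>) (Configs n)"

lemma nrm_square: "(nrm f)\<^sup>2 = ev (\<lambda>\<eta>. (f \<eta>)\<^sup>2)"
  unfolding nrm_def L2_set_def ev_def
  by (subst real_sqrt_pow2) (auto intro!: sum_nonneg sum.cong simp: power_mult_distrib nu_nonneg)

lemma nrm_eq: "nrm f = sqrt (ev (\<lambda>\<eta>. (f \<eta>)\<^sup>2))"
  unfolding nrm_square[symmetric] by (simp add: nrm_def)

lemma nrm_add: "nrm (\<lambda>\<eta>. f \<eta> + g \<eta>) \<le> nrm f + nrm g"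
  unfolding nrm_def distrib_left by (rule L2_set_triangle_ineq)

lemma nrm_exchange: "i < n \<Longrightarrow> j < n \<Longrightarrow> nrm (\<lambda>\<eta>. f (exchange \<eta> i j)) = nrm f"
  unfolding nrm_eq by (simp add: ev_exchange[where g="\<lambda>\<eta>. (f \<eta>)\<^sup>2"])

section \<open>Dirichlet forms and moving particles\<close>

definition bond :: "((nat \<Rightarrow> nat) \<Rightarrow> real) \<Rightarrow> nat \<Rightarrow> nat \<Rightarrow> real" where
  "bond \<phi> i j = ev (\<lambda>\<eta>. (\<phi> (exchange \<eta> i j) - \<phi> \<eta>)\<^sup>2)"

definition dirichlet :: "((nat \<Rightarrow> nat) \<Rightarrow> real) \<Rightarrow> real" where
  "dirichlet \<phi> = (\<Sum>k<n. bond \<phi> k (succ_site n k))"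

lemma bond_nonneg: "0 \<le> bond \<phi> i j"
  unfolding bond_def by (rule ev_nonneg) auto

lemma bond_commute: "bond \<phi> i j = bond \<phi> j i"
  by (simp add: bond_def exchange_commute)

text \<open>A long exchange is a shorter one conjugated by a neighbouring exchange. By invariance of
  the weights each of the three factors contributes the norm of its own increment, so every bond on
  the way is used at most twice.\<close>

lemma moving_particle:
  assumes "i < j" "j < n"
  shows "sqrt (bond \<phi> i j) \<le> 2 * (\<Sum>k=i..<j. sqrt (bond \<phi> k (Suc k)))"
  using assms
proof (induction j)
  case (Suc j)
  show ?case
  proof (cases "i = j")
    case True
    then show ?thesis by (simp add: bond_nonneg)
  next
    case False
    then have ij: "i < j" "j < n" using Suc.prems by auto
    define \<tau> where "\<tau> \<eta> = exchange \<eta> j (Suc j)" for \<eta> :: "nat \<Rightarrow> nat"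
    define \<rho> where "\<rho> \<eta> = exchange \<eta> i j" for \<eta> :: "nat \<Rightarrow> nat"
    have conj: "exchange \<eta> i (Suc j) = \<tau> (\<rho> (\<tau> \<eta>))" for \<eta>
      using ij by (auto simp: \<tau>_def \<rho>_def exchange_def fun_eq_iff)
    have b: "sqrt (bond \<phi> p q) = nrm (\<lambda>\<eta>. \<phi> (exchange \<eta> p q) - \<phi> \<eta>)" for p q
      by (simp add: bond_def nrm_eq)
    have "sqrt (bond \<phi> i (Suc j)) = nrm (\<lambda>\<eta>. (\<phi> (\<tau> (\<rho> (\<tau> \<eta>))) - \<phi> (\<rho> (\<tau> \<eta>)))
        + ((\<phi> (\<rho> (\<tau> \<eta>)) - \<phi> (\<tau> \<eta>)) + (\<phi> (\<tau> \<eta>) - \<phi> \<eta>)))"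
      by (simp add: b conj)
    also have "\<dots> \<le> nrm (\<lambda>\<eta>. \<phi> (\<tau> (\<rho> (\<tau> \<eta>))) - \<phi> (\<rho> (\<tau> \<eta>)))
        + (nrm (\<lambda>\<eta>. \<phi> (\<rho> (\<tau> \<eta>)) - \<phi> (\<tau> \<eta>)) + nrm (\<lambda>\<eta>. \<phi> (\<tau> \<eta>) - \<phi> \<eta>))"
      by (rule order_trans[OF nrm_add add_left_mono[OF nrm_add]])
    also have "nrm (\<lambda>\<eta>. \<phi> (\<rho> (\<tau> \<eta>)) - \<phi> (\<tau> \<eta>)) = nrm (\<lambda>\<eta>. \<phi> (\<rho> \<eta>) - \<phi> \<eta>)"
      using nrm_exchange[of j "Suc j" "\<lambda>\<eta>. \<phi> (\<rho> \<eta>) - \<phi> \<eta>"] Suc.prems by (simp add: \<tau>_def)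
    also have "nrm (\<lambda>\<eta>. \<phi> (\<tau> (\<rho> (\<tau> \<eta>))) - \<phi> (\<rho> (\<tau> \<eta>))) = nrm (\<lambda>\<eta>. \<phi> (\<tau> (\<rho> \<eta>)) - \<phi> (\<rho> \<eta>))"
      using nrm_exchange[of j "Suc j" "\<lambda>\<eta>. \<phi> (\<tau> (\<rho> \<eta>)) - \<phi> (\<rho> \<eta>)"] Suc.prems by (simp add: \<tau>_def)
    also have "\<dots> = nrm (\<lambda>\<eta>. \<phi> (\<tau> \<eta>) - \<phi> \<eta>)"
      using nrm_exchange[of i j "\<lambda>\<eta>. \<phi> (\<tau> \<eta>) - \<phi> \<eta>"] ij by (simp add: \<rho>_def)
    finally have "sqrt (bond \<phi> i (Suc j)) \<le> 2 * sqrt (bond \<phi> j (Suc j)) + sqrt (bond \<phi> i j)"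
      unfolding b by (simp add: \<tau>_def \<rho>_def)
    then show ?thesis using Suc.IH[OF ij] ij by simp
  qed
qed simp

text \<open>The path stays between the two sites and avoids the bond that closes the circle.
  Cauchy-Schwarz over its at most n bonds costs the factor n.\<close>

lemma bond_le_dirichlet:
  assumes "i < n" "j < n"
  shows "bond \<phi> i j \<le> 4 * real n * dirichlet \<phi>"
proof -
  have main: "bond \<phi> i j \<le> 4 * real n * dirichlet \<phi>" if "i < j" "j < n" for i j
  proof -
    have "bond \<phi> i j = (sqrt (bond \<phi> i j))\<^sup>2" by (simp add: bond_nonneg)
    also have "\<dots> \<le> (2 * (\<Sum>k=i..<j. sqrt (bond \<phi> k (Suc k))))\<^sup>2"
      by (intro power_mono moving_particle that) (simp add: bond_nonneg)
    also have "\<dots> = 4 * (\<Sum>k=i..<j. sqrt (bond \<phi> k (Suc k)))\<^sup>2" by (simp add: power_mult_distrib)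
    also have "\<dots> \<le> 4 * ((\<Sum>k=i..<j. (sqrt (bond \<phi> k (Suc k)))\<^sup>2) * card {i..<j})"
      by (intro mult_left_mono sum_squared_le_sum_of_squares) auto
    also have "(\<Sum>k=i..<j. (sqrt (bond \<phi> k (Suc k)))\<^sup>2) = (\<Sum>k=i..<j. bond \<phi> k (succ_site n k))"
      using that by (intro sum.cong refl) (simp add: bond_nonneg succ_site_def)
    also have "4 * ((\<Sum>k=i..<j. bond \<phi> k (succ_site n k)) * card {i..<j}) \<le> 4 * (dirichlet \<phi> * real n)"
      unfolding dirichlet_def using that
      by (intro mult_left_mono mult_mono sum_mono2) (auto simp: bond_nonneg intro!: sum_nonneg)
    finally show ?thesis by (simp add: mult_ac)
  qed
  have D0: "0 \<le> dirichlet \<phi>" by (auto simp: dirichlet_def bond_nonneg intro!: sum_nonneg)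
  consider "i < j" | "j < i" | "i = j" by linarith
  then show ?thesis
  proof cases
    case 3
    have "bond \<phi> i i = 0" by (simp add: bond_def ev_def)
    then show ?thesis using D0 3 by simp
  qed (use main assms bond_commute in metis)+
qed

lemma dirichlet_nonneg: "0 \<le> dirichlet \<phi>"
  by (auto simp: dirichlet_def bond_nonneg intro!: sum_nonneg)

text \<open>Integration by parts in the form of an inequality: it is enough to compare sums over a
  configuration and its exchange. The left side is counted twice there and \<open>u\<close> once,
  whence the half.\<close>

lemma ev_symmetrized:
  assumes "i < n" "j < n"
    and "\<And>\<eta>. \<eta> \<in> Configs n \<Longrightarrow> g \<eta> + g (exchange \<eta> i j) \<le> u \<eta> + (v \<eta> + v (exchange \<eta> i j))"
  shows "ev g \<le> ev u / 2 + ev v"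
proof -
  have "ev (\<lambda>\<eta>. g \<eta> + g (exchange \<eta> i j)) \<le> ev (\<lambda>\<eta>. u \<eta> + (v \<eta> + v (exchange \<eta> i j)))"
    by (rule ev_mono) (rule assms(3))
  then show ?thesis by (simp add: ev_add ev_exchange assms)
qed

end

section \<open>Integration by parts across one exchange\<close>

lemma square_sum_le: "(p + q)\<^sup>2 \<le> 2 * p\<^sup>2 + 2 * (q::real)\<^sup>2"
  using sum_squares_bound[of p q] by (simp add: power2_sum)

text \<open>Separates the two configurations: \<open>p\<close> meets only \<open>h\<close> and
  \<open>p'\<close> only \<open>h'\<close>, at the price of the increment \<open>c\<close>. Each
  part then depends on one configuration and can be moved by invariance of the weights.\<close>

lemma young_product:
  fixes p p' h h' :: real
  assumes "\<bar>h' - h\<bar> \<le> c"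
  shows "(p' + p)\<^sup>2 * (h + h')\<^sup>2 \<le> 2 * (p\<^sup>2 * (8 * h\<^sup>2 + 2 * c\<^sup>2)) + 2 * (p'\<^sup>2 * (8 * h'\<^sup>2 + 2 * c\<^sup>2))"
proof -
  have d: "(h' - h)\<^sup>2 \<le> c\<^sup>2" using power_mono[OF assms, of 2] by simp
  have 1: "(h + h')\<^sup>2 \<le> 8 * h\<^sup>2 + 2 * c\<^sup>2" using square_sum_le[of "2 * h" "h' - h"] d by (simp add: power_mult_distrib)
  have 2: "(h + h')\<^sup>2 \<le> 8 * h'\<^sup>2 + 2 * c\<^sup>2" using square_sum_le[of "2 * h'" "h - h'"] d
    by (simp add: power_mult_distrib power2_commute add.commute)
  have "(p' + p)\<^sup>2 * (h + h')\<^sup>2 \<le> (2 * p'\<^sup>2 + 2 * p\<^sup>2) * (h + h')\<^sup>2"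
    by (intro mult_right_mono square_sum_le) auto
  also have "\<dots> = 2 * (p\<^sup>2 * (h + h')\<^sup>2) + 2 * (p'\<^sup>2 * (h + h')\<^sup>2)" by (simp add: algebra_simps)
  also have "\<dots> \<le> 2 * (p\<^sup>2 * (8 * h\<^sup>2 + 2 * c\<^sup>2)) + 2 * (p'\<^sup>2 * (8 * h'\<^sup>2 + 2 * c\<^sup>2))"
    using 1 2 by (intro add_mono mult_left_mono) auto
  finally show ?thesis .
qed

text \<open>The difference of the products splits into the increment of \<open>p\<close> times
  \<open>h + h'\<close> and the increment of \<open>h\<close> times the sum of squares. Young's
  inequality treats the first; the second is already of size \<open>c\<close>.\<close>

lemma young_antisymmetric:
  fixes p p' h h' k :: real
  assumes "\<bar>h' - h\<bar> \<le> c" "\<bar>k\<bar> \<le> C" "0 < \<beta>"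
  shows "k * (p\<^sup>2 * h - p'\<^sup>2 * h') \<le> 2 * \<beta> * (p' - p)\<^sup>2
    + (C\<^sup>2 / (16 * \<beta>) * (p\<^sup>2 * (8 * h\<^sup>2 + 2 * c\<^sup>2)) + C * c / 2 * p\<^sup>2
      + (C\<^sup>2 / (16 * \<beta>) * (p'\<^sup>2 * (8 * h'\<^sup>2 + 2 * c\<^sup>2)) + C * c / 2 * p'\<^sup>2))"
proof -
  have C: "0 \<le> C" and c: "0 \<le> c" using assms(1,2) by linarith+
  define w where "w = (p' + p) * (h + h')"
  have "k * (p\<^sup>2 * h - p'\<^sup>2 * h') = - (k / 2) * (p' - p) * w + k * (h - h') / 2 * (p\<^sup>2 + p'\<^sup>2)"
    by (simp add: w_def power2_eq_square algebra_simps) (simp add: field_simps)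
  moreover have "k * (h - h') / 2 * (p\<^sup>2 + p'\<^sup>2) \<le> C * c / 2 * (p\<^sup>2 + p'\<^sup>2)"
  proof (intro mult_right_mono divide_right_mono)
    have "\<bar>k * (h - h')\<bar> \<le> C * c" unfolding abs_mult using assms by (intro mult_mono) auto
    then show "k * (h - h') \<le> C * c" by linarith
  qed auto
  moreover have "- (k / 2) * (p' - p) * w \<le> 2 * \<beta> * (p' - p)\<^sup>2 + C\<^sup>2 / (32 * \<beta>) * w\<^sup>2"
  proof -
    \<comment> \<open>The weight is \<open>2 * \<beta>\<close> because \<open>ev_symmetrized\<close>
      will halve it.\<close>
    have "0 \<le> 2 * \<beta> * ((p' - p) + k / (8 * \<beta>) * w)\<^sup>2" using assms(3) by simp
    also have "\<dots> = 2 * \<beta> * (p' - p)\<^sup>2 + k / 2 * (p' - p) * w + k\<^sup>2 / (32 * \<beta>) * w\<^sup>2"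
      using assms(3) by (simp add: power2_eq_square field_simps)
    finally have "- (k / 2) * (p' - p) * w \<le> 2 * \<beta> * (p' - p)\<^sup>2 + k\<^sup>2 / (32 * \<beta>) * w\<^sup>2" by simp
    moreover have "k\<^sup>2 / (32 * \<beta>) * w\<^sup>2 \<le> C\<^sup>2 / (32 * \<beta>) * w\<^sup>2"
      using assms power_mono[OF assms(2), of 2] by (intro mult_right_mono divide_right_mono) auto
    ultimately show ?thesis by linarith
  qed
  moreover have "C\<^sup>2 / (32 * \<beta>) * w\<^sup>2 \<le> C\<^sup>2 / (32 * \<beta>) *
      (2 * (p\<^sup>2 * (8 * h\<^sup>2 + 2 * c\<^sup>2)) + 2 * (p'\<^sup>2 * (8 * h'\<^sup>2 + 2 * c\<^sup>2)))"
    unfolding w_def power_mult_distrib using young_product[OF assms(1), of p' p] assms(3)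
    by (intro mult_left_mono) auto
  moreover have "C\<^sup>2 / (32 * \<beta>) * (2 * (p\<^sup>2 * (8 * h\<^sup>2 + 2 * c\<^sup>2)) + 2 * (p'\<^sup>2 * (8 * h'\<^sup>2 + 2 * c\<^sup>2)))
    = C\<^sup>2 / (16 * \<beta>) * (p\<^sup>2 * (8 * h\<^sup>2 + 2 * c\<^sup>2)) + C\<^sup>2 / (16 * \<beta>) * (p'\<^sup>2 * (8 * h'\<^sup>2 + 2 * c\<^sup>2))"
  proof -
    have "C\<^sup>2 / (32 * \<beta>) * (2 * A + 2 * A') = C\<^sup>2 / (16 * \<beta>) * A + C\<^sup>2 / (16 * \<beta>) * A'" for A A'
      using assms(3) by (simp add: field_simps)
    then show ?thesis .
  qed
  moreover have "C * c / 2 * (p\<^sup>2 + p'\<^sup>2) = C * c / 2 * p\<^sup>2 + C * c / 2 * p'\<^sup>2"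
    by (rule distrib_left)
  ultimately show ?thesis by linarith
qed

context exchangeable begin

text \<open>Antisymmetry of \<open>k\<close> turns the integral into one of differences. Thus
  \<open>h\<close> is felt only through its increment and its second moment, and no uniform bound on
  \<open>h\<close> enters.\<close>

lemma ev_antisymmetric_le:
  assumes ij: "i < n" "j < n"
    and diff: "\<And>\<eta>. \<eta> \<in> Configs n \<Longrightarrow> \<bar>h (exchange \<eta> i j) - h \<eta>\<bar> \<le> c"
    and k: "\<And>\<eta>. \<eta> \<in> Configs n \<Longrightarrow> \<bar>k \<eta>\<bar> \<le> C"
    and anti: "\<And>\<eta>. \<eta> \<in> Configs n \<Longrightarrow> k (exchange \<eta> i j) = - k \<eta>"
    and \<beta>: "0 < \<beta>"
  shows "ev (\<lambda>\<eta>. (\<phi> \<eta>)\<^sup>2 * (k \<eta> * h \<eta>)) \<le> \<beta> * bond \<phi> i j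
    + C\<^sup>2 / (16 * \<beta>) * (8 * ev (\<lambda>\<eta>. (\<phi> \<eta>)\<^sup>2 * (h \<eta>)\<^sup>2) + 2 * c\<^sup>2 * ev (\<lambda>\<eta>. (\<phi> \<eta>)\<^sup>2))
    + C * c / 2 * ev (\<lambda>\<eta>. (\<phi> \<eta>)\<^sup>2)"
proof -
  define v where "v \<eta> = C\<^sup>2 / (16 * \<beta>) * ((\<phi> \<eta>)\<^sup>2 * (8 * (h \<eta>)\<^sup>2 + 2 * c\<^sup>2)) + C * c / 2 * (\<phi> \<eta>)\<^sup>2" for \<eta>
  have v: "v \<eta> = C\<^sup>2 / (16 * \<beta>) * (8 * ((\<phi> \<eta>)\<^sup>2 * (h \<eta>)\<^sup>2) + 2 * c\<^sup>2 * (\<phi> \<eta>)\<^sup>2) + C * c / 2 * (\<phi> \<eta>)\<^sup>2" for \<eta>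
    by (simp add: v_def algebra_simps)
  have "ev (\<lambda>\<eta>. (\<phi> \<eta>)\<^sup>2 * (k \<eta> * h \<eta>)) \<le> ev (\<lambda>\<eta>. 2 * \<beta> * (\<phi> (exchange \<eta> i j) - \<phi> \<eta>)\<^sup>2) / 2 + ev v"
  proof (rule ev_symmetrized[OF ij])
    fix \<eta> assume \<eta>: "\<eta> \<in> Configs n"
    have "(\<phi> \<eta>)\<^sup>2 * (k \<eta> * h \<eta>) + (\<phi> (exchange \<eta> i j))\<^sup>2 * (k (exchange \<eta> i j) * h (exchange \<eta> i j))
       = k \<eta> * ((\<phi> \<eta>)\<^sup>2 * h \<eta> - (\<phi> (exchange \<eta> i j))\<^sup>2 * h (exchange \<eta> i j))"
      unfolding anti[OF \<eta>] by (simp add: algebra_simps)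
    also have "\<dots> \<le> 2 * \<beta> * (\<phi> (exchange \<eta> i j) - \<phi> \<eta>)\<^sup>2 + (v \<eta> + v (exchange \<eta> i j))"
      using young_antisymmetric[OF diff[OF \<eta>] k[OF \<eta>] \<beta>, of "\<phi> \<eta>" "\<phi> (exchange \<eta> i j)"]
      by (simp add: v_def)
    finally show "(\<phi> \<eta>)\<^sup>2 * (k \<eta> * h \<eta>) + (\<phi> (exchange \<eta> i j))\<^sup>2 * (k (exchange \<eta> i j) * h (exchange \<eta> i j))
      \<le> 2 * \<beta> * (\<phi> (exchange \<eta> i j) - \<phi> \<eta>)\<^sup>2 + (v \<eta> + v (exchange \<eta> i j))" .
  qed
  moreover have "ev v = C\<^sup>2 / (16 * \<beta>) * (8 * ev (\<lambda>\<eta>. (\<phi> \<eta>)\<^sup>2 * (h \<eta>)\<^sup>2) + 2 * c\<^sup>2 * ev (\<lambda>\<eta>. (\<phi> \<eta>)\<^sup>2))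
    + C * c / 2 * ev (\<lambda>\<eta>. (\<phi> \<eta>)\<^sup>2)"
    unfolding v[abs_def] by (simp only: ev_add ev_cmult)
  moreover have "ev (\<lambda>\<eta>. 2 * \<beta> * (\<phi> (exchange \<eta> i j) - \<phi> \<eta>)\<^sup>2) / 2 = \<beta> * bond \<phi> i j"
    unfolding bond_def by (simp only: ev_cmult)
  ultimately show ?thesis by linarith
qed

text \<open>Averaging over all exchanges has a spectral gap of order one, and
  \<open>h\<close> is close to one of its eigenfunctions.\<close>

lemma ev_square_le:
  fixes h \<phi> :: "(nat \<Rightarrow> nat) \<Rightarrow> real"
  assumes diff: "\<And>\<eta> i j. \<eta> \<in> Configs n \<Longrightarrow> i < n \<Longrightarrow> j < n \<Longrightarrow> \<bar>h (exchange \<eta> i j) - h \<eta>\<bar> \<le> c"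
    and eig: "\<And>\<eta>. \<eta> \<in> Configs n \<Longrightarrow>
      \<bar>(\<Sum>i<n. \<Sum>j<n. h (exchange \<eta> i j) - h \<eta>) / real n + l * h \<eta>\<bar> \<le> c"
    and l: "2 \<le> l" and c: "0 < c"
  shows "ev (\<lambda>\<eta>. (\<phi> \<eta>)\<^sup>2 * (h \<eta>)\<^sup>2)
    \<le> 4 * c\<^sup>2 * real n ^ 3 * dirichlet \<phi> + 2 * c\<^sup>2 * real n * ev (\<lambda>\<eta>. (\<phi> \<eta>)\<^sup>2)"
proof -
  define Y where "Y = ev (\<lambda>\<eta>. (\<phi> \<eta>)\<^sup>2 * (h \<eta>)\<^sup>2)"
  define F where "F = ev (\<lambda>\<eta>. (\<phi> \<eta>)\<^sup>2)"
  have npos: "1 \<le> real n" using n3 by simp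
  have F0: "0 \<le> F" unfolding F_def by (rule ev_nonneg) auto
  define k where "k i j \<eta> = h \<eta> - h (exchange \<eta> i j)" for i j \<eta>
  have pair: "ev (\<lambda>\<eta>. (\<phi> \<eta>)\<^sup>2 * (k i j \<eta> * h \<eta>))
     \<le> 4 * (real n)\<^sup>2 * c\<^sup>2 * dirichlet \<phi> + ((Y / 2 + c\<^sup>2 / 8 * F) / real n + c\<^sup>2 / 2 * F)"
    if ij: "i < n" "j < n" for i j
  proof -
    \<comment> \<open>The Young weight \<open>real n * c\<^sup>2\<close> gives \<open>Y\<close> the
      coefficient 1/(2n). Over n^2 pairs, with the prefactor 1/n, this amounts to Y/2, which the
      left side absorbs.\<close>
    have "ev (\<lambda>\<eta>. (\<phi> \<eta>)\<^sup>2 * (k i j \<eta> * h \<eta>)) \<le> (real n * c\<^sup>2) * bond \<phi> i j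
        + c\<^sup>2 / (16 * (real n * c\<^sup>2)) * (8 * Y + 2 * c\<^sup>2 * F) + c * c / 2 * F"
      unfolding Y_def F_def
    proof (rule ev_antisymmetric_le[OF ij])
      fix \<eta> assume \<eta>: "\<eta> \<in> Configs n"
      show "\<bar>h (exchange \<eta> i j) - h \<eta>\<bar> \<le> c" by (rule diff[OF \<eta> ij])
      then show "\<bar>k i j \<eta>\<bar> \<le> c" by (simp add: k_def abs_minus_commute)
      show "k i j (exchange \<eta> i j) = - k i j \<eta>" by (simp add: k_def exchange_exchange)
    qed (use c npos in simp)
    also have "c\<^sup>2 / (16 * (real n * c\<^sup>2)) * (8 * Y + 2 * c\<^sup>2 * F) = (Y / 2 + c\<^sup>2 / 8 * F) / real n"
      using c npos by (simp add: field_simps)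
    also have "c * c / 2 * F = c\<^sup>2 / 2 * F" by (simp add: power2_eq_square)
    also have "(real n * c\<^sup>2) * bond \<phi> i j \<le> (real n * c\<^sup>2) * (4 * real n * dirichlet \<phi>)"
      by (intro mult_left_mono bond_le_dirichlet ij) auto
    also have "\<dots> = 4 * (real n)\<^sup>2 * c\<^sup>2 * dirichlet \<phi>" by (simp add: power2_eq_square)
    finally show ?thesis by simp
  qed
  \<comment> \<open>3/2 is the lower bound 2 for \<open>l\<close> minus the 1/2 lost when the
    eigenvalue error is split off by Young's inequality.\<close>
  have "3 / 2 * Y = ev (\<lambda>\<eta>. 3 / 2 * ((\<phi> \<eta>)\<^sup>2 * (h \<eta>)\<^sup>2))" by (simp only: Y_def ev_cmult)
  also have "\<dots> \<le> ev (\<lambda>\<eta>. c\<^sup>2 / 2 * (\<phi> \<eta>)\<^sup>2 + 1 / real n * (\<Sum>i<n. \<Sum>j<n. (\<phi> \<eta>)\<^sup>2 * (k i j \<eta> * h \<eta>)))"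
  proof (rule ev_mono)
    fix \<eta> assume \<eta>: "\<eta> \<in> Configs n"
    define A where "A = (\<Sum>i<n. \<Sum>j<n. h (exchange \<eta> i j) - h \<eta>) / real n"
    have "h \<eta> * (A + l * h \<eta>) \<le> \<bar>h \<eta>\<bar> * c"
      using mult_left_mono[OF eig[OF \<eta>, folded A_def], of "\<bar>h \<eta>\<bar>"] abs_ge_self[of "h \<eta> * (A + l * h \<eta>)"]
      by (simp add: abs_mult)
    also have "\<dots> \<le> (h \<eta>)\<^sup>2 / 2 + c\<^sup>2 / 2"
      using sum_squares_bound[of "\<bar>h \<eta>\<bar>" c] by simp
    finally have "l * (h \<eta>)\<^sup>2 \<le> (h \<eta>)\<^sup>2 / 2 + c\<^sup>2 / 2 - h \<eta> * A"
      by (simp add: algebra_simps power2_eq_square)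
    moreover have "2 * (h \<eta>)\<^sup>2 \<le> l * (h \<eta>)\<^sup>2" using l by (intro mult_right_mono) auto
    ultimately have "3 / 2 * (h \<eta>)\<^sup>2 \<le> c\<^sup>2 / 2 - h \<eta> * A" by linarith
    from mult_left_mono[OF this, of "(\<phi> \<eta>)\<^sup>2"]
    have "3 / 2 * ((\<phi> \<eta>)\<^sup>2 * (h \<eta>)\<^sup>2) \<le> c\<^sup>2 / 2 * (\<phi> \<eta>)\<^sup>2 - (\<phi> \<eta>)\<^sup>2 * h \<eta> * A"
      by (simp add: algebra_simps)
    moreover have "- ((\<phi> \<eta>)\<^sup>2 * h \<eta> * A) = 1 / real n * (\<Sum>i<n. \<Sum>j<n. (\<phi> \<eta>)\<^sup>2 * (k i j \<eta> * h \<eta>))"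
    proof -
      have "(\<Sum>i<n. \<Sum>j<n. (\<phi> \<eta>)\<^sup>2 * (k i j \<eta> * h \<eta>))
          = (\<Sum>i<n. \<Sum>j<n. - ((\<phi> \<eta>)\<^sup>2 * h \<eta>) * (h (exchange \<eta> i j) - h \<eta>))"
        by (intro sum.cong refl) (simp add: k_def algebra_simps)
      then show ?thesis by (simp add: A_def sum_distrib_left[symmetric] sum_negf)
    qed
    ultimately show "3 / 2 * ((\<phi> \<eta>)\<^sup>2 * (h \<eta>)\<^sup>2)
      \<le> c\<^sup>2 / 2 * (\<phi> \<eta>)\<^sup>2 + 1 / real n * (\<Sum>i<n. \<Sum>j<n. (\<phi> \<eta>)\<^sup>2 * (k i j \<eta> * h \<eta>))" by linarith
  qed
  also have "\<dots> = c\<^sup>2 / 2 * F + 1 / real n * (\<Sum>i<n. \<Sum>j<n. ev (\<lambda>\<eta>. (\<phi> \<eta>)\<^sup>2 * (k i j \<eta> * h \<eta>)))"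
    by (simp only: ev_add ev_cmult ev_sum F_def)
  also have "\<dots> \<le> c\<^sup>2 / 2 * F + 1 / real n * (\<Sum>i<n. \<Sum>j<n. 4 * (real n)\<^sup>2 * c\<^sup>2 * dirichlet \<phi> + ((Y / 2 + c\<^sup>2 / 8 * F) / real n + c\<^sup>2 / 2 * F))"
    by (intro add_left_mono mult_left_mono sum_mono pair) auto
  also have "\<dots> = c\<^sup>2 / 2 * F + 4 * c\<^sup>2 * real n ^ 3 * dirichlet \<phi> + Y / 2 + c\<^sup>2 / 8 * F + real n * (c\<^sup>2 / 2 * F)"
    using npos by (simp add: field_simps power2_eq_square power3_eq_cube)
  finally have "Y \<le> 4 * c\<^sup>2 * real n ^ 3 * dirichlet \<phi> + 5 / 8 * (c\<^sup>2 * F) + real n * (c\<^sup>2 * F) / 2"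
    by (simp add: algebra_simps)
  moreover have "1 * (c\<^sup>2 * F) \<le> real n * (c\<^sup>2 * F)" using npos F0 by (intro mult_right_mono) auto
  moreover have "0 \<le> real n * (c\<^sup>2 * F)" using F0 by simp
  ultimately have "Y \<le> 4 * c\<^sup>2 * real n ^ 3 * dirichlet \<phi> + 2 * (real n * (c\<^sup>2 * F))"
    by linarith
  then show ?thesis by (simp add: Y_def F_def mult_ac)
qed

text \<open>\<open>\<kappa>\<close> is invariant, so its product with the spin difference stays
  antisymmetric across the bond. Increments of order one suffice for the second moment of
  \<open>h k\<close>; across its own bond order 1/n is required, because the remainder linear in
  that increment is summed over n bonds.\<close>

lemma ev_gradient_sum_le:
  fixes h :: "nat \<Rightarrow> (nat \<Rightarrow> nat) \<Rightarrow> real"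
  assumes h_diff: "\<And>k \<eta> i j. k < n \<Longrightarrow> \<eta> \<in> Configs n \<Longrightarrow> i < n \<Longrightarrow> j < n \<Longrightarrow> \<bar>h k (exchange \<eta> i j) - h k \<eta>\<bar> \<le> c"
    and h_eig: "\<And>k \<eta>. k < n \<Longrightarrow> \<eta> \<in> Configs n \<Longrightarrow>
      \<bar>(\<Sum>i<n. \<Sum>j<n. h k (exchange \<eta> i j) - h k \<eta>) / real n + l * h k \<eta>\<bar> \<le> c"
    and h_bond: "\<And>k \<eta>. k < n \<Longrightarrow> \<eta> \<in> Configs n \<Longrightarrow> \<bar>h k (exchange \<eta> k (succ_site n k)) - h k \<eta>\<bar> \<le> c / real n"
    and l: "2 \<le> l" and c: "0 < c"
    and \<kappa>: "\<And>\<eta>. \<eta> \<in> Configs n \<Longrightarrow> \<bar>\<kappa> \<eta>\<bar> \<le> C"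
    and \<kappa>_inv: "\<And>\<eta> i j. \<eta> \<in> Configs n \<Longrightarrow> i < n \<Longrightarrow> j < n \<Longrightarrow> \<kappa> (exchange \<eta> i j) = \<kappa> \<eta>"
    and b: "0 < b"
  shows "ev (\<lambda>\<eta>. (\<phi> \<eta>)\<^sup>2 * (\<kappa> \<eta> * (\<Sum>k<n. (spin \<eta> k - spin \<eta> (succ_site n k)) * h k \<eta>)))
    \<le> (b + 8 * C\<^sup>2 * c\<^sup>2 / b) * (real n)\<^sup>2 * dirichlet \<phi> + (5 * C\<^sup>2 * c\<^sup>2 / b + C * c) * ev (\<lambda>\<eta>. (\<phi> \<eta>)\<^sup>2)"
proof -
  define F where "F = ev (\<lambda>\<eta>. (\<phi> \<eta>)\<^sup>2)"
  define D where "D = dirichlet \<phi>"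
  define N where "N = real n"
  have N: "1 \<le> N" using n3 by (simp add: N_def)
  have F0: "0 \<le> F" unfolding F_def by (rule ev_nonneg) auto
  have D0: "0 \<le> D" unfolding D_def by (rule dirichlet_nonneg)
  define \<beta> where "\<beta> = b * N\<^sup>2"
  have \<beta>: "0 < \<beta>" using b N by (simp add: \<beta>_def)
  define k where "k j \<eta> = \<kappa> \<eta> * (spin \<eta> j - spin \<eta> (succ_site n j))" for j \<eta>
  have succ: "succ_site n j < n" for j using n3 by (simp add: succ_site_def)
  have bnd: "ev (\<lambda>\<eta>. (\<phi> \<eta>)\<^sup>2 * (k j \<eta> * h j \<eta>)) \<le> \<beta> * bond \<phi> j (succ_site n j)
    + ((2 * C)\<^sup>2 / (16 * \<beta>) * (8 * (4 * c\<^sup>2 * N ^ 3 * D + 2 * c\<^sup>2 * N * F) + 2 * (c / N)\<^sup>2 * F) + (2 * C) * (c / N) / 2 * F)"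
    if j: "j < n" for j
  proof -
    have "ev (\<lambda>\<eta>. (\<phi> \<eta>)\<^sup>2 * (k j \<eta> * h j \<eta>)) \<le> \<beta> * bond \<phi> j (succ_site n j)
      + (2 * C)\<^sup>2 / (16 * \<beta>) * (8 * ev (\<lambda>\<eta>. (\<phi> \<eta>)\<^sup>2 * (h j \<eta>)\<^sup>2) + 2 * (c / N)\<^sup>2 * F) + (2 * C) * (c / N) / 2 * F"
      unfolding F_def
    proof (rule ev_antisymmetric_le[OF j succ])
      fix \<eta> assume \<eta>: "\<eta> \<in> Configs n"
      show "\<bar>h j (exchange \<eta> j (succ_site n j)) - h j \<eta>\<bar> \<le> c / N"
        unfolding N_def by (rule h_bond[OF j \<eta>])
      have "\<bar>spin \<eta> j - spin \<eta> (succ_site n j)\<bar> \<le> 2"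
        using abs_spin[OF \<eta> j] abs_spin[OF \<eta> succ[of j]] by linarith
      then have "\<bar>k j \<eta>\<bar> \<le> C * 2" unfolding k_def abs_mult using \<kappa>[OF \<eta>] by (intro mult_mono) auto
      then show "\<bar>k j \<eta>\<bar> \<le> 2 * C" by simp
      show "k j (exchange \<eta> j (succ_site n j)) = - k j \<eta>"
        unfolding k_def \<kappa>_inv[OF \<eta> j succ] by (simp add: spin_def exchange_def algebra_simps)
    qed (rule \<beta>)
    also have "ev (\<lambda>\<eta>. (\<phi> \<eta>)\<^sup>2 * (h j \<eta>)\<^sup>2) \<le> 4 * c\<^sup>2 * N ^ 3 * D + 2 * c\<^sup>2 * N * F"
      unfolding N_def D_def F_def by (rule ev_square_le[OF h_diff[OF j] h_eig[OF j] l c])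
    finally show ?thesis using \<beta> by (simp add: mult_left_mono divide_right_mono)
  qed
  have "ev (\<lambda>\<eta>. (\<phi> \<eta>)\<^sup>2 * (\<kappa> \<eta> * (\<Sum>k<n. (spin \<eta> k - spin \<eta> (succ_site n k)) * h k \<eta>)))
     = (\<Sum>j<n. ev (\<lambda>\<eta>. (\<phi> \<eta>)\<^sup>2 * (k j \<eta> * h j \<eta>)))"
    unfolding ev_sum[symmetric] by (simp add: k_def sum_distrib_left mult_ac)
  also have "\<dots> \<le> (\<Sum>j<n. \<beta> * bond \<phi> j (succ_site n j)
    + ((2 * C)\<^sup>2 / (16 * \<beta>) * (8 * (4 * c\<^sup>2 * N ^ 3 * D + 2 * c\<^sup>2 * N * F) + 2 * (c / N)\<^sup>2 * F) + (2 * C) * (c / N) / 2 * F))"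
    by (intro sum_mono bnd) auto
  also have "\<dots> = \<beta> * D + N * ((2 * C)\<^sup>2 / (16 * \<beta>) * (8 * (4 * c\<^sup>2 * N ^ 3 * D + 2 * c\<^sup>2 * N * F) + 2 * (c / N)\<^sup>2 * F) + (2 * C) * (c / N) / 2 * F)"
    by (simp add: sum.distrib sum_distrib_left D_def dirichlet_def N_def)
  \<comment> \<open>The bonds give \<open>b\<close>, the n^3 term of \<open>ev_square_le\<close>
    gives the other part of the coefficient of \<open>D\<close>, and the squared increments across
    the bonds leave only the last term, of order N^(-3).\<close>
  also have "\<dots> = (b + 8 * C\<^sup>2 * c\<^sup>2 / b) * N\<^sup>2 * D + (4 * C\<^sup>2 * c\<^sup>2 / b + C * c) * F + C\<^sup>2 * c\<^sup>2 / (2 * b) * F * (1 / N ^ 3)"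
    using b N by (simp add: \<beta>_def field_simps power2_eq_square power3_eq_cube)
  also have "C\<^sup>2 * c\<^sup>2 / (2 * b) * F * (1 / N ^ 3) \<le> C\<^sup>2 * c\<^sup>2 / b * F * 1"
    using b N F0 by (intro mult_mono divide_left_mono mult_right_mono) (auto simp: one_le_power)
  finally show ?thesis using b unfolding N_def D_def F_def by (simp add: algebra_simps add_divide_distrib)
qed

end

section \<open>Local functions on the circle\<close>

definition mean_spin :: "nat \<Rightarrow> (nat \<Rightarrow> nat) \<Rightarrow> real" where
  "mean_spin n \<eta> = (\<Sum>i<n. spin \<eta> i) / real n"

definition dev :: "nat \<Rightarrow> (nat \<Rightarrow> nat) \<Rightarrow> nat \<Rightarrow> real" where
  "dev n \<eta> i = spin \<eta> i - mean_spin n \<eta>"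

lemma spin_exchange: "spin (exchange \<eta> i j) p = spin \<eta> (if p = i then j else if p = j then i else p)"
  by (auto simp: spin_def exchange_def)

lemma sum_exchange:
  assumes "i < n" "j < n"
  shows "(\<Sum>p<n. g (exchange \<eta> i j p)) = (\<Sum>p<n. g (\<eta> p))"
proof -
  have "bij_betw (Transposition.transpose i j) {..<n} {..<n}"
    using assms by (intro bij_betwI[where g="Transposition.transpose i j"]) (auto simp: Transposition.transpose_def)
  from sum.reindex_bij_betw[OF this, of "\<lambda>p. g (\<eta> p)"]
  moreover have "exchange \<eta> i j p = \<eta> (Transposition.transpose i j p)" for p
    by (simp add: exchange_def Transposition.transpose_def)
  ultimately show ?thesis by simp
qed

lemma mean_spin_exchange: "i < n \<Longrightarrow> j < n \<Longrightarrow> mean_spin n (exchange \<eta> i j) = mean_spin n \<eta>"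
  unfolding mean_spin_def spin_def by (subst sum_exchange[where g="\<lambda>x. 2 * real x - 1"]) auto

lemma dev_exchange:
  "i < n \<Longrightarrow> j < n \<Longrightarrow> dev n (exchange \<eta> i j) p = dev n \<eta> (if p = i then j else if p = j then i else p)"
  by (simp add: dev_def mean_spin_exchange spin_exchange)

lemma abs_mean_spin:
  assumes "\<eta> \<in> Configs n"
  shows "\<bar>mean_spin n \<eta>\<bar> \<le> 1"
proof -
  have "\<bar>\<Sum>i<n. spin \<eta> i\<bar> \<le> (\<Sum>i<n. 1)"
    by (rule order_trans[OF sum_abs sum_mono]) (use abs_spin[OF assms] in auto)
  then show ?thesis by (cases "n = 0") (auto simp: mean_spin_def)
qed

lemma abs_dev: "\<eta> \<in> Configs n \<Longrightarrow> i < n \<Longrightarrow> \<bar>dev n \<eta> i\<bar> \<le> 2"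
  using abs_spin[of \<eta> n i] abs_mean_spin[of \<eta> n] by (auto simp: dev_def)

lemma sum_dev: "0 < n \<Longrightarrow> (\<Sum>i<n. dev n \<eta> i) = 0"
  by (simp add: dev_def sum_subtractf mean_spin_def)

lemma succ_site_less: "0 < n \<Longrightarrow> succ_site n i < n"
  by (simp add: succ_site_def)

lemma pred_site_less: "0 < n \<Longrightarrow> pred_site n i < n"
  by (simp add: pred_site_def)

lemma succ_site_if: "i < n \<Longrightarrow> succ_site n i = (if i = n - 1 then 0 else i + 1)"
  by (auto simp: succ_site_def)

lemma pred_site_if: "i < n \<Longrightarrow> pred_site n i = (if i = 0 then n - 1 else i - 1)"
  by (auto simp: pred_site_def mod_if)

lemma succ_pred_site: "i < n \<Longrightarrow> succ_site n (pred_site n i) = i"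
  using pred_site_if[of i n] by (auto simp: succ_site_if pred_site_less split: if_splits)

lemma pred_succ_site: "i < n \<Longrightarrow> pred_site n (succ_site n i) = i"
  using succ_site_if[of i n] by (auto simp: pred_site_if succ_site_less split: if_splits)

lemma bij_succ_site: "bij_betw (succ_site n) {..<n} {..<n}"
  by (rule bij_betwI[where g="pred_site n"]) (auto simp: succ_pred_site pred_succ_site intro: succ_site_less pred_site_less)

lemma sum_succ_site: "(\<Sum>i<n. f (succ_site n i)) = (\<Sum>i<n. f i)"
  by (rule sum.reindex_bij_betw[OF bij_succ_site])

text \<open>Telescoping \<open>dev (i + 1) - dev j\<close> along the circle and averaging over \<open>j\<close> crosses the bond
  from \<open>k\<close> to \<open>k + 1\<close> with this weight.\<close>

definition weight :: "nat \<Rightarrow> nat \<Rightarrow> nat \<Rightarrow> real" where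
  "weight n i k = (if k = i then 0 else if i < k then 1 - real (k - i) / real n else real (i - k) / real n)"

lemma weight_bounds: "i < n \<Longrightarrow> k < n \<Longrightarrow> 0 \<le> weight n i k \<and> weight n i k \<le> 1"
  by (auto simp: weight_def field_simps of_nat_diff)

section \<open>Summation by parts along the circle\<close>

text \<open>n times \<open>weight n i k\<close> counts the end points j for which the walk from i +
  1 to j crosses the bond after \<open>k\<close>. Going from one bond to the next gains all n walks
  if they start at \<open>k\<close> and loses the one that ends there.\<close>

lemma weight_diff:
  assumes "3 \<le> n" "i < n" "k < n"
  shows "weight n i k - weight n i (pred_site n k) = of_bool (k = succ_site n i) - 1 / real n"
proof (cases "k = 0")
  case True
  then have pk: "pred_site n k = n - 1" using assms by (simp add: pred_site_if)
  consider "i = n - 1" | "i < n - 1" "i = 0" | "i < n - 1" "0 < i" using assms by linarith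
  then show ?thesis
  proof cases
    case 1
    then have "succ_site n i = 0" using assms by (simp add: succ_site_if)
    with 1 True pk assms show ?thesis by (simp add: weight_def of_nat_diff diff_divide_distrib)
  next
    case 2
    then have "succ_site n i = 1" using assms by (simp add: succ_site_if)
    with 2 True pk assms show ?thesis by (simp add: weight_def of_nat_diff diff_divide_distrib)
  next
    case 3
    then have "succ_site n i = i + 1" using assms by (simp add: succ_site_if)
    with 3 True pk assms show ?thesis by (simp add: weight_def of_nat_diff diff_divide_distrib add_divide_distrib)
  qed
next
  case False
  then have pk: "pred_site n k = k - 1" using assms by (simp add: pred_site_if)
  have sk: "k = succ_site n i \<longleftrightarrow> k = i + 1" using assms False by (auto simp: succ_site_if)
  consider "k = i" | "k = i + 1" | "k < i" | "i + 1 < k" by linarith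
  then show ?thesis
  proof cases
    case 1
    then have "i - 1 \<noteq> i" "\<not> i < i - 1" "i - (i - 1) = 1" using False by auto
    then show ?thesis using 1 sk pk by (simp add: weight_def)
  next
    case 2
    then show ?thesis unfolding sk pk using assms by (simp add: weight_def)
  next
    case 3
    then have "i - (k - 1) = i - k + 1" "\<not> i < k" "\<not> i < k - 1" "k - 1 \<noteq> i" using False by auto
    then show ?thesis unfolding sk pk using 3 by (simp add: weight_def add_divide_distrib)
  next
    case 4
    then have "i < k - 1" by simp
    then show ?thesis using 4 sk pk assms
      by (simp add: weight_def of_nat_diff diff_divide_distrib add_divide_distrib)
  qed
qed

text \<open>An exchange across the bond after \<open>k\<close> is noticed by the local functions at
  \<open>k\<close>, \<open>k + 1\<close> and \<open>k + 2\<close> only. At \<open>k\<close> the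
  weight is 0, and this lemma and the next show that the other two are O(1/n).\<close>

lemma weight_succ:
  assumes "3 \<le> n" "k < n"
  shows "weight n (succ_site n k) k = 1 / real n"
proof (cases "k = n - 1")
  case True
  then have "succ_site n k = 0" using assms by (simp add: succ_site_if)
  then show ?thesis using True assms by (simp add: weight_def of_nat_diff diff_divide_distrib)
next
  case False
  then have "succ_site n k = k + 1" using assms by (simp add: succ_site_if)
  then show ?thesis by (simp add: weight_def)
qed

lemma weight_succ_succ:
  assumes "3 \<le> n" "k < n"
  shows "weight n (succ_site n (succ_site n k)) k = 2 / real n"
proof -
  consider "k = n - 1" | "k = n - 2" | "k < n - 2" using assms by linarith
  then show ?thesis
  proof cases
    case 1
    then have "succ_site n (succ_site n k) = 1" using assms by (simp add: succ_site_def)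
    then show ?thesis using 1 assms by (simp add: weight_def of_nat_diff diff_divide_distrib)
  next
    case 2
    then have "n = k + 2" using assms by linarith
    then have "succ_site n (succ_site n k) = 0" by (simp add: succ_site_def)
    then show ?thesis using 2 assms by (simp add: weight_def of_nat_diff diff_divide_distrib)
  next
    case 3
    then have "succ_site n (succ_site n k) = k + 2" using assms by (simp add: succ_site_def)
    then show ?thesis by (simp add: weight_def)
  qed
qed

text \<open>The amount carried across the bond after \<open>k\<close> when all terms are telescoped;
  it is the factor of the spin gradient there.\<close>

definition transport :: "nat \<Rightarrow> (nat \<Rightarrow> real) \<Rightarrow> nat \<Rightarrow> real" where
  "transport n A k = (\<Sum>i<n. weight n i k * A i)"

text \<open>Summation by parts on the circle; the mean of \<open>dev\<close> vanishes.\<close>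

lemma sum_dev_succ_eq_gradient:
  assumes n: "3 \<le> n"
  shows "(\<Sum>i<n. A i * dev n \<eta> (succ_site n i))
    = (\<Sum>k<n. (spin \<eta> k - spin \<eta> (succ_site n k)) * transport n A k)"
proof -
  have inner: "(\<Sum>k<n. weight n i k * (dev n \<eta> k - dev n \<eta> (succ_site n k))) = dev n \<eta> (succ_site n i)"
    if i: "i < n" for i
  proof -
    have "(\<Sum>k<n. weight n i k * dev n \<eta> (succ_site n k))
      = (\<Sum>k<n. weight n i (pred_site n (succ_site n k)) * dev n \<eta> (succ_site n k))"
      by (intro sum.cong refl) (simp add: pred_succ_site)
    also have "\<dots> = (\<Sum>k<n. weight n i (pred_site n k) * dev n \<eta> k)"
      by (rule sum_succ_site[where f="\<lambda>k. weight n i (pred_site n k) * dev n \<eta> k"])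
    finally have "(\<Sum>k<n. weight n i k * (dev n \<eta> k - dev n \<eta> (succ_site n k)))
      = (\<Sum>k<n. (weight n i k - weight n i (pred_site n k)) * dev n \<eta> k)"
      by (simp add: right_diff_distrib left_diff_distrib sum_subtractf)
    also have "\<dots> = (\<Sum>k<n. (if k = succ_site n i then dev n \<eta> k else 0) - dev n \<eta> k / real n)"
      using n i by (intro sum.cong refl) (auto simp: weight_diff left_diff_distrib)
    also have "\<dots> = dev n \<eta> (succ_site n i)"
      using n sum_dev[of n \<eta>] succ_site_less[of n i] by (simp add: sum_subtractf sum_divide_distrib[symmetric])
    finally show ?thesis .
  qed
  have "(\<Sum>k<n. (spin \<eta> k - spin \<eta> (succ_site n k)) * transport n A k)
     = (\<Sum>k<n. \<Sum>i<n. A i * (weight n i k * (dev n \<eta> k - dev n \<eta> (succ_site n k))))"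
    by (simp add: transport_def dev_def sum_distrib_left mult_ac)
  also have "\<dots> = (\<Sum>i<n. \<Sum>k<n. A i * (weight n i k * (dev n \<eta> k - dev n \<eta> (succ_site n k))))"
    by (rule sum.swap)
  also have "\<dots> = (\<Sum>i<n. A i * dev n \<eta> (succ_site n i))"
    by (simp add: sum_distrib_left[symmetric] inner)
  finally show ?thesis by simp
qed

lemma sum_of_bool_mult:
  fixes p n :: nat
  shows "p < n \<Longrightarrow> (\<Sum>i<n. w i * of_bool (i = p)) = (w p :: real)"
  by (simp add: of_bool_def if_distrib cong: if_cong)

lemma sum_of_bool_pred_mult:
  assumes "p < n"
  shows "(\<Sum>i<n. w i * of_bool (pred_site n i = p)) = (w (succ_site n p) :: real)"
proof -
  have "(\<Sum>i<n. w i * of_bool (pred_site n i = p)) = (\<Sum>i<n. w i * of_bool (i = succ_site n p))"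
    using assms by (intro sum.cong refl) (auto simp: succ_pred_site pred_succ_site)
  then show ?thesis using assms by (simp add: sum_of_bool_mult succ_site_less)
qed

text \<open>Multiplied by \<open>dev\<close> at the next site and summed over the circle, these are the only
  unbounded terms in the entropy production of the flips.\<close>

definition local_functions :: "nat \<Rightarrow> ((nat \<Rightarrow> nat) \<Rightarrow> nat \<Rightarrow> real) set" where
  "local_functions n = {dev n, \<lambda>\<eta> i. dev n \<eta> (pred_site n i), \<lambda>\<eta> i. dev n \<eta> (pred_site n i) * dev n \<eta> i}"

text \<open>Exchanges conserve the mean spin, so only a change at \<open>i\<close> or at its
  predecessor matters. Local functions are at most 4 in modulus, as deviations are at most 2; the
  constant is twice that.\<close>

lemma local_function_exchange_diff:
  assumes A: "A \<in> local_functions n" and \<eta>: "\<eta> \<in> Configs n" and pq: "p < n" "q < n" and i: "i < n"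
  shows "\<bar>A (exchange \<eta> p q) i - A \<eta> i\<bar>
    \<le> 8 * (of_bool (i = p) + of_bool (i = q) + of_bool (pred_site n i = p) + of_bool (pred_site n i = q))"
proof (cases "i = p \<or> i = q \<or> pred_site n i = p \<or> pred_site n i = q")
  case True
  have A4: "\<bar>A \<xi> i\<bar> \<le> 4" if \<xi>: "\<xi> \<in> Configs n" for \<xi>
  proof -
    have d: "\<bar>dev n \<xi> i\<bar> \<le> 2" "\<bar>dev n \<xi> (pred_site n i)\<bar> \<le> 2"
      using i by (auto intro!: abs_dev[OF \<xi>] pred_site_less)
    moreover have "\<bar>dev n \<xi> (pred_site n i) * dev n \<xi> i\<bar> \<le> 2 * 2"
      unfolding abs_mult using d by (intro mult_mono) auto
    ultimately show ?thesis using A by (auto simp: local_functions_def)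
  qed
  have "\<bar>A (exchange \<eta> p q) i - A \<eta> i\<bar> \<le> 8"
    using A4[OF \<eta>] A4[OF exchange_in_Configs[OF \<eta> pq]] by linarith
  moreover have "(8::real) \<le> 8 * (of_bool (i = p) + of_bool (i = q) + of_bool (pred_site n i = p) + of_bool (pred_site n i = q))"
    using True by (auto simp: of_bool_def)
  ultimately show ?thesis by (rule order_trans)
next
  case False
  then show ?thesis using A pq by (auto simp: local_functions_def dev_exchange)
qed

text \<open>Each exchanged site is seen from itself and from its successor, which makes four
  weights.\<close>

lemma transport_exchange_diff:
  assumes A: "A \<in> local_functions n" and \<eta>: "\<eta> \<in> Configs n" and pq: "p < n" "q < n" and k: "k < n"
  shows "\<bar>transport n (A (exchange \<eta> p q)) k - transport n (A \<eta>) k\<bar>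
    \<le> 8 * (weight n p k + weight n q k + weight n (succ_site n p) k + weight n (succ_site n q) k)"
proof -
  let ?w = "\<lambda>i. weight n i k"
  have eq: "transport n (A (exchange \<eta> p q)) k - transport n (A \<eta>) k
     = (\<Sum>i<n. ?w i * (A (exchange \<eta> p q) i - A \<eta> i))"
    by (simp add: transport_def sum_subtractf right_diff_distrib)
  have "\<bar>transport n (A (exchange \<eta> p q)) k - transport n (A \<eta>) k\<bar> \<le> (\<Sum>i<n. ?w i * (8 * (of_bool (i = p) + of_bool (i = q)
      + of_bool (pred_site n i = p) + of_bool (pred_site n i = q))))"
    unfolding eq
  proof (rule order_trans[OF sum_abs], rule sum_mono)
    fix i assume "i \<in> {..<n}"
    then have i: "i < n" by simp
    show "\<bar>?w i * (A (exchange \<eta> p q) i - A \<eta> i)\<bar> \<le> ?w i * (8 * (of_bool (i = p) + of_bool (i = q)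
      + of_bool (pred_site n i = p) + of_bool (pred_site n i = q)))"
      unfolding abs_mult using weight_bounds[OF i k] local_function_exchange_diff[OF A \<eta> pq i]
      by (simp add: mult_left_mono)
  qed
  also have "\<dots> = 8 * ((\<Sum>i<n. ?w i * of_bool (i = p)) + (\<Sum>i<n. ?w i * of_bool (i = q))
      + (\<Sum>i<n. ?w i * of_bool (pred_site n i = p)) + (\<Sum>i<n. ?w i * of_bool (pred_site n i = q)))"
    by (simp only: sum_distrib_left sum.distrib distrib_left mult.left_commute[of _ 8])
  finally show ?thesis by (simp only: sum_of_bool_mult sum_of_bool_pred_mult pq)
qed

lemma transport_exchange_diff_le:
  assumes "A \<in> local_functions n" "\<eta> \<in> Configs n" "p < n" "q < n" "k < n"
  shows "\<bar>transport n (A (exchange \<eta> p q)) k - transport n (A \<eta>) k\<bar> \<le> 32"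
proof -
  have n0: "0 < n" using assms(3) by simp
  have "weight n i k \<le> 1" if "i < n" for i using weight_bounds[OF that assms(5)] by simp
  from this[OF assms(3)] this[OF assms(4)] this[OF succ_site_less[OF n0, of p]] this[OF succ_site_less[OF n0, of q]]
  have "8 * (weight n p k + weight n q k + weight n (succ_site n p) k + weight n (succ_site n q) k) \<le> 32"
    by simp
  with transport_exchange_diff[OF assms] show ?thesis by (rule order_trans)
qed

text \<open>The four weights are 0, 1/n, 1/n and 2/n. It matters that local functions look
  backwards: dependence on the following site would bring in the weight at \<open>k - 1\<close>,
  which is close to one.\<close>

lemma transport_bond_diff_le:
  assumes "3 \<le> n" "A \<in> local_functions n" "\<eta> \<in> Configs n" "k < n"
  shows "\<bar>transport n (A (exchange \<eta> k (succ_site n k))) k - transport n (A \<eta>) k\<bar> \<le> 32 / real n"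
proof -
  have "weight n k k = 0" by (simp add: weight_def)
  then show ?thesis
    using transport_exchange_diff[OF assms(2,3,4) succ_site_less assms(4), of k] assms
      weight_succ[OF assms(1,4)] weight_succ_succ[OF assms(1,4)] by simp
qed

section \<open>Local functions under exchanges of all pairs\<close>

text \<open>Site \<open>p\<close> takes part in 2n ordered exchanges and receives a value that
  averages to zero: after division by n the eigenvalue is -2.\<close>

lemma sum_exchange_dev:
  assumes p: "p < n"
  shows "(\<Sum>i<n. \<Sum>j<n. dev n (exchange \<eta> i j) p - dev n \<eta> p) = - 2 * real n * dev n \<eta> p"
proof -
  let ?u = "dev n \<eta>"
  have "(\<Sum>i<n. \<Sum>j<n. dev n (exchange \<eta> i j) p - ?u p)
     = (\<Sum>i<n. \<Sum>j<n. (?u j - ?u p) * of_bool (i = p) + (?u i - ?u p) * of_bool (j = p))"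
    by (intro sum.cong refl) (auto simp: dev_exchange)
  also have "\<dots> = (\<Sum>i<n. (\<Sum>j<n. ?u j - ?u p) * of_bool (i = p) + (?u i - ?u p))"
    using p by (simp add: sum.distrib sum_of_bool_mult sum_distrib_right[symmetric])
  also have "\<dots> = (\<Sum>j<n. ?u j - ?u p) + (\<Sum>i<n. ?u i - ?u p)"
    using p by (simp add: sum.distrib sum_of_bool_mult)
  also have "(\<Sum>j<n. ?u j - ?u p) = - real n * ?u p"
    using p by (simp add: sum_subtractf sum_dev)
  finally show ?thesis by simp
qed

text \<open>A product rule: the two factors change one at a time, except when \<open>p\<close> and
  \<open>q\<close> are exchanged with each other. The product is then unchanged, and the square
  cancels what the rule would predict.\<close>

lemma exchange_pair_expand:
  fixes u :: "'a \<Rightarrow> real"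
  assumes "p \<noteq> q"
  shows "u (if p = i then j else if p = j then i else p) * u (if q = i then j else if q = j then i else q) - u p * u q
     = ((u j - u p) * u q) * of_bool (i = p) + ((u i - u p) * u q) * of_bool (j = p)
        + (u p * (u j - u q)) * of_bool (i = q) + (u p * (u i - u q)) * of_bool (j = q)
        - (u p - u q)\<^sup>2 * of_bool (i = p) * of_bool (j = q) - (u p - u q)\<^sup>2 * of_bool (i = q) * of_bool (j = p)"
proof -
  consider "i = p" "j = p" | "i = p" "j = q" | "i = p" "j \<noteq> p" "j \<noteq> q"
    | "i = q" "j = p" | "i = q" "j = q" | "i = q" "j \<noteq> p" "j \<noteq> q"
    | "i \<noteq> p" "i \<noteq> q" "j = p" | "i \<noteq> p" "i \<noteq> q" "j = q" | "i \<noteq> p" "i \<noteq> q" "j \<noteq> p" "j \<noteq> q" by blast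
  then show ?thesis
  proof cases
    case 2
    then show ?thesis using assms by (simp add: power2_eq_square algebra_simps)
  next
    case 4
    then show ?thesis using assms by (simp add: power2_eq_square algebra_simps)
  qed (use assms in \<open>auto simp: algebra_simps\<close>)
qed

text \<open>Two factors double the eigenvalue to -4. The square comes from exchanging
  \<open>p\<close> with \<open>q\<close>, in both orders, and carries no factor n.\<close>

lemma sum_exchange_dev_dev:
  assumes pq: "p < n" "q < n" "p \<noteq> q"
  shows "(\<Sum>i<n. \<Sum>j<n. dev n (exchange \<eta> i j) p * dev n (exchange \<eta> i j) q - dev n \<eta> p * dev n \<eta> q)
    = - 4 * real n * (dev n \<eta> p * dev n \<eta> q) - 2 * (dev n \<eta> p - dev n \<eta> q)\<^sup>2"
proof -
  let ?u = "dev n \<eta>"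
  have "(\<Sum>i<n. \<Sum>j<n. dev n (exchange \<eta> i j) p * dev n (exchange \<eta> i j) q - ?u p * ?u q)
     = (\<Sum>i<n. \<Sum>j<n. ((?u j - ?u p) * ?u q) * of_bool (i = p) + ((?u i - ?u p) * ?u q) * of_bool (j = p)
        + (?u p * (?u j - ?u q)) * of_bool (i = q) + (?u p * (?u i - ?u q)) * of_bool (j = q)
        - (?u p - ?u q)\<^sup>2 * of_bool (i = p) * of_bool (j = q) - (?u p - ?u q)\<^sup>2 * of_bool (i = q) * of_bool (j = p))"
  proof (intro sum.cong refl)
    fix i j assume "i \<in> {..<n}" "j \<in> {..<n}"
    then have ij: "i < n" "j < n" by auto
    show "dev n (exchange \<eta> i j) p * dev n (exchange \<eta> i j) q - ?u p * ?u q
     = ((?u j - ?u p) * ?u q) * of_bool (i = p) + ((?u i - ?u p) * ?u q) * of_bool (j = p)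
        + (?u p * (?u j - ?u q)) * of_bool (i = q) + (?u p * (?u i - ?u q)) * of_bool (j = q)
        - (?u p - ?u q)\<^sup>2 * of_bool (i = p) * of_bool (j = q) - (?u p - ?u q)\<^sup>2 * of_bool (i = q) * of_bool (j = p)"
      unfolding dev_exchange[OF ij] by (rule exchange_pair_expand[OF pq(3)])
  qed
  also have "\<dots> = (\<Sum>i<n. (\<Sum>j<n. (?u j - ?u p) * ?u q) * of_bool (i = p) + ((?u i - ?u p) * ?u q)
        + (\<Sum>j<n. ?u p * (?u j - ?u q)) * of_bool (i = q) + (?u p * (?u i - ?u q))
        - (?u p - ?u q)\<^sup>2 * of_bool (i = p) - (?u p - ?u q)\<^sup>2 * of_bool (i = q))"
    using pq by (simp add: sum.distrib sum_subtractf sum_of_bool_mult sum_distrib_right[symmetric])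
  also have "\<dots> = (\<Sum>j<n. (?u j - ?u p) * ?u q) + (\<Sum>i<n. (?u i - ?u p) * ?u q)
        + (\<Sum>j<n. ?u p * (?u j - ?u q)) + (\<Sum>i<n. ?u p * (?u i - ?u q)) - 2 * (?u p - ?u q)\<^sup>2"
    using pq by (simp add: sum.distrib sum_subtractf sum_of_bool_mult)
  also have "(\<Sum>j<n. (?u j - ?u p) * ?u q) = - real n * (?u p * ?u q)"
    using pq by (simp add: sum_distrib_right[symmetric] sum_subtractf sum_dev)
  also have "(\<Sum>j<n. ?u p * (?u j - ?u q)) = - real n * (?u p * ?u q)"
    using pq by (simp add: sum_distrib_left[symmetric] sum_subtractf sum_dev)
  finally show ?thesis by simp
qed

text \<open>At one site the eigenvalue equation is exact for deviations and, before division by n,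
  off by at most 2 * 16 for their products. Adding up n sites with weights at most one and dividing
  by n keeps the error at 32.\<close>

lemma transport_eigen:
  assumes n: "3 \<le> n" and A: "A \<in> local_functions n"
  obtains l where "2 \<le> l" "\<And>\<eta> k. \<eta> \<in> Configs n \<Longrightarrow> k < n \<Longrightarrow>
    \<bar>(\<Sum>i<n. \<Sum>j<n. transport n (A (exchange \<eta> i j)) k - transport n (A \<eta>) k) / real n + l * transport n (A \<eta>) k\<bar> \<le> 32"
proof -
  have pred_ne: "pred_site n i \<noteq> i" if "i < n" for i using n that by (auto simp: pred_site_if)
  obtain l where l: "2 \<le> l" and loc: "\<And>\<eta> p. \<eta> \<in> Configs n \<Longrightarrow> p < n \<Longrightarrow>
    \<bar>(\<Sum>i<n. \<Sum>j<n. A (exchange \<eta> i j) p - A \<eta> p) + real n * l * A \<eta> p\<bar> \<le> 32"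
  proof -
    consider "A = dev n" | "A = (\<lambda>\<eta> i. dev n \<eta> (pred_site n i))"
      | "A = (\<lambda>\<eta> i. dev n \<eta> (pred_site n i) * dev n \<eta> i)"
      using A by (auto simp: local_functions_def)
    then show ?thesis
    proof cases
      case 1
      show ?thesis by (rule that[of 2]) (simp_all add: 1 sum_exchange_dev)
    next
      case 2
      show ?thesis by (rule that[of 2]) (use n in \<open>simp_all add: 2 sum_exchange_dev pred_site_less\<close>)
    next
      case 3
      show ?thesis
      proof (rule that[of 4])
        fix \<eta> p assume \<eta>: "\<eta> \<in> Configs n" and p: "p < n"
        have "\<bar>dev n \<eta> (pred_site n p) - dev n \<eta> p\<bar> \<le> 4"
          using abs_dev[OF \<eta> p] abs_dev[OF \<eta> pred_site_less[of n p]] p by linarith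
        from power_mono[OF this, of 2] have "(dev n \<eta> (pred_site n p) - dev n \<eta> p)\<^sup>2 \<le> 16" by simp
        then show "\<bar>(\<Sum>i<n. \<Sum>j<n. A (exchange \<eta> i j) p - A \<eta> p) + real n * 4 * A \<eta> p\<bar> \<le> 32"
          using sum_exchange_dev_dev[of "pred_site n p" n p \<eta>] pred_ne[OF p] p
          by (simp add: 3 pred_site_less)
      qed simp
    qed
  qed
  show ?thesis
  proof (rule that[OF l])
    fix \<eta> k assume \<eta>: "\<eta> \<in> Configs n" and k: "k < n"
    have "(\<Sum>i<n. \<Sum>j<n. transport n (A (exchange \<eta> i j)) k - transport n (A \<eta>) k)
      = (\<Sum>i<n. \<Sum>p<n. \<Sum>j<n. weight n p k * (A (exchange \<eta> i j) p - A \<eta> p))"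
      unfolding transport_def sum_subtractf[symmetric] right_diff_distrib[symmetric]
      by (intro sum.cong refl sum.swap)
    also have "\<dots> = (\<Sum>p<n. \<Sum>i<n. \<Sum>j<n. weight n p k * (A (exchange \<eta> i j) p - A \<eta> p))"
      by (rule sum.swap)
    finally have eq: "(\<Sum>i<n. \<Sum>j<n. transport n (A (exchange \<eta> i j)) k - transport n (A \<eta>) k) + real n * l * transport n (A \<eta>) k
      = (\<Sum>p<n. weight n p k * ((\<Sum>i<n. \<Sum>j<n. A (exchange \<eta> i j) p - A \<eta> p) + real n * l * A \<eta> p))"
      by (simp add: transport_def sum_distrib_left distrib_left sum.distrib mult_ac)
    have "\<bar>\<dots>\<bar> \<le> (\<Sum>p<n. 1 * 32)"
    proof (rule order_trans[OF sum_abs], rule sum_mono)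
      fix p assume "p \<in> {..<n}"
      then show "\<bar>weight n p k * ((\<Sum>i<n. \<Sum>j<n. A (exchange \<eta> i j) p - A \<eta> p) + real n * l * A \<eta> p)\<bar> \<le> 1 * 32"
        unfolding abs_mult using weight_bounds[of p n k] k loc[OF \<eta>, of p] by (intro mult_mono) auto
    qed
    then have "\<bar>(\<Sum>i<n. \<Sum>j<n. transport n (A (exchange \<eta> i j)) k - transport n (A \<eta>) k) + real n * l * transport n (A \<eta>) k\<bar>
       \<le> 32 * real n"
      unfolding eq by simp
    moreover have "0 < real n" using n by simp
    moreover have "(\<Sum>i<n. \<Sum>j<n. transport n (A (exchange \<eta> i j)) k - transport n (A \<eta>) k) / real n + l * transport n (A \<eta>) k
      = ((\<Sum>i<n. \<Sum>j<n. transport n (A (exchange \<eta> i j)) k - transport n (A \<eta>) k) + real n * l * transport n (A \<eta>) k) / real n"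
      using \<open>0 < real n\<close> by (simp add: field_simps)
    ultimately show "\<bar>(\<Sum>i<n. \<Sum>j<n. transport n (A (exchange \<eta> i j)) k - transport n (A \<eta>) k) / real n + l * transport n (A \<eta>) k\<bar> \<le> 32"
      by (simp add: divide_le_eq mult.commute)
  qed
qed

text \<open>\<open>ev_gradient_sum_le\<close> with \<open>c\<close> = 32, the constant common to all
  bounds on \<open>transport\<close>: 8192 = 8 * 32^2 and 5120 = 5 * 32^2.\<close>

lemma (in exchangeable) ev_local_function_le:
  assumes A: "A \<in> local_functions n"
    and \<kappa>: "\<And>\<eta>. \<eta> \<in> Configs n \<Longrightarrow> \<bar>\<kappa> \<eta>\<bar> \<le> C"
    and \<kappa>_inv: "\<And>\<eta> i j. \<eta> \<in> Configs n \<Longrightarrow> i < n \<Longrightarrow> j < n \<Longrightarrow> \<kappa> (exchange \<eta> i j) = \<kappa> \<eta>"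
    and b: "0 < b"
  shows "ev (\<lambda>\<eta>. (\<phi> \<eta>)\<^sup>2 * (\<kappa> \<eta> * (\<Sum>i<n. A \<eta> i * dev n \<eta> (succ_site n i))))
    \<le> (b + 8192 * C\<^sup>2 / b) * (real n)\<^sup>2 * dirichlet \<phi> + (5120 * C\<^sup>2 / b + 32 * C) * ev (\<lambda>\<eta>. (\<phi> \<eta>)\<^sup>2)"
proof -
  obtain l where l: "2 \<le> l" and eig: "\<And>\<eta> k. \<eta> \<in> Configs n \<Longrightarrow> k < n \<Longrightarrow>
    \<bar>(\<Sum>i<n. \<Sum>j<n. transport n (A (exchange \<eta> i j)) k - transport n (A \<eta>) k) / real n + l * transport n (A \<eta>) k\<bar> \<le> 32"
    by (rule transport_eigen[OF n3 A]) blast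
  have "ev (\<lambda>\<eta>. (\<phi> \<eta>)\<^sup>2 * (\<kappa> \<eta> * (\<Sum>k<n. (spin \<eta> k - spin \<eta> (succ_site n k)) * transport n (A \<eta>) k)))
    \<le> (b + 8 * C\<^sup>2 * 32\<^sup>2 / b) * (real n)\<^sup>2 * dirichlet \<phi> + (5 * C\<^sup>2 * 32\<^sup>2 / b + C * 32) * ev (\<lambda>\<eta>. (\<phi> \<eta>)\<^sup>2)"
    by (rule ev_gradient_sum_le[where h="\<lambda>k \<eta>. transport n (A \<eta>) k" and l=l])
      (use l b \<kappa> \<kappa>_inv eig transport_exchange_diff_le[OF A] transport_bond_diff_le[OF n3 A] in auto)
  then show ?thesis by (simp add: sum_dev_succ_eq_gradient[OF n3] mult.commute)
qed

section \<open>Flip rates and the reference weights\<close>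

text \<open>For U the potential and u = \<sigma> * 2 * \<gamma> * \<rho>, this is exp (- \<sigma>
  U'(\<rho>)): to first order, the factor gained by the reference weight when a spin \<sigma> is
  flipped.\<close>

definition qratio :: "real \<Rightarrow> real" where
  "qratio u = ((1 - u) / (1 + u))\<^sup>2"

lemma flip_in_Configs: "\<eta> \<in> Configs n \<Longrightarrow> i < n \<Longrightarrow> flip \<eta> i \<in> Configs n"
  unfolding Configs_def flip_def PiE_def Pi_def extensional_def by auto

lemma flip_flip: "\<eta> \<in> Configs n \<Longrightarrow> i < n \<Longrightarrow> flip (flip \<eta> i) i = \<eta>"
  using Configs_cases[of \<eta> n i] by (auto simp: flip_def)

lemma sum_flip:
  assumes "i < n"
  shows "(\<Sum>\<eta>\<in>Configs n. g (flip \<eta> i)) = (\<Sum>\<eta>\<in>Configs n. g \<eta>)"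
  by (rule sum.reindex_bij_betw, rule bij_betwI[where g="\<lambda>\<eta>. flip \<eta> i"])
    (auto simp: flip_flip assms intro: flip_in_Configs assms)

lemma spin_flip:
  assumes "\<eta> \<in> Configs n" "i < n"
  shows "spin (flip \<eta> i) j = (if j = i then - spin \<eta> i else spin \<eta> j)"
  using Configs_cases[OF assms] by (auto simp: spin_def flip_def)

lemma mean_spin_flip:
  assumes "\<eta> \<in> Configs n" "i < n"
  shows "mean_spin n (flip \<eta> i) = mean_spin n \<eta> - 2 * spin \<eta> i / real n"
proof -
  have "(\<Sum>j<n. spin (flip \<eta> i) j) = (\<Sum>j<n. spin \<eta> j - (if j = i then 2 * spin \<eta> i else 0))"
    by (intro sum.cong refl) (simp add: spin_flip[OF assms])
  also have "\<dots> = (\<Sum>j<n. spin \<eta> j) - 2 * spin \<eta> i"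
    using assms by (simp add: sum_subtractf)
  finally show ?thesis by (simp add: mean_spin_def diff_divide_distrib)
qed

lemma magnetization_eq: "magnetization n \<eta> / real n = mean_spin n \<eta> / 2"
proof -
  have "magnetization n \<eta> = (\<Sum>i<n. spin \<eta> i) / 2"
    unfolding magnetization_def sum_divide_distrib by (simp add: centred_def spin_def diff_divide_distrib)
  then show "magnetization n \<eta> / real n = mean_spin n \<eta> / 2"
    by (simp only: mean_spin_def divide_divide_eq_left mult.commute)
qed

lemma mult_ln_tangent:
  fixes x y :: real
  assumes "0 < x" "0 < y"
  shows "x * ln x - y * ln y \<le> (ln x + 1) * (x - y)"
proof -
  have "ln (x / y) \<le> x / y - 1" using assms by (intro ln_le_minus_one) auto
  then have "y * (ln x - ln y) \<le> y * (x / y - 1)"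
    using assms by (intro mult_left_mono) (auto simp: ln_div)
  also have "\<dots> = x - y" using assms by (simp add: field_simps)
  finally show ?thesis by (simp add: algebra_simps)
qed

lemma exp_two_ln_diff:
  fixes x y :: real
  assumes "0 < x" "0 < y"
  shows "exp (2 * (ln x - ln y)) = (x / y)\<^sup>2"
  using assms unfolding exp_double by (simp add: exp_diff)

text \<open>Convexity of the potential bounds the density ratio by its derivative at the flipped
  configuration.\<close>

lemma tilt_flip_le:
  assumes n: "0 < n" and \<gamma>: "0 < gam \<theta> n" "gam \<theta> n < 1" and \<eta>: "\<eta> \<in> Configs n" "i < n"
  shows "tilt \<theta> n (flip \<eta> i) \<le> tilt \<theta> n \<eta> * qratio (spin \<eta> i * (gam \<theta> n * mean_spin n (flip \<eta> i)))"
proof -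
  define g where "g = gam \<theta> n"
  define s where "s = g * mean_spin n \<eta>"
  define s' where "s' = g * mean_spin n (flip \<eta> i)"
  have g: "0 < g" "g < 1" using \<gamma> by (simp_all add: g_def)
  have small: "\<bar>g * x\<bar> < 1" if "\<bar>x\<bar> \<le> 1" for x
  proof -
    have "g * \<bar>x\<bar> \<le> g * 1" using that g by (intro mult_left_mono) auto
    moreover have "\<bar>g * x\<bar> = g * \<bar>x\<bar>" using g by (simp add: abs_mult)
    ultimately show ?thesis using g by linarith
  qed
  have s: "\<bar>s\<bar> < 1" "\<bar>s'\<bar> < 1"
    unfolding s_def s'_def by (intro small abs_mean_spin flip_in_Configs \<eta>)+
  then have pos: "0 < 1 + s" "0 < 1 - s" "0 < 1 + s'" "0 < 1 - s'" by linarith+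
  have pot: "potential \<theta> n (magnetization n \<xi> / real n)
     = ((1 + g * mean_spin n \<xi>) * ln (1 + g * mean_spin n \<xi>) + (1 - g * mean_spin n \<xi>) * ln (1 - g * mean_spin n \<xi>)) / g" for \<xi>
    unfolding potential_def magnetization_eq by (simp add: Let_def g_def)
  have d: "s' - s = - (2 * g * spin \<eta> i / real n)"
    unfolding s_def s'_def mean_spin_flip[OF \<eta>] by (simp add: algebra_simps)
  \<comment> \<open>Tangents are taken at the flipped value \<open>s'\<close>, the choice for which
    convexity bounds the difference from above. The constants 1 cancel because the two increments
    are opposite.\<close>
  have "(1 + s') * ln (1 + s') + (1 - s') * ln (1 - s') - ((1 + s) * ln (1 + s) + (1 - s) * ln (1 - s))
     \<le> (ln (1 + s') + 1) * (s' - s) + (ln (1 - s') + 1) * (s - s')"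
    using mult_ln_tangent[OF pos(3) pos(1)] mult_ln_tangent[OF pos(4) pos(2)] by simp
  also have "\<dots> = (ln (1 + s') - ln (1 - s')) * (s' - s)" by (simp add: algebra_simps)
  finally have "real n / g * ((1 + s') * ln (1 + s') + (1 - s') * ln (1 - s') - ((1 + s) * ln (1 + s) + (1 - s) * ln (1 - s)))
     \<le> real n / g * ((ln (1 + s') - ln (1 - s')) * (s' - s))"
    using g n by (intro mult_left_mono) auto
  \<comment> \<open>The prefactor n/g cancels against the increment of order g/n, which leaves an
    exponent of order one.\<close>
  also have "\<dots> = - 2 * spin \<eta> i * (ln (1 + s') - ln (1 - s'))"
    unfolding d using g n by (simp add: field_simps)
  finally have "tilt \<theta> n (flip \<eta> i) \<le> exp (real n * potential \<theta> n (magnetization n \<eta> / real n)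
      + (- 2 * spin \<eta> i * (ln (1 + s') - ln (1 - s'))))"
    unfolding tilt_def pot s_def[symmetric] s'_def[symmetric] by (simp add: algebra_simps diff_divide_distrib add_divide_distrib)
  also have "\<dots> = tilt \<theta> n \<eta> * exp (- 2 * spin \<eta> i * (ln (1 + s') - ln (1 - s')))"
    unfolding tilt_def by (rule exp_add)
  also have "exp (- 2 * spin \<eta> i * (ln (1 + s') - ln (1 - s'))) = qratio (spin \<eta> i * s')"
  proof -
    consider "spin \<eta> i = 1" | "spin \<eta> i = -1" using abs_spin[OF \<eta>] by linarith
    then show ?thesis
    proof cases
      case 1
      then show ?thesis using exp_two_ln_diff[OF pos(4) pos(3)] by (simp add: qratio_def algebra_simps)
    next
      case 2
      then show ?thesis using exp_two_ln_diff[OF pos(3) pos(4)] by (simp add: qratio_def)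
    qed
  qed
  finally show ?thesis by (simp add: s'_def g_def)
qed

lemma qratio_bounds:
  assumes "\<bar>u\<bar> \<le> g" "g < 1"
  shows "0 \<le> (1 - u) / (1 + u)" "(1 - u) / (1 + u) \<le> 2 / (1 - g)" "0 \<le> qratio u" "qratio u \<le> 4 / (1 - g)\<^sup>2"
proof -
  show p: "0 \<le> (1 - u) / (1 + u)" using assms by auto
  show p2: "(1 - u) / (1 + u) \<le> 2 / (1 - g)" using assms by (intro frac_le) auto
  show "0 \<le> qratio u" by (simp add: qratio_def)
  show "qratio u \<le> 4 / (1 - g)\<^sup>2"
    using power_mono[OF p2 p, of 2] by (simp add: qratio_def power_divide)
qed

text \<open>Allows the mean spin after a flip to be replaced by the one before; all denominators are
  at least 1 - g.\<close>

lemma qratio_lipschitz: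
  assumes "\<bar>u\<bar> \<le> g" "\<bar>u'\<bar> \<le> g" "g < 1"
  shows "qratio u' \<le> qratio u + 8 / (1 - g) ^ 3 * \<bar>u' - u\<bar>"
proof -
  define p where "p v = (1 - v) / (1 + v)" for v :: real
  have pos: "0 < 1 + u" "0 < 1 + u'" "0 < 1 - g" using assms by linarith+
  have "p u' - p u = 2 * (u - u') / ((1 + u) * (1 + u'))"
    using pos by (simp add: p_def field_simps)
  also have "\<dots> \<le> 2 * \<bar>u' - u\<bar> / ((1 - g) * (1 - g))"
  proof (rule frac_le)
    show "(1 - g) * (1 - g) \<le> (1 + u) * (1 + u')" using assms pos by (intro mult_mono) auto
    show "2 * (u - u') \<le> 2 * \<bar>u' - u\<bar>" using abs_ge_self[of "u - u'"] by (simp add: abs_minus_commute)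
  qed (use pos in auto)
  finally have 1: "p u' - p u \<le> 2 * \<bar>u' - u\<bar> / ((1 - g) * (1 - g))" .
  have 2: "p u' + p u \<le> 4 / (1 - g)" "0 \<le> p u' + p u"
    using qratio_bounds[OF assms(1,3)] qratio_bounds[OF assms(2,3)] by (simp_all add: p_def)
  have "qratio u' - qratio u = (p u' - p u) * (p u' + p u)"
    by (simp add: qratio_def p_def power2_eq_square algebra_simps)
  also have "\<dots> \<le> 2 * \<bar>u' - u\<bar> / ((1 - g) * (1 - g)) * (p u' + p u)"
    using 1 2 by (intro mult_right_mono)
  also have "\<dots> \<le> 2 * \<bar>u' - u\<bar> / ((1 - g) * (1 - g)) * (4 / (1 - g))"
    using 2 pos by (intro mult_left_mono) auto
  also have "\<dots> = 8 / (1 - g) ^ 3 * \<bar>u' - u\<bar>" by (simp add: power3_eq_cube)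
  finally show ?thesis by simp
qed

text \<open>With the mean spin in place of the neighbours, the flip rate is reversible.\<close>

lemma qratio_detailed_balance:
  assumes "\<bar>w\<bar> < 1" "e = 1 \<or> e = -1"
  shows "(1 + e * w)\<^sup>2 * qratio (e * w) = (1 - e * w)\<^sup>2"
  using assms by (auto simp: qratio_def power_divide)

text \<open>For a sign e, \<open>qratio (e * w)\<close> is affine in e with the even and odd parts
  as coefficients, and these depend on the mean spin alone.\<close>

definition qeven :: "real \<Rightarrow> real" where "qeven w = (qratio w + qratio (- w)) / 2"
definition qodd :: "real \<Rightarrow> real" where "qodd w = (qratio w - qratio (- w)) / 2"

lemma qratio_even_odd: "e = 1 \<or> e = -1 \<Longrightarrow> qratio (e * w) = qeven w + e * qodd w"
  by (auto simp: qeven_def qodd_def field_simps)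

text \<open>If both neighbours equal the mean \<open>s\<close>, detailed balance makes the left side
  zero, so every surviving term contains \<open>xp\<close> or \<open>xs\<close>. The last summand is
  linear in deviations and will vanish when summed over the circle.\<close>

lemma local_expansion:
  fixes \<gamma> s e xp xs x :: real
  assumes e: "e = 1 \<or> e = -1" and "e = x + s" and w: "\<bar>\<gamma> * s\<bar> < 1"
  defines "p \<equiv> (xp + s) + (xs + s)" and "q \<equiv> (xp + s) * (xs + s)"
    and "B \<equiv> qeven (\<gamma> * s)" and "C \<equiv> qodd (\<gamma> * s)"
  shows "(1 + \<gamma> * e * p + \<gamma>\<^sup>2 * q) * qratio (e * (\<gamma> * s)) - (1 - \<gamma> * e * p + \<gamma>\<^sup>2 * q)
    = (\<gamma> * (B + 1) + \<gamma>\<^sup>2 * C * s) * (xp * x + x * xs) + \<gamma>\<^sup>2 * (B - 1 + C * s) * (xp * xs)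
      + \<gamma>\<^sup>2 * C * (xp * x * xs)
      + (\<gamma> * (B + 1) * s + \<gamma> * C + \<gamma>\<^sup>2 * (B - 1) * s + \<gamma>\<^sup>2 * C * s\<^sup>2) * (xp + xs)"
proof -
  have q: "qratio (e * (\<gamma> * s)) = B + e * C" unfolding B_def C_def by (rule qratio_even_odd[OF e])
  have e2: "e * e = 1" using e by auto
  have bal: "(1 + e * (\<gamma> * s))\<^sup>2 * (B + e * C) = (1 - e * (\<gamma> * s))\<^sup>2"
    using qratio_detailed_balance[OF w e] q by simp
  \<comment> \<open>The summands with \<open>1 - e * e\<close> are zero; they make the equation a
    polynomial identity in e, provable by ring normalisation alone.\<close>
  have "(1 + \<gamma> * e * p + \<gamma>\<^sup>2 * q) * (B + e * C) - (1 - \<gamma> * e * p + \<gamma>\<^sup>2 * q)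
     = ((1 + e * (\<gamma> * s))\<^sup>2 * (B + e * C) - (1 - e * (\<gamma> * s))\<^sup>2)
      + (B + e * C) * (\<gamma> * e * (xp + xs) + \<gamma>\<^sup>2 * (q - s\<^sup>2)) + \<gamma> * e * (xp + xs) - \<gamma>\<^sup>2 * (q - s\<^sup>2)
      + \<gamma>\<^sup>2 * s\<^sup>2 * (1 - e * e) * (B + e * C) - \<gamma>\<^sup>2 * s\<^sup>2 * (1 - e * e)"
    unfolding p_def by (simp add: power2_eq_square algebra_simps)
  also have "\<dots> = (B + e * C) * (\<gamma> * e * (xp + xs) + \<gamma>\<^sup>2 * (q - s\<^sup>2)) + \<gamma> * e * (xp + xs) - \<gamma>\<^sup>2 * (q - s\<^sup>2)"
    using bal e2 by simp
  also have "\<dots> = \<gamma> * (B + 1) * e * (xp + xs) + \<gamma> * C * (e * e) * (xp + xs) + (\<gamma>\<^sup>2 * (B - 1) + \<gamma>\<^sup>2 * C * e) * (q - s\<^sup>2)"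
    by (simp add: algebra_simps)
  \<comment> \<open>With \<open>e * e\<close> = 1 and \<open>e\<close> = \<open>x + s\<close> the
    spin disappears from the coefficients.\<close>
  also have "\<dots> = \<gamma> * (B + 1) * (x + s) * (xp + xs) + \<gamma> * C * (xp + xs)
      + (\<gamma>\<^sup>2 * (B - 1) + \<gamma>\<^sup>2 * C * (x + s)) * (xp * xs + s * (xp + xs))"
    unfolding e2 using assms(2) by (simp add: q_def power2_eq_square algebra_simps)
  also have "\<dots> = (\<gamma> * (B + 1) + \<gamma>\<^sup>2 * C * s) * (xp * x + x * xs) + \<gamma>\<^sup>2 * (B - 1 + C * s) * (xp * xs)
      + \<gamma>\<^sup>2 * C * (xp * x * xs)
      + (\<gamma> * (B + 1) * s + \<gamma> * C + \<gamma>\<^sup>2 * (B - 1) * s + \<gamma>\<^sup>2 * C * s\<^sup>2) * (xp + xs)"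
    by (simp add: power2_eq_square algebra_simps)
  finally show ?thesis unfolding q .
qed

lemma sum_pred_site: "(\<Sum>i<n. f (pred_site n i)) = (\<Sum>i<n. f i :: real)"
proof -
  have "(\<Sum>i<n. f (pred_site n i)) = (\<Sum>i<n. f (pred_site n (succ_site n i)))"
    by (rule sum_succ_site[symmetric])
  also have "\<dots> = (\<Sum>i<n. f i)" by (intro sum.cong refl) (simp add: pred_succ_site)
  finally show ?thesis .
qed

lemma sum_pred_shift: "(\<Sum>i<n. f (pred_site n i) i) = (\<Sum>i<n. f i (succ_site n i) :: real)"
proof -
  have "(\<Sum>i<n. f (pred_site n i) i) = (\<Sum>i<n. f (pred_site n (succ_site n i)) (succ_site n i))"
    by (rule sum_succ_site[symmetric])
  also have "\<dots> = (\<Sum>i<n. f i (succ_site n i))" by (intro sum.cong refl) (simp add: pred_succ_site)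
  finally show ?thesis .
qed

lemma flip_rate_flip:
  assumes n: "3 \<le> n" and \<eta>: "\<eta> \<in> Configs n" "i < n"
  shows "flip_rate \<theta> n i (flip \<eta> i) = 1 + gam \<theta> n * spin \<eta> i * (spin \<eta> (pred_site n i) + spin \<eta> (succ_site n i))
      + (gam \<theta> n)\<^sup>2 * (spin \<eta> (pred_site n i) * spin \<eta> (succ_site n i))"
proof -
  have "pred_site n i \<noteq> i" "succ_site n i \<noteq> i" using n \<eta> by (auto simp: pred_site_if succ_site_if)
  then show ?thesis by (simp add: flip_rate_def spin_flip[OF \<eta>])
qed

text \<open>Since squares of spins are 1, the rate factorises as \<open>u * v\<close>, one factor
  per neighbour, each strictly between 0 and 2.\<close>

lemma flip_rate_bounds:
  assumes n: "0 < n" and \<gamma>: "0 < gam \<theta> n" "gam \<theta> n < 1" and \<eta>: "\<eta> \<in> Configs n" "i < n"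
  shows "0 < flip_rate \<theta> n i \<eta>" "flip_rate \<theta> n i \<eta> \<le> 4"
proof -
  define g where "g = gam \<theta> n"
  have g: "0 < g" "g < 1" using \<gamma> by (simp_all add: g_def)
  have pm: "spin \<eta> j = 1 \<or> spin \<eta> j = -1" if "j < n" for j
    using abs_spin[OF \<eta>(1) that] by linarith
  note pms = pm[OF \<eta>(2)] pm[OF pred_site_less[OF n, of i]] pm[OF succ_site_less[OF n, of i]]
  define u v where "u = 1 - g * (spin \<eta> i * spin \<eta> (pred_site n i))" and "v = 1 - g * (spin \<eta> i * spin \<eta> (succ_site n i))"
  have uv: "0 < u" "u \<le> 2" "0 < v" "v \<le> 2" using pms g by (auto simp: u_def v_def)
  have "flip_rate \<theta> n i \<eta> = 1 - g * spin \<eta> i * (spin \<eta> (pred_site n i) + spin \<eta> (succ_site n i))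
       + g\<^sup>2 * (spin \<eta> i * spin \<eta> i) * (spin \<eta> (pred_site n i) * spin \<eta> (succ_site n i))"
    using pms(1) by (auto simp: flip_rate_def g_def)
  also have "\<dots> = u * v" by (simp add: u_def v_def power2_eq_square algebra_simps)
  finally have e: "flip_rate \<theta> n i \<eta> = u * v" .
  show "0 < flip_rate \<theta> n i \<eta>" unfolding e using uv by simp
  show "flip_rate \<theta> n i \<eta> \<le> 4" unfolding e using mult_mono[OF uv(2) uv(4)] uv by simp
qed

text \<open>The factor 2 arises because the products with the left and with the right neighbour have
  the same sum over the circle.\<close>

definition coeff1 :: "real \<Rightarrow> real \<Rightarrow> real" where
  "coeff1 \<gamma> s = 2 * (\<gamma> * (qeven (\<gamma> * s) + 1) + \<gamma>\<^sup>2 * qodd (\<gamma> * s) * s)"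
definition coeff2 :: "real \<Rightarrow> real \<Rightarrow> real" where
  "coeff2 \<gamma> s = \<gamma>\<^sup>2 * (qeven (\<gamma> * s) - 1 + qodd (\<gamma> * s) * s)"
definition coeff3 :: "real \<Rightarrow> real \<Rightarrow> real" where
  "coeff3 \<gamma> s = \<gamma>\<^sup>2 * qodd (\<gamma> * s)"

definition succ_sum :: "nat \<Rightarrow> ((nat \<Rightarrow> nat) \<Rightarrow> nat \<Rightarrow> real) \<Rightarrow> (nat \<Rightarrow> nat) \<Rightarrow> real" where
  "succ_sum n A \<eta> = (\<Sum>i<n. A \<eta> i * dev n \<eta> (succ_site n i))"

lemma abs_scaled_mean_spin:
  assumes "0 < \<gamma>" "\<gamma> \<le> g" "\<eta> \<in> Configs n"
  shows "\<bar>\<gamma> * mean_spin n \<eta>\<bar> \<le> g"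
proof -
  have "\<gamma> * \<bar>mean_spin n \<eta>\<bar> \<le> g * 1"
    using assms abs_mean_spin[OF assms(3)] by (intro mult_mono) auto
  then show ?thesis using assms by (simp add: abs_mult)
qed

lemma rate_sum_eq:
  assumes n: "3 \<le> n" and \<gamma>: "0 < gam \<theta> n" "gam \<theta> n < 1" and \<eta>: "\<eta> \<in> Configs n"
  defines "s \<equiv> mean_spin n \<eta>"
  shows "(\<Sum>i<n. flip_rate \<theta> n i (flip \<eta> i) * qratio (spin \<eta> i * (gam \<theta> n * s)) - flip_rate \<theta> n i \<eta>)
    = coeff1 (gam \<theta> n) s * succ_sum n (dev n) \<eta>
    + coeff2 (gam \<theta> n) s * succ_sum n (\<lambda>\<eta> i. dev n \<eta> (pred_site n i)) \<eta>
    + coeff3 (gam \<theta> n) s * succ_sum n (\<lambda>\<eta> i. dev n \<eta> (pred_site n i) * dev n \<eta> i) \<eta>"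
proof -
  let ?\<gamma> = "gam \<theta> n" and ?x = "dev n \<eta>"
  let ?p = "pred_site n" and ?s = "succ_site n"
  define c where "c = ?\<gamma> * (qeven (?\<gamma> * s) + 1) * s + ?\<gamma> * qodd (?\<gamma> * s) + ?\<gamma>\<^sup>2 * (qeven (?\<gamma> * s) - 1) * s + ?\<gamma>\<^sup>2 * qodd (?\<gamma> * s) * s\<^sup>2"
  have w: "\<bar>?\<gamma> * s\<bar> < 1" using abs_scaled_mean_spin[OF \<gamma>(1) order_refl \<eta>] \<gamma>(2) by (simp add: s_def)
  have sp: "spin \<eta> j = ?x j + s" for j by (simp add: dev_def s_def)
  have i: "flip_rate \<theta> n i (flip \<eta> i) * qratio (spin \<eta> i * (?\<gamma> * s)) - flip_rate \<theta> n i \<eta>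
    = coeff1 ?\<gamma> s / 2 * (?x (?p i) * ?x i + ?x i * ?x (?s i)) + coeff2 ?\<gamma> s * (?x (?p i) * ?x (?s i))
      + coeff3 ?\<gamma> s * (?x (?p i) * ?x i * ?x (?s i)) + c * (?x (?p i) + ?x (?s i))" if "i < n" for i
  proof -
    have e: "spin \<eta> i = 1 \<or> spin \<eta> i = -1" using abs_spin[OF \<eta> that] by linarith
    have r: "flip_rate \<theta> n i \<eta> = 1 - ?\<gamma> * spin \<eta> i * (spin \<eta> (?p i) + spin \<eta> (?s i))
        + ?\<gamma>\<^sup>2 * (spin \<eta> (?p i) * spin \<eta> (?s i))"
      by (simp add: flip_rate_def)
    have c1: "coeff1 ?\<gamma> s / 2 = ?\<gamma> * (qeven (?\<gamma> * s) + 1) + ?\<gamma>\<^sup>2 * qodd (?\<gamma> * s) * s"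
      by (simp add: coeff1_def)
    show ?thesis
      unfolding flip_rate_flip[OF n \<eta> that] r sp[of "?p i"] sp[of "?s i"] c1 coeff2_def coeff3_def c_def
      by (rule local_expansion[OF e sp[of i] w])
  qed
  have "(\<Sum>i<n. flip_rate \<theta> n i (flip \<eta> i) * qratio (spin \<eta> i * (?\<gamma> * s)) - flip_rate \<theta> n i \<eta>)
    = coeff1 ?\<gamma> s / 2 * ((\<Sum>i<n. ?x (?p i) * ?x i) + (\<Sum>i<n. ?x i * ?x (?s i))) + coeff2 ?\<gamma> s * (\<Sum>i<n. ?x (?p i) * ?x (?s i))
      + coeff3 ?\<gamma> s * (\<Sum>i<n. ?x (?p i) * ?x i * ?x (?s i)) + c * ((\<Sum>i<n. ?x (?p i)) + (\<Sum>i<n. ?x (?s i)))"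
    unfolding sum_distrib_left sum.distrib[symmetric] by (intro sum.cong refl) (simp only: i lessThan_iff)
  also have "(\<Sum>i<n. ?x (?p i) * ?x i) = (\<Sum>i<n. ?x i * ?x (?s i))"
    by (rule sum_pred_shift[where f="\<lambda>i j. ?x i * ?x j"])
  also have "(\<Sum>i<n. ?x (?p i)) = 0" using sum_dev[of n \<eta>] n by (simp add: sum_pred_site)
  also have "(\<Sum>i<n. ?x (?s i)) = 0" using sum_dev[of n \<eta>] n by (simp add: sum_succ_site)
  finally show ?thesis by (simp add: succ_sum_def)
qed

lemma coeff_bounds:
  assumes \<gamma>: "0 < \<gamma>" "\<gamma> \<le> g" "g < 1" and s: "\<bar>s\<bar> \<le> 1"
  defines "Q \<equiv> 4 / (1 - g)\<^sup>2"
  shows "\<bar>coeff1 \<gamma> s\<bar> \<le> 6 * Q" "\<bar>coeff2 \<gamma> s\<bar> \<le> 6 * Q" "\<bar>coeff3 \<gamma> s\<bar> \<le> 6 * Q"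
proof -
  have w: "\<bar>\<gamma> * s\<bar> \<le> g" using mult_mono[OF \<gamma>(2) s] \<gamma> by (simp add: abs_mult)
  then have w': "\<bar>- (\<gamma> * s)\<bar> \<le> g" by simp
  have Q: "0 \<le> qratio (\<gamma> * s)" "qratio (\<gamma> * s) \<le> Q" "0 \<le> qratio (- (\<gamma> * s))" "qratio (- (\<gamma> * s)) \<le> Q"
    using qratio_bounds[OF w \<gamma>(3)] qratio_bounds[OF w' \<gamma>(3)] by (auto simp: Q_def)
  have B: "\<bar>qeven (\<gamma> * s)\<bar> \<le> Q" and C: "\<bar>qodd (\<gamma> * s)\<bar> \<le> Q"
    using Q by (auto simp: qeven_def qodd_def)
  have "(1 - g)\<^sup>2 \<le> 1" using \<gamma> by (intro power_le_one) auto
  then have Q1: "1 \<le> Q" using \<gamma> by (simp add: Q_def field_simps)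
  have g2: "0 \<le> \<gamma>\<^sup>2" "\<gamma>\<^sup>2 \<le> 1" using \<gamma> by (auto intro: power_le_one)
  have Cs: "\<bar>qodd (\<gamma> * s) * s\<bar> \<le> Q * 1"
    unfolding abs_mult using C s by (intro mult_mono) auto
  have "\<bar>\<gamma> * (qeven (\<gamma> * s) + 1)\<bar> \<le> 1 * (Q + 1)"
    unfolding abs_mult using B \<gamma> by (intro mult_mono) auto
  moreover have "\<bar>\<gamma>\<^sup>2 * (qodd (\<gamma> * s) * s)\<bar> \<le> 1 * (Q * 1)"
    unfolding abs_mult[of "\<gamma>\<^sup>2"] using Cs g2 by (intro mult_mono) auto
  ultimately have "\<bar>\<gamma> * (qeven (\<gamma> * s) + 1) + \<gamma>\<^sup>2 * (qodd (\<gamma> * s) * s)\<bar> \<le> 1 * (Q + 1) + 1 * (Q * 1)"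
    by (intro order_trans[OF abs_triangle_ineq add_mono])
  also have "\<dots> \<le> 3 * Q" using Q1 by simp
  finally have "\<bar>\<gamma> * (qeven (\<gamma> * s) + 1) + \<gamma>\<^sup>2 * (qodd (\<gamma> * s) * s)\<bar> \<le> 3 * Q" .
  then show "\<bar>coeff1 \<gamma> s\<bar> \<le> 6 * Q"
    unfolding coeff1_def mult.assoc abs_mult[of 2] by simp
  have "\<bar>\<gamma>\<^sup>2 * (qeven (\<gamma> * s) - 1 + qodd (\<gamma> * s) * s)\<bar> \<le> 1 * (2 * Q + 1)"
    unfolding abs_mult[of "\<gamma>\<^sup>2"] using B Cs g2 by (intro mult_mono) auto
  then show "\<bar>coeff2 \<gamma> s\<bar> \<le> 6 * Q" using Q1 unfolding coeff2_def by simp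
  have "\<bar>\<gamma>\<^sup>2 * qodd (\<gamma> * s)\<bar> \<le> 1 * Q"
    unfolding abs_mult[of "\<gamma>\<^sup>2"] using C g2 by (intro mult_mono) auto
  then show "\<bar>coeff3 \<gamma> s\<bar> \<le> 6 * Q" using Q1 unfolding coeff3_def by simp
qed

lemma tilt_pos: "0 < tilt \<theta> n \<eta>"
  by (simp add: tilt_def)

lemma tilt_exchange: "i < n \<Longrightarrow> j < n \<Longrightarrow> tilt \<theta> n (exchange \<eta> i j) = tilt \<theta> n \<eta>"
  by (simp add: tilt_def magnetization_eq mean_spin_exchange)

text \<open>64/n is the rate bound 4 times the Lipschitz constant 8 times the change 2/n of the
  argument. Being O(1/n) per site, the error stays of order one over all sites.\<close>

lemma flip_inflow_le:
  assumes n: "3 \<le> n" and \<gamma>: "0 < gam \<theta> n" "gam \<theta> n \<le> g" "g < 1" and \<eta>: "\<eta> \<in> Configs n" "i < n"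
  shows "tilt \<theta> n (flip \<eta> i) * flip_rate \<theta> n i (flip \<eta> i) \<le> tilt \<theta> n \<eta> *
    (flip_rate \<theta> n i (flip \<eta> i) * qratio (spin \<eta> i * (gam \<theta> n * mean_spin n \<eta>)) + 64 / (1 - g) ^ 3 / real n)"
proof -
  let ?\<gamma> = "gam \<theta> n"
  have \<gamma>1: "?\<gamma> < 1" using \<gamma> by simp
  have n0: "0 < n" using n by simp
  define u where "u = spin \<eta> i * (?\<gamma> * mean_spin n \<eta>)"
  define u' where "u' = spin \<eta> i * (?\<gamma> * mean_spin n (flip \<eta> i))"
  have sp: "\<bar>spin \<eta> i\<bar> = 1" by (rule abs_spin[OF \<eta>])
  have f: "flip \<eta> i \<in> Configs n" by (rule flip_in_Configs[OF \<eta>])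
  have u: "\<bar>u\<bar> \<le> g" "\<bar>u'\<bar> \<le> g"
    using abs_scaled_mean_spin[OF \<gamma>(1,2) \<eta>(1)] abs_scaled_mean_spin[OF \<gamma>(1,2) f] sp
    by (simp_all add: u_def u'_def abs_mult)
  have "u' - u = - (2 * ?\<gamma> * (spin \<eta> i * spin \<eta> i) / real n)"
    unfolding u_def u'_def mean_spin_flip[OF \<eta>] by (simp add: algebra_simps)
  also have "spin \<eta> i * spin \<eta> i = 1" using sp by (metis abs_mult_self_eq mult_1)
  finally have "\<bar>u' - u\<bar> = 2 * ?\<gamma> / real n" using \<gamma> by simp
  also have "\<dots> \<le> 2 / real n" using \<gamma>1 n0 by (intro divide_right_mono) auto
  finally have d: "\<bar>u' - u\<bar> \<le> 2 / real n" .
  have "qratio u' \<le> qratio u + 8 / (1 - g) ^ 3 * \<bar>u' - u\<bar>"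
    by (rule qratio_lipschitz[OF u \<gamma>(3)])
  also have "8 / (1 - g) ^ 3 * \<bar>u' - u\<bar> \<le> 8 / (1 - g) ^ 3 * (2 / real n)"
    using d \<gamma> by (intro mult_left_mono) auto
  finally have q: "qratio u' \<le> qratio u + 16 / (1 - g) ^ 3 / real n" by simp
  note r = flip_rate_bounds[OF n0 \<gamma>(1) \<gamma>1 f \<eta>(2)]
  have "tilt \<theta> n (flip \<eta> i) * flip_rate \<theta> n i (flip \<eta> i) \<le> (tilt \<theta> n \<eta> * qratio u') * flip_rate \<theta> n i (flip \<eta> i)"
    using tilt_flip_le[OF n0 \<gamma>(1) \<gamma>1 \<eta>] r by (intro mult_right_mono) (auto simp: u'_def)
  also have "\<dots> = tilt \<theta> n \<eta> * (flip_rate \<theta> n i (flip \<eta> i) * qratio u')" by simp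
  also have "\<dots> \<le> tilt \<theta> n \<eta> * (flip_rate \<theta> n i (flip \<eta> i) * qratio u + 64 / (1 - g) ^ 3 / real n)"
  proof (intro mult_left_mono)
    have "flip_rate \<theta> n i (flip \<eta> i) * qratio u' \<le> flip_rate \<theta> n i (flip \<eta> i) * (qratio u + 16 / (1 - g) ^ 3 / real n)"
      using q r by (intro mult_left_mono) auto
    also have "\<dots> = flip_rate \<theta> n i (flip \<eta> i) * qratio u + flip_rate \<theta> n i (flip \<eta> i) * (16 / (1 - g) ^ 3 / real n)"
      by (rule distrib_left)
    also have "flip_rate \<theta> n i (flip \<eta> i) * (16 / (1 - g) ^ 3 / real n) \<le> 4 * (16 / (1 - g) ^ 3 / real n)"
      using r \<gamma> by (intro mult_right_mono) auto
    finally show "flip_rate \<theta> n i (flip \<eta> i) * qratio u' \<le> flip_rate \<theta> n i (flip \<eta> i) * qratio u + 64 / (1 - g) ^ 3 / real n"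
      by simp
  qed (simp add: tilt_def)
  finally show ?thesis by (simp add: u_def)
qed

text \<open>Reindexing the inflow by the flip leaves \<open>h\<close> at the current configuration
  and moves weight and rate to the flipped one. Subtracting the outflow gives the sum evaluated in
  \<open>rate_sum_eq\<close>.\<close>

lemma flip_production_le:
  assumes n: "3 \<le> n" and \<gamma>: "0 < gam \<theta> n" "gam \<theta> n \<le> g" "g < 1"
    and h: "\<And>\<eta>. \<eta> \<in> Configs n \<Longrightarrow> 0 \<le> h \<eta>"
  shows "(\<Sum>\<eta>\<in>Configs n. tilt \<theta> n \<eta> * (\<Sum>i<n. flip_rate \<theta> n i \<eta> * (h (flip \<eta> i) - h \<eta>)))
    \<le> (\<Sum>\<eta>\<in>Configs n. tilt \<theta> n \<eta> * (h \<eta> *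
        (coeff1 (gam \<theta> n) (mean_spin n \<eta>) * succ_sum n (dev n) \<eta>
       + coeff2 (gam \<theta> n) (mean_spin n \<eta>) * succ_sum n (\<lambda>\<eta> i. dev n \<eta> (pred_site n i)) \<eta>
       + coeff3 (gam \<theta> n) (mean_spin n \<eta>) * succ_sum n (\<lambda>\<eta> i. dev n \<eta> (pred_site n i) * dev n \<eta> i) \<eta>
       + 64 / (1 - g) ^ 3)))"
proof -
  let ?c = "\<lambda>i \<eta>. flip_rate \<theta> n i \<eta>"
  define out where "out = (\<Sum>\<eta>\<in>Configs n. \<Sum>i<n. tilt \<theta> n \<eta> * ?c i \<eta> * h \<eta>)"
  have split: "(\<Sum>\<eta>\<in>Configs n. tilt \<theta> n \<eta> * (\<Sum>i<n. ?c i \<eta> * (h (flip \<eta> i) - h \<eta>)))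
    = (\<Sum>\<eta>\<in>Configs n. \<Sum>i<n. tilt \<theta> n \<eta> * ?c i \<eta> * h (flip \<eta> i))
     - out"
    unfolding out_def by (simp add: sum_subtractf[symmetric] sum_distrib_left right_diff_distrib mult.assoc)
  have "(\<Sum>\<eta>\<in>Configs n. \<Sum>i<n. tilt \<theta> n \<eta> * ?c i \<eta> * h (flip \<eta> i))
     = (\<Sum>i<n. \<Sum>\<eta>\<in>Configs n. tilt \<theta> n \<eta> * ?c i \<eta> * h (flip \<eta> i))" by (rule sum.swap)
  also have "\<dots> = (\<Sum>i<n. \<Sum>\<eta>\<in>Configs n. tilt \<theta> n (flip \<eta> i) * ?c i (flip \<eta> i) * h \<eta>)"
  proof (rule sum.cong[OF refl])
    fix i assume "i \<in> {..<n}"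
    then have i: "i < n" by simp
    have "(\<Sum>\<eta>\<in>Configs n. tilt \<theta> n \<eta> * ?c i \<eta> * h (flip \<eta> i))
      = (\<Sum>\<eta>\<in>Configs n. tilt \<theta> n (flip \<eta> i) * ?c i (flip \<eta> i) * h (flip (flip \<eta> i) i))"
      by (rule sum_flip[OF i, symmetric])
    also have "\<dots> = (\<Sum>\<eta>\<in>Configs n. tilt \<theta> n (flip \<eta> i) * ?c i (flip \<eta> i) * h \<eta>)"
      by (intro sum.cong refl) (simp add: flip_flip i)
    finally show "(\<Sum>\<eta>\<in>Configs n. tilt \<theta> n \<eta> * ?c i \<eta> * h (flip \<eta> i))
      = (\<Sum>\<eta>\<in>Configs n. tilt \<theta> n (flip \<eta> i) * ?c i (flip \<eta> i) * h \<eta>)" .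
  qed
  also have "\<dots> = (\<Sum>\<eta>\<in>Configs n. \<Sum>i<n. tilt \<theta> n (flip \<eta> i) * ?c i (flip \<eta> i) * h \<eta>)" by (rule sum.swap)
  also have "\<dots> \<le> (\<Sum>\<eta>\<in>Configs n. \<Sum>i<n. tilt \<theta> n \<eta> * (?c i (flip \<eta> i) * qratio (spin \<eta> i * (gam \<theta> n * mean_spin n \<eta>)) + 64 / (1 - g) ^ 3 / real n) * h \<eta>)"
    by (intro sum_mono mult_right_mono flip_inflow_le[OF n \<gamma>] h) auto
  finally have "(\<Sum>\<eta>\<in>Configs n. tilt \<theta> n \<eta> * (\<Sum>i<n. ?c i \<eta> * (h (flip \<eta> i) - h \<eta>))) \<le> (\<Sum>\<eta>\<in>Configs n. \<Sum>i<n. tilt \<theta> n \<eta> * (?c i (flip \<eta> i) * qratio (spin \<eta> i * (gam \<theta> n * mean_spin n \<eta>)) + 64 / (1 - g) ^ 3 / real n) * h \<eta>) - out"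
    unfolding split by (rule diff_right_mono)
  also have "(\<Sum>\<eta>\<in>Configs n. \<Sum>i<n. tilt \<theta> n \<eta> * (?c i (flip \<eta> i) * qratio (spin \<eta> i * (gam \<theta> n * mean_spin n \<eta>)) + 64 / (1 - g) ^ 3 / real n) * h \<eta>) - out = (\<Sum>\<eta>\<in>Configs n. tilt \<theta> n \<eta> * (h \<eta> *
      ((\<Sum>i<n. ?c i (flip \<eta> i) * qratio (spin \<eta> i * (gam \<theta> n * mean_spin n \<eta>)) - ?c i \<eta>) + (\<Sum>i<n. 64 / (1 - g) ^ 3 / real n))))"
    unfolding out_def
  proof (subst sum_subtractf[symmetric], rule sum.cong[OF refl])
    fix \<eta>
    have *: "(\<Sum>i<n. t * (A i + w) * x) - (\<Sum>i<n. t * c i * x) = t * (x * ((\<Sum>i<n. A i - c i) + (\<Sum>i<n. w)))"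
      for t w x :: real and A c and n :: nat
      by (induction n) (simp_all add: algebra_simps)
    show "(\<Sum>i<n. tilt \<theta> n \<eta> * (?c i (flip \<eta> i) * qratio (spin \<eta> i * (gam \<theta> n * mean_spin n \<eta>)) + 64 / (1 - g) ^ 3 / real n) * h \<eta>)
       - (\<Sum>i<n. tilt \<theta> n \<eta> * ?c i \<eta> * h \<eta>) = tilt \<theta> n \<eta> * (h \<eta> *
      ((\<Sum>i<n. ?c i (flip \<eta> i) * qratio (spin \<eta> i * (gam \<theta> n * mean_spin n \<eta>)) - ?c i \<eta>) + (\<Sum>i<n. 64 / (1 - g) ^ 3 / real n)))"
      by (rule *)
  qed
  also have "\<dots> = (\<Sum>\<eta>\<in>Configs n. tilt \<theta> n \<eta> * (h \<eta> *
        (coeff1 (gam \<theta> n) (mean_spin n \<eta>) * succ_sum n (dev n) \<eta>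
       + coeff2 (gam \<theta> n) (mean_spin n \<eta>) * succ_sum n (\<lambda>\<eta> i. dev n \<eta> (pred_site n i)) \<eta>
       + coeff3 (gam \<theta> n) (mean_spin n \<eta>) * succ_sum n (\<lambda>\<eta> i. dev n \<eta> (pred_site n i) * dev n \<eta> i) \<eta>
       + 64 / (1 - g) ^ 3)))"
  proof (rule sum.cong[OF refl])
    fix \<eta> assume \<eta>: "\<eta> \<in> Configs n"
    have "(\<Sum>i<n. 64 / (1 - g) ^ 3 / real n) = 64 / (1 - g) ^ 3" using n by simp
    moreover have "gam \<theta> n < 1" using \<gamma> by simp
    ultimately show "tilt \<theta> n \<eta> * (h \<eta> *
      ((\<Sum>i<n. ?c i (flip \<eta> i) * qratio (spin \<eta> i * (gam \<theta> n * mean_spin n \<eta>)) - ?c i \<eta>) + (\<Sum>i<n. 64 / (1 - g) ^ 3 / real n)))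
     = tilt \<theta> n \<eta> * (h \<eta> *
        (coeff1 (gam \<theta> n) (mean_spin n \<eta>) * succ_sum n (dev n) \<eta>
       + coeff2 (gam \<theta> n) (mean_spin n \<eta>) * succ_sum n (\<lambda>\<eta> i. dev n \<eta> (pred_site n i)) \<eta>
       + coeff3 (gam \<theta> n) (mean_spin n \<eta>) * succ_sum n (\<lambda>\<eta> i. dev n \<eta> (pred_site n i) * dev n \<eta> i) \<eta>
       + 64 / (1 - g) ^ 3))"
      by (simp only: rate_sum_eq[OF n \<gamma>(1) _ \<eta>])
  qed
  finally show ?thesis .
qed

text \<open>Each jump contributes the square of the increment of sqrt h. The contribution of the
  flips is nonnegative and is dropped.\<close>

lemma carre_du_champ_lower:
  assumes a: "0 < a" and n: "3 \<le> n" and \<gamma>: "0 < gam \<theta> n" "gam \<theta> n < 1" and \<eta>: "\<eta> \<in> Configs n"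
    and h: "\<And>\<xi>. \<xi> \<in> Configs n \<Longrightarrow> 0 \<le> h \<xi>"
  shows "sqrt (real n) * (real n)\<^sup>2 / 2 * (\<Sum>i<n. (sqrt (h (exchange \<eta> i (succ_site n i))) - sqrt (h \<eta>))\<^sup>2)
    \<le> 1 / 2 * (fast_gen \<theta> a n h \<eta> - 2 * sqrt (h \<eta>) * fast_gen \<theta> a n (\<lambda>\<xi>. sqrt (h \<xi>)) \<eta>)"
proof -
  have n0: "0 < n" using n by simp
  have sq: "(h \<xi> - h \<eta>) - 2 * sqrt (h \<eta>) * (sqrt (h \<xi>) - sqrt (h \<eta>)) = (sqrt (h \<xi>) - sqrt (h \<eta>))\<^sup>2"
    if "\<xi> \<in> Configs n" for \<xi>
    using h[OF that] h[OF \<eta>] by (simp add: power2_diff algebra_simps)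
  have ex: "exchange \<eta> i (succ_site n i) \<in> Configs n" if "i < n" for i
    by (intro exchange_in_Configs[OF \<eta> that] succ_site_less n0)
  have "fast_gen \<theta> a n h \<eta> - 2 * sqrt (h \<eta>) * fast_gen \<theta> a n (\<lambda>\<xi>. sqrt (h \<xi>)) \<eta>
    = sqrt (real n) * ((real n)\<^sup>2 * (\<Sum>i<n. (h (exchange \<eta> i (succ_site n i)) - h \<eta>)
          - 2 * sqrt (h \<eta>) * (sqrt (h (exchange \<eta> i (succ_site n i))) - sqrt (h \<eta>)))
      + a * (\<Sum>i<n. flip_rate \<theta> n i \<eta> * ((h (flip \<eta> i) - h \<eta>) - 2 * sqrt (h \<eta>) * (sqrt (h (flip \<eta> i)) - sqrt (h \<eta>)))))"
    unfolding fast_gen_def gen_def sum_subtractf right_diff_distrib[of "flip_rate \<theta> n _ \<eta>"]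
    by (simp add: sum_distrib_left[symmetric] sum_subtractf algebra_simps)
  also have "\<dots> = sqrt (real n) * ((real n)\<^sup>2 * (\<Sum>i<n. (sqrt (h (exchange \<eta> i (succ_site n i))) - sqrt (h \<eta>))\<^sup>2)
      + a * (\<Sum>i<n. flip_rate \<theta> n i \<eta> * (sqrt (h (flip \<eta> i)) - sqrt (h \<eta>))\<^sup>2))"
    by (simp add: sq ex flip_in_Configs[OF \<eta>])
  also have "\<dots> \<ge> sqrt (real n) * ((real n)\<^sup>2 * (\<Sum>i<n. (sqrt (h (exchange \<eta> i (succ_site n i))) - sqrt (h \<eta>))\<^sup>2))"
    using a flip_rate_bounds(1)[OF n0 \<gamma> \<eta>]
    by (intro mult_left_mono) (auto intro!: mult_nonneg_nonneg sum_nonneg simp: less_imp_le)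
  finally show ?thesis by simp
qed

theorem entropy_production_le:
  assumes n: "3 \<le> n" and \<gamma>: "0 < gam \<theta> n" "gam \<theta> n \<le> g" "g < 1" and z: "0 \<le> z"
    and h: "\<And>\<eta>. \<eta> \<in> Configs n \<Longrightarrow> 0 \<le> h \<eta>"
  defines "C \<equiv> 24 / (1 - g)\<^sup>2"
  assumes a: "0 < a" "a \<le> 1 / (1200 * C)"
  shows "(\<Sum>\<eta>\<in>Configs n. z * tilt \<theta> n \<eta> * fast_gen \<theta> a n h \<eta>)
    \<le> (\<Sum>\<eta>\<in>Configs n. z * tilt \<theta> n \<eta> * (1 / 2 * (fast_gen \<theta> a n h \<eta>
          - 2 * sqrt (h \<eta>) * fast_gen \<theta> a n (\<lambda>\<xi>. sqrt (h \<xi>)) \<eta>)))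
     + a * (250 * C + 64 / (1 - g) ^ 3) * sqrt (real n) * (\<Sum>\<eta>\<in>Configs n. z * tilt \<theta> n \<eta> * h \<eta>)"
proof -
  have n0: "0 < n" using n by simp
  have \<gamma>1: "gam \<theta> n < 1" using \<gamma> by simp
  interpret exchangeable n "\<lambda>\<eta>. z * tilt \<theta> n \<eta>"
    using n z by unfold_locales (auto simp: tilt_exchange less_imp_le[OF tilt_pos])
  define \<phi> where "\<phi> \<eta> = sqrt (h \<eta>)" for \<eta>
  have \<phi>: "(\<phi> \<eta>)\<^sup>2 = h \<eta>" if "\<eta> \<in> Configs n" for \<eta> using h[OF that] by (simp add: \<phi>_def)
  define F where "F = ev (\<lambda>\<eta>. (\<phi> \<eta>)\<^sup>2)"
  have F: "F = (\<Sum>\<eta>\<in>Configs n. z * tilt \<theta> n \<eta> * h \<eta>)" unfolding F_def ev_def by (intro sum.cong refl) (simp add: \<phi>)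
  have F0: "0 \<le> F" unfolding F_def by (rule ev_nonneg) auto
  define D where "D = dirichlet \<phi>"
  have D0: "0 \<le> D" unfolding D_def by (rule dirichlet_nonneg)
  have C0: "0 < C" using \<gamma> by (simp add: C_def)
  \<comment> \<open>Three local sums cost 3 * a * b = 1/4 of n^2 times the Dirichlet form, half of
    the share 1/2 that the energy provides.\<close>
  define b where "b = 1 / (12 * a)"
  have b: "0 < b" using a by (simp add: b_def)
  define W where "W = 64 / (1 - g) ^ 3"
  have loc: "ev (\<lambda>\<eta>. (\<phi> \<eta>)\<^sup>2 * (\<kappa> (mean_spin n \<eta>) * succ_sum n A \<eta>))
      \<le> (b + 8192 * C\<^sup>2 / b) * (real n)\<^sup>2 * D + (5120 * C\<^sup>2 / b + 32 * C) * F"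
    if A: "A \<in> local_functions n" and \<kappa>: "\<And>s. \<bar>s\<bar> \<le> 1 \<Longrightarrow> \<bar>\<kappa> s\<bar> \<le> C" for A \<kappa>
    unfolding succ_sum_def D_def F_def
    by (rule ev_local_function_le[OF A _ _ b]) (auto intro!: \<kappa> abs_mean_spin simp: mean_spin_exchange)
  have C6: "C = 6 * (4 / (1 - g)\<^sup>2)" by (simp add: C_def)
  have exch0: "(\<Sum>\<eta>\<in>Configs n. z * tilt \<theta> n \<eta> * (\<Sum>i<n. h (exchange \<eta> i (succ_site n i)) - h \<eta>)) = 0"
  proof -
    have "ev (\<lambda>\<eta>. \<Sum>i<n. h (exchange \<eta> i (succ_site n i)) - h \<eta>)
      = (\<Sum>i<n. ev (\<lambda>\<eta>. h (exchange \<eta> i (succ_site n i))) - ev h)"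
      by (simp only: ev_sum ev_diff)
    also have "\<dots> = 0"
      by (intro sum.neutral ballI) (simp add: ev_exchange succ_site_less n0)
    finally show ?thesis by (simp add: ev_def)
  qed
  have flip_part: "(\<Sum>\<eta>\<in>Configs n. z * tilt \<theta> n \<eta> * (\<Sum>i<n. flip_rate \<theta> n i \<eta> * (h (flip \<eta> i) - h \<eta>)))
     \<le> 3 * ((b + 8192 * C\<^sup>2 / b) * (real n)\<^sup>2 * D + (5120 * C\<^sup>2 / b + 32 * C) * F) + W * F"
  proof -
    have "(\<Sum>\<eta>\<in>Configs n. z * tilt \<theta> n \<eta> * (\<Sum>i<n. flip_rate \<theta> n i \<eta> * (h (flip \<eta> i) - h \<eta>)))
      \<le> ev (\<lambda>\<eta>. h \<eta> *
        (coeff1 (gam \<theta> n) (mean_spin n \<eta>) * succ_sum n (dev n) \<eta>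
       + coeff2 (gam \<theta> n) (mean_spin n \<eta>) * succ_sum n (\<lambda>\<eta> i. dev n \<eta> (pred_site n i)) \<eta>
       + coeff3 (gam \<theta> n) (mean_spin n \<eta>) * succ_sum n (\<lambda>\<eta> i. dev n \<eta> (pred_site n i) * dev n \<eta> i) \<eta>
       + W))"
      unfolding ev_def mult.assoc sum_distrib_left[of z, symmetric] W_def
      by (intro mult_left_mono z flip_production_le[OF n \<gamma>] h)
    also have "\<dots> = ev (\<lambda>\<eta>. (\<phi> \<eta>)\<^sup>2 * (coeff1 (gam \<theta> n) (mean_spin n \<eta>) * succ_sum n (dev n) \<eta>)
      + (\<phi> \<eta>)\<^sup>2 * (coeff2 (gam \<theta> n) (mean_spin n \<eta>) * succ_sum n (\<lambda>\<eta> i. dev n \<eta> (pred_site n i)) \<eta>)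
      + (\<phi> \<eta>)\<^sup>2 * (coeff3 (gam \<theta> n) (mean_spin n \<eta>) * succ_sum n (\<lambda>\<eta> i. dev n \<eta> (pred_site n i) * dev n \<eta> i) \<eta>)
      + W * (\<phi> \<eta>)\<^sup>2)"
      by (intro ev_cong) (simp add: \<phi> distrib_left mult.commute)
    also have "\<dots> = ev (\<lambda>\<eta>. (\<phi> \<eta>)\<^sup>2 * (coeff1 (gam \<theta> n) (mean_spin n \<eta>) * succ_sum n (dev n) \<eta>))
      + ev (\<lambda>\<eta>. (\<phi> \<eta>)\<^sup>2 * (coeff2 (gam \<theta> n) (mean_spin n \<eta>) * succ_sum n (\<lambda>\<eta> i. dev n \<eta> (pred_site n i)) \<eta>))
      + ev (\<lambda>\<eta>. (\<phi> \<eta>)\<^sup>2 * (coeff3 (gam \<theta> n) (mean_spin n \<eta>) * succ_sum n (\<lambda>\<eta> i. dev n \<eta> (pred_site n i) * dev n \<eta> i) \<eta>))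
      + W * F"
      by (simp only: ev_add ev_cmult F_def)
    also have "\<dots> \<le> ((b + 8192 * C\<^sup>2 / b) * (real n)\<^sup>2 * D + (5120 * C\<^sup>2 / b + 32 * C) * F)
       + ((b + 8192 * C\<^sup>2 / b) * (real n)\<^sup>2 * D + (5120 * C\<^sup>2 / b + 32 * C) * F)
       + ((b + 8192 * C\<^sup>2 / b) * (real n)\<^sup>2 * D + (5120 * C\<^sup>2 / b + 32 * C) * F) + W * F"
      using coeff_bounds[OF \<gamma>, folded C6] by (intro add_mono order_refl loc) (auto simp: local_functions_def)
    finally have "(\<Sum>\<eta>\<in>Configs n. z * tilt \<theta> n \<eta> * (\<Sum>i<n. flip_rate \<theta> n i \<eta> * (h (flip \<eta> i) - h \<eta>)))
      \<le> ((b + 8192 * C\<^sup>2 / b) * (real n)\<^sup>2 * D + (5120 * C\<^sup>2 / b + 32 * C) * F)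
       + ((b + 8192 * C\<^sup>2 / b) * (real n)\<^sup>2 * D + (5120 * C\<^sup>2 / b + 32 * C) * F)
       + ((b + 8192 * C\<^sup>2 / b) * (real n)\<^sup>2 * D + (5120 * C\<^sup>2 / b + 32 * C) * F) + W * F" .
    moreover have "x + x + x + y = 3 * x + y" for x y :: real by simp
    ultimately show ?thesis by metis
  qed
  have aC: "a * C \<le> 1 / 1200" using a C0 by (simp add: field_simps)
  have "a * (3 * ((b + 8192 * C\<^sup>2 / b) * (real n)\<^sup>2 * D + (5120 * C\<^sup>2 / b + 32 * C) * F) + W * F)
     = (1 / 4 + 294912 * (a * C)\<^sup>2) * ((real n)\<^sup>2 * D) + a * (184320 * C * (a * C) + 96 * C + W) * F"
    using a by (simp add: b_def field_simps power2_eq_square)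
  also have "\<dots> \<le> 1 / 2 * ((real n)\<^sup>2 * D) + a * (250 * C + W) * F"
  proof (intro add_mono mult_right_mono mult_left_mono)
    \<comment> \<open>294912 = 3 * 12 * 8192, and 294912 / 1200^2 is below the remaining 1/4; this
      is the origin of 1200.\<close>
    have "(a * C)\<^sup>2 \<le> (1 / 1200)\<^sup>2" using aC a C0 by (intro power_mono) auto
    then show "1 / 4 + 294912 * (a * C)\<^sup>2 \<le> 1 / 2" by (simp add: power_divide)
    \<comment> \<open>184320 / 1200 + 96 = 249.6, rounded up to 250.\<close>
    have "184320 * C * (a * C) \<le> 184320 * C * (1 / 1200)" using aC C0 by (intro mult_left_mono) auto
    then show "184320 * C * (a * C) + 96 * C \<le> 250 * C" using C0 by simp
  qed (use D0 F0 a in auto)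
  finally have small: "a * (3 * ((b + 8192 * C\<^sup>2 / b) * (real n)\<^sup>2 * D + (5120 * C\<^sup>2 / b + 32 * C) * F) + W * F)
     \<le> 1 / 2 * ((real n)\<^sup>2 * D) + a * (250 * C + W) * F" .
  have "(\<Sum>\<eta>\<in>Configs n. z * tilt \<theta> n \<eta> * fast_gen \<theta> a n h \<eta>)
    = sqrt (real n) * ((real n)\<^sup>2 * (\<Sum>\<eta>\<in>Configs n. z * tilt \<theta> n \<eta> * (\<Sum>i<n. h (exchange \<eta> i (succ_site n i)) - h \<eta>))
      + a * (\<Sum>\<eta>\<in>Configs n. z * tilt \<theta> n \<eta> * (\<Sum>i<n. flip_rate \<theta> n i \<eta> * (h (flip \<eta> i) - h \<eta>))))"
    unfolding sum_distrib_left[of "(real n)\<^sup>2"] sum_distrib_left[of a] sum.distrib[symmetric] sum_distrib_left[of "sqrt (real n)"]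
    by (intro sum.cong refl) (simp add: fast_gen_def gen_def algebra_simps)
  also have "\<dots> \<le> sqrt (real n) * (a * (3 * ((b + 8192 * C\<^sup>2 / b) * (real n)\<^sup>2 * D + (5120 * C\<^sup>2 / b + 32 * C) * F) + W * F))"
    unfolding exch0 using flip_part a by (intro mult_left_mono) auto
  also have "\<dots> \<le> sqrt (real n) * (1 / 2 * ((real n)\<^sup>2 * D) + a * (250 * C + W) * F)"
    by (intro mult_left_mono small) auto
  also have "\<dots> = sqrt (real n) * (real n)\<^sup>2 / 2 * D + a * (250 * C + W) * sqrt (real n) * F"
    by (simp add: algebra_simps)
  also have "sqrt (real n) * (real n)\<^sup>2 / 2 * D
    = ev (\<lambda>\<eta>. sqrt (real n) * (real n)\<^sup>2 / 2 * (\<Sum>i<n. (\<phi> (exchange \<eta> i (succ_site n i)) - \<phi> \<eta>)\<^sup>2))"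
    unfolding D_def dirichlet_def bond_def by (simp only: ev_cmult ev_sum)
  also have "\<dots> \<le> ev (\<lambda>\<eta>. 1 / 2 * (fast_gen \<theta> a n h \<eta>
          - 2 * sqrt (h \<eta>) * fast_gen \<theta> a n (\<lambda>\<xi>. sqrt (h \<xi>)) \<eta>))"
    unfolding \<phi>_def by (intro ev_mono carre_du_champ_lower[OF a(1) n \<gamma>(1) \<gamma>1] h)
  finally show ?thesis by (simp only: ev_def F W_def)
qed

section \<open>The entropy inequality\<close>

lemma sqrt_bound_of_square: "\<theta>\<^sup>2 < x \<Longrightarrow> \<bar>\<theta>\<bar> < sqrt x"
  using real_sqrt_less_mono[of "\<theta>\<^sup>2" x] by simp

text \<open>The bound has to be uniform in n. As |\<theta>| / sqrt n decreases in n, the least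
  integer \<open>N\<close> above \<theta>^2 is the worst case.\<close>

lemma gam_bounds:
  fixes \<theta> :: real
  obtains g where "g < 1" "\<And>n. \<theta>\<^sup>2 < real n \<Longrightarrow> 0 < gam \<theta> n \<and> gam \<theta> n \<le> g"
proof -
  define N where "N = nat \<lfloor>\<theta>\<^sup>2\<rfloor> + 1"
  have N: "\<theta>\<^sup>2 < real N" unfolding N_def by (simp; linarith)
  define g where "g = (1 + \<bar>\<theta>\<bar> / sqrt (real N)) / 2"
  show ?thesis
  proof (rule that[of g])
    have "\<bar>\<theta>\<bar> < sqrt (real N)" by (rule sqrt_bound_of_square[OF N])
    then show "g < 1" by (simp add: g_def divide_less_eq)
  next
    fix n :: nat assume n: "\<theta>\<^sup>2 < real n"
    then have s: "\<bar>\<theta>\<bar> < sqrt (real n)" by (rule sqrt_bound_of_square)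
    have "real_of_int \<lfloor>\<theta>\<^sup>2\<rfloor> < real n" using n by linarith
    then have "\<lfloor>\<theta>\<^sup>2\<rfloor> < int n" by linarith
    then have Nn: "N \<le> n" unfolding N_def by (simp add: nat_less_iff Suc_le_eq)
    have "0 < sqrt (real n)" using s by linarith
    then have pos: "\<theta> / sqrt (real n) < 1" using s by (simp add: divide_less_eq)
    have "- \<theta> / sqrt (real n) \<le> \<bar>\<theta>\<bar> / sqrt (real n)" by (intro divide_right_mono) auto
    also have "\<dots> \<le> \<bar>\<theta>\<bar> / sqrt (real N)"
    proof (rule divide_left_mono)
      have "0 < N" by (simp add: N_def)
      then show "0 < sqrt (real n) * sqrt (real N)" using Nn by simp
    qed (use Nn in auto)
    finally have "1 - \<theta> / sqrt (real n) \<le> 1 + \<bar>\<theta>\<bar> / sqrt (real N)" by simp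
    then have "gam \<theta> n \<le> g" unfolding gam_def g_def by (simp only: times_divide_eq_left mult_1 divide_right_mono)
    moreover have "0 < gam \<theta> n" using pos by (simp add: gam_def)
    ultimately show "0 < gam \<theta> n \<and> gam \<theta> n \<le> g" by simp
  qed
qed

text \<open>One index set for both mechanisms: \<open>True\<close> marks the exchange across the
  bond after the site, \<open>False\<close> the flip at the site. The time change is part of the
  rates.\<close>

definition rate :: "real \<Rightarrow> real \<Rightarrow> nat \<Rightarrow> bool \<times> nat \<Rightarrow> (nat \<Rightarrow> nat) \<Rightarrow> real" where
  "rate \<theta> a n b \<eta> = (if fst b then sqrt (real n) * (real n)\<^sup>2 else sqrt (real n) * a * flip_rate \<theta> n (snd b) \<eta>)"

definition move :: "nat \<Rightarrow> bool \<times> nat \<Rightarrow> (nat \<Rightarrow> nat) \<Rightarrow> (nat \<Rightarrow> nat)" where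
  "move n b \<eta> = (if fst b then exchange \<eta> (snd b) (succ_site n (snd b)) else flip \<eta> (snd b))"

lemma finite_chain_flip_exchange:
  assumes a: "0 < a" and n: "3 \<le> n" and \<gamma>: "0 < gam \<theta> n" "gam \<theta> n < 1"
  shows "finite_chain (Configs n) (UNIV \<times> {..<n}) (rate \<theta> a n) (move n)"
proof
  have n0: "0 < n" using n by simp
  fix b :: "bool \<times> nat" and \<eta> assume b: "b \<in> UNIV \<times> {..<n}" and \<eta>: "\<eta> \<in> Configs n"
  show "move n b \<eta> \<in> Configs n"
    using b by (auto simp: move_def intro!: exchange_in_Configs flip_in_Configs succ_site_less \<eta> n0)
  show "0 \<le> rate \<theta> a n b \<eta>"
    using b a flip_rate_bounds(1)[OF n0 \<gamma> \<eta>, of "snd b"] by (auto simp: rate_def)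
qed (auto simp: finite_Configs)

lemma generator_eq_fast_gen:
  assumes "finite_chain (Configs n) (UNIV \<times> {..<n}) (rate \<theta> a n) (move n)"
  shows "finite_chain.generator (UNIV \<times> {..<n}) (rate \<theta> a n) (move n) = fast_gen \<theta> a n"
proof (intro ext)
  fix f :: "(nat \<Rightarrow> nat) \<Rightarrow> real" and \<eta>
  have "finite_chain.generator (UNIV \<times> {..<n}) (rate \<theta> a n) (move n) f \<eta>
      = (\<Sum>c\<in>UNIV. \<Sum>i<n. rate \<theta> a n (c, i) \<eta> * (f (move n (c, i) \<eta>) - f \<eta>))"
    unfolding finite_chain.generator_def[OF assms] sum.cartesian_product by (simp add: case_prod_beta)
  also have "\<dots> = fast_gen \<theta> a n f \<eta>"
    by (simp add: UNIV_bool rate_def move_def fast_gen_def gen_def distrib_left sum_distrib_left mult_ac)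
  finally show "finite_chain.generator (UNIV \<times> {..<n}) (rate \<theta> a n) (move n) f \<eta> = fast_gen \<theta> a n f \<eta>" .
qed

text \<open>Any target is reached by correcting the sites from left to right. Flips are essential
  here, as exchanges conserve the number of particles.\<close>

lemma flip_connected:
  assumes S: "S \<subseteq> Configs n" "S \<noteq> {}" and closed: "\<And>\<eta> i. \<eta> \<in> S \<Longrightarrow> i < n \<Longrightarrow> flip \<eta> i \<in> S"
  shows "S = Configs n"
proof
  show "Configs n \<subseteq> S"
  proof
    fix \<xi> assume \<xi>: "\<xi> \<in> Configs n"
    obtain \<eta> where \<eta>: "\<eta> \<in> S" using S by auto
    then have \<eta>C: "\<eta> \<in> Configs n" using S by auto
    have "(\<lambda>i. if i < k then \<xi> i else \<eta> i) \<in> S" if "k \<le> n" for k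
      using that
    proof (induction k)
      case (Suc k)
      define \<zeta> where "\<zeta> = (\<lambda>i. if i < k then \<xi> i else \<eta> i)"
      have \<zeta>: "\<zeta> \<in> S" using Suc by (simp add: \<zeta>_def)
      have k: "k < n" using Suc.prems by simp
      have upd: "(\<lambda>i. if i < Suc k then \<xi> i else \<eta> i) = \<zeta>(k := \<xi> k)"
        by (auto simp: \<zeta>_def fun_eq_iff less_Suc_eq)
      show ?case
      proof (cases "\<xi> k = \<eta> k")
        case True
        then have "\<zeta>(k := \<xi> k) = \<zeta>" by (auto simp: \<zeta>_def)
        then show ?thesis using \<zeta> upd by simp
      next
        case False
        then have "\<zeta>(k := \<xi> k) = flip \<zeta> k"
          using Configs_cases[OF \<xi> k] Configs_cases[OF \<eta>C k] by (auto simp: \<zeta>_def flip_def)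
        then show ?thesis using closed[OF \<zeta> k] upd by simp
      qed
    qed (use \<eta> in simp)
    from this[of n] have "(\<lambda>i. if i < n then \<xi> i else \<eta> i) \<in> S" by simp
    moreover have "(\<lambda>i. if i < n then \<xi> i else \<eta> i) = \<xi>"
      using \<xi> \<eta>C by (auto simp: Configs_def PiE_def extensional_def fun_eq_iff)
    ultimately show "\<xi> \<in> S" by simp
  qed
qed (rule S)

section \<open>From measures to finite sums\<close>

lemma integral_finite_space:
  fixes f :: "'a \<Rightarrow> real"
  assumes "prob_space \<mu>" "sets \<mu> = Pow X" "finite X"
  shows "(\<integral>\<eta>. f \<eta> \<partial>\<mu>) = (\<Sum>\<eta>\<in>X. measure \<mu> {\<eta>} * f \<eta>)"
proof -
  interpret prob_space \<mu> by fact
  have sp: "space \<mu> = X" using assms(2) by (metis Pow_top sets.sets_into_space sets.top subset_antisym PowD)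
  have "(\<integral>\<eta>. f \<eta> \<partial>\<mu>) = (\<integral>\<eta>. (\<Sum>\<xi>\<in>X. f \<xi> * indicator {\<xi>} \<eta>) \<partial>\<mu>)"
  proof (rule Bochner_Integration.integral_cong[OF refl])
    fix \<eta> assume "\<eta> \<in> space \<mu>"
    then show "f \<eta> = (\<Sum>\<xi>\<in>X. f \<xi> * indicator {\<xi>} \<eta>)"
      using assms(3) sp by (simp add: indicator_def if_distrib sum.delta cong: if_cong)
  qed
  also have "\<dots> = (\<Sum>\<xi>\<in>X. \<integral>\<eta>. f \<xi> * indicator {\<xi>} \<eta> \<partial>\<mu>)"
    using assms(2) by (intro Bochner_Integration.integral_sum integrable_mult_right integrable_real_indicator)
      (auto simp: emeasure_eq_measure)
  also have "\<dots> = (\<Sum>\<eta>\<in>X. measure \<mu> {\<eta>} * f \<eta>)"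
    using sp by (intro sum.cong refl) (simp add: mult.commute)
  finally show ?thesis .
qed

lemma sum_measure_singletons:
  assumes "prob_space \<mu>" "sets \<mu> = Pow X" "finite X"
  shows "(\<Sum>\<eta>\<in>X. measure \<mu> {\<eta>}) = 1"
  using integral_finite_space[OF assms, of "\<lambda>_. 1"] prob_space.prob_space[OF assms(1)] by simp

lemma Configs_nonempty: "Configs n \<noteq> {}"
  unfolding Configs_def by (simp add: PiE_eq_empty_iff)

lemma partition_const_pos: "0 < partition_const \<theta> n"
  unfolding partition_const_def
  by (subst integral_uniform_count_measure[OF finite_Configs])
    (auto intro!: divide_pos_pos sum_pos simp: tilt_pos finite_Configs Configs_nonempty card_gt_0_iff)

text \<open>The normalisation stands in front so that it can serve as the factor \<open>z\<close> of
  \<open>entropy_production_le\<close>.\<close>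

definition ref_weight :: "real \<Rightarrow> nat \<Rightarrow> (nat \<Rightarrow> nat) \<Rightarrow> real" where
  "ref_weight \<theta> n \<eta> = 1 / (card (Configs n) * partition_const \<theta> n) * tilt \<theta> n \<eta>"

lemma ref_weight_pos: "0 < ref_weight \<theta> n \<eta>"
  unfolding ref_weight_def using tilt_pos partition_const_pos
  by (auto intro!: mult_pos_pos simp: finite_Configs Configs_nonempty card_gt_0_iff)

lemma ref_measure_eq: "ref_measure \<theta> n = point_measure (Configs n) (\<lambda>\<eta>. ennreal (ref_weight \<theta> n \<eta>))"
proof -
  have "ref_measure \<theta> n = density (count_space (Configs n))
      (\<lambda>\<eta>. ennreal (1 / card (Configs n)) * ennreal (tilt \<theta> n \<eta> / partition_const \<theta> n))"
    unfolding ref_measure_def uniform_count_measure_def point_measure_def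
    by (subst density_density_eq) auto
  also have "(\<lambda>\<eta>. ennreal (1 / card (Configs n)) * ennreal (tilt \<theta> n \<eta> / partition_const \<theta> n))
      = (\<lambda>\<eta>. ennreal (ref_weight \<theta> n \<eta>))"
  proof
    fix \<eta>
    have "0 \<le> tilt \<theta> n \<eta> / partition_const \<theta> n"
      using tilt_pos[of \<theta> n \<eta>] partition_const_pos[of \<theta> n] by simp
    then have "ennreal (1 / card (Configs n)) * ennreal (tilt \<theta> n \<eta> / partition_const \<theta> n)
        = ennreal (1 / card (Configs n) * (tilt \<theta> n \<eta> / partition_const \<theta> n))"
      by (intro ennreal_mult[symmetric]) auto
    then show "ennreal (1 / card (Configs n)) * ennreal (tilt \<theta> n \<eta> / partition_const \<theta> n) = ennreal (ref_weight \<theta> n \<eta>)"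
      by (simp add: ref_weight_def)
  qed
  finally show ?thesis by (simp add: point_measure_def)
qed

lemma integral_ref_measure: "(\<integral>\<eta>. f \<eta> \<partial>ref_measure \<theta> n) = (\<Sum>\<eta>\<in>Configs n. ref_weight \<theta> n \<eta> * f \<eta>)"
  for f :: "_ \<Rightarrow> real"
  unfolding ref_measure_eq
  by (subst lebesgue_integral_point_measure_finite[OF finite_Configs])
    (auto simp: less_imp_le[OF ref_weight_pos])

text \<open>Uniqueness of the derivative holds almost everywhere; every configuration has positive
  reference weight, so it holds at each of them.\<close>

lemma enn2real_RN_deriv_ref_measure:
  assumes w: "\<And>\<eta>. \<eta> \<in> Configs n \<Longrightarrow> 0 \<le> w \<eta>" and \<eta>: "\<eta> \<in> Configs n"
  shows "enn2real (RN_deriv (ref_measure \<theta> n) (point_measure (Configs n) (\<lambda>\<xi>. ennreal (w \<xi>))) \<eta>)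
    = w \<eta> / ref_weight \<theta> n \<eta>"
proof -
  let ?R = "ref_measure \<theta> n"
  let ?f = "\<lambda>\<xi>. ennreal (w \<xi> / ref_weight \<theta> n \<xi>)"
  have "emeasure ?R (space ?R) \<noteq> \<infinity>"
    unfolding ref_measure_eq space_point_measure
    by (subst emeasure_point_measure_finite) (auto simp: finite_Configs)
  then interpret R: finite_measure ?R by (rule finite_measureI)
  have "density ?R ?f = density (count_space (Configs n)) (\<lambda>\<xi>. ennreal (ref_weight \<theta> n \<xi>) * ?f \<xi>)"
    unfolding ref_measure_eq point_measure_def by (subst density_density_eq) auto
  also have "\<dots> = point_measure (Configs n) (\<lambda>\<xi>. ennreal (w \<xi>))"
    unfolding point_measure_def
  proof (rule density_cong)
    show "AE \<xi> in count_space (Configs n). ennreal (ref_weight \<theta> n \<xi>) * ?f \<xi> = ennreal (w \<xi>)"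
    proof (rule AE_I2)
      fix \<xi> assume "\<xi> \<in> space (count_space (Configs n))"
      then have "0 \<le> w \<xi>" using w by simp
      moreover have "0 < ref_weight \<theta> n \<xi>" by (rule ref_weight_pos)
      ultimately show "ennreal (ref_weight \<theta> n \<xi>) * ?f \<xi> = ennreal (w \<xi>)"
        by (subst ennreal_mult[symmetric]) auto
    qed
  qed auto
  finally have d: "density ?R ?f = point_measure (Configs n) (\<lambda>\<xi>. ennreal (w \<xi>))" .
  have "?f \<in> borel_measurable ?R"
    unfolding ref_measure_eq by simp
  from R.RN_deriv_unique[OF this d]
  have "\<forall>\<xi>\<in>Configs n. ?f \<xi> = RN_deriv ?R (point_measure (Configs n) (\<lambda>\<xi>. ennreal (w \<xi>))) \<xi>"
    unfolding ref_measure_eq AE_point_measure by (simp add: ref_weight_pos ref_measure_eq)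
  then have "RN_deriv ?R (point_measure (Configs n) (\<lambda>\<xi>. ennreal (w \<xi>))) \<eta> = ?f \<eta>" using \<eta> by simp
  then show ?thesis using w[OF \<eta>] ref_weight_pos[of \<theta> n \<eta>] by simp
qed

lemma entropy_bound:
  assumes n: "3 \<le> n" and \<gamma>: "0 < gam \<theta> n" "gam \<theta> n \<le> g" "g < 1"
  defines "C \<equiv> 24 / (1 - g)\<^sup>2"
  assumes a: "0 < a" "a \<le> 1 / (1200 * C)" and t: "0 \<le> t"
    and \<mu>: "prob_space \<mu>" "sets \<mu> = Pow (Configs n)"
  shows "rel_entropy (dens \<theta> a n \<mu> t) (ref_measure \<theta> n)
        + (LBINT s:{0..t}. carre_energy \<theta> a n (dens \<theta> a n \<mu> s) (ref_measure \<theta> n))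
      \<le> rel_entropy (dens \<theta> a n \<mu> 0) (ref_measure \<theta> n) + a * (250 * C + 64 / (1 - g) ^ 3) * sqrt (real n) * t"
proof -
  have \<gamma>1: "gam \<theta> n < 1" using \<gamma> by simp
  have n0: "0 < n" using n by simp
  note fc = finite_chain_flip_exchange[OF a(1) n \<gamma>(1) \<gamma>1]
  interpret chain: finite_chain "Configs n" "UNIV \<times> {..<n}" "rate \<theta> a n" "move n" by (rule fc)
  have L: "chain.generator = fast_gen \<theta> a n" by (rule generator_eq_fast_gen[OF fc])
  define w where "w \<eta> = measure \<mu> {\<eta>}" for \<eta>
  have w: "0 \<le> w \<eta>" "(\<Sum>\<eta>\<in>Configs n. w \<eta>) = 1" for \<eta>
    using sum_measure_singletons[OF \<mu> finite_Configs] by (simp_all add: w_def)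
  let ?\<nu> = "ref_weight \<theta> n"
  define f where "f s \<eta> = chain.law w s \<eta> / ?\<nu> \<eta>" for s \<eta>
  have ev: "evolve \<theta> a n \<mu> s = point_measure (Configs n) (\<lambda>\<xi>. ennreal (chain.law w s \<xi>))" for s
    unfolding evolve_def integral_finite_space[OF \<mu> finite_Configs] chain.law_def chain.semigroup_def L semigroup_op_def w_def ..
  have dens: "dens \<theta> a n \<mu> s \<eta> = f s \<eta>" if "0 \<le> s" "\<eta> \<in> Configs n" for s \<eta>
    unfolding dens_def ev f_def
    by (rule enn2real_RN_deriv_ref_measure[OF chain.law_nonneg that(2)]) (use w that in auto)
  have ent: "rel_entropy (dens \<theta> a n \<mu> s) (ref_measure \<theta> n) = chain.entropy ?\<nu> (f s)" if "0 \<le> s" for s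
    unfolding rel_entropy_def integral_ref_measure chain.entropy_def
    by (intro sum.cong refl) (simp add: dens that)
  \<comment> \<open>\<open>dens\<close> is identified with \<open>f\<close> on configurations only,
    and the generator reads no other values.\<close>
  have Lcong: "chain.generator h \<eta> = chain.generator h' \<eta>" if "\<eta> \<in> Configs n" "\<And>\<xi>. \<xi> \<in> Configs n \<Longrightarrow> h \<xi> = h' \<xi>" for h h' \<eta>
    unfolding chain.generator_def using that by (intro sum.cong refl) (simp add: chain.TX)
  have en: "carre_energy \<theta> a n (dens \<theta> a n \<mu> s) (ref_measure \<theta> n) = chain.energy ?\<nu> (f s)" if "0 \<le> s" for s
    unfolding carre_energy_def integral_ref_measure chain.energy_def L[symmetric]
  proof (intro sum.cong refl)
    fix \<eta> assume \<eta>: "\<eta> \<in> Configs n"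
    have "chain.generator (dens \<theta> a n \<mu> s) \<eta> = chain.generator (f s) \<eta>"
      by (rule Lcong[OF \<eta>]) (rule dens[OF that])
    moreover have "chain.generator (\<lambda>\<xi>. sqrt (dens \<theta> a n \<mu> s \<xi>)) \<eta> = chain.generator (\<lambda>\<xi>. sqrt (f s \<xi>)) \<eta>"
      by (rule Lcong[OF \<eta>]) (simp add: dens[OF that])
    ultimately show "?\<nu> \<eta> * (1 / 2 * (chain.generator (dens \<theta> a n \<mu> s) \<eta> - 2 * sqrt (dens \<theta> a n \<mu> s \<eta>)
        * chain.generator (\<lambda>\<xi>. sqrt (dens \<theta> a n \<mu> s \<xi>)) \<eta>))
      = ?\<nu> \<eta> * (1 / 2 * (chain.generator (f s) \<eta> - 2 * sqrt (f s \<eta>) * chain.generator (\<lambda>\<xi>. sqrt (f s \<xi>)) \<eta>))"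
      using dens[OF that \<eta>] by simp
  qed
  have int: "(LBINT s:{0..t}. carre_energy \<theta> a n (dens \<theta> a n \<mu> s) (ref_measure \<theta> n))
      = (LBINT s:{0..t}. chain.energy ?\<nu> (f s))"
    by (rule set_lebesgue_integral_cong) (auto simp: en)
  have "chain.entropy ?\<nu> (f t) + (LBINT s:{0..t}. chain.energy ?\<nu> (f s))
      \<le> chain.entropy ?\<nu> (f 0) + (a * (250 * C + 64 / (1 - g) ^ 3) * sqrt (real n)) * t"
    unfolding f_def
  proof (rule chain.entropy_energy_bound[OF w(1) w(2) ref_weight_pos])
    fix S assume S: "S \<subseteq> Configs n" "S \<noteq> {}"
      "\<And>\<eta> b. \<eta> \<in> S \<Longrightarrow> b \<in> UNIV \<times> {..<n} \<Longrightarrow> 0 < rate \<theta> a n b \<eta> \<Longrightarrow> move n b \<eta> \<in> S"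
    show "S = Configs n"
    proof (rule flip_connected[OF S(1,2)])
      fix \<eta> i assume "\<eta> \<in> S" "i < n"
      then show "flip \<eta> i \<in> S"
        using S(3)[of \<eta> "(False, i)"] S(1) a(1) n0 flip_rate_bounds(1)[OF n0 \<gamma>(1) \<gamma>1, of \<eta> i]
        by (auto simp: rate_def move_def)
    qed
  next
    fix h :: "(nat \<Rightarrow> nat) \<Rightarrow> real" assume h: "\<And>\<eta>. \<eta> \<in> Configs n \<Longrightarrow> 0 \<le> h \<eta>"
    have z: "0 \<le> 1 / (card (Configs n) * partition_const \<theta> n)"
      using partition_const_pos[of \<theta> n] by simp
    show "(\<Sum>\<eta>\<in>Configs n. ?\<nu> \<eta> * chain.generator h \<eta>) \<le> chain.energy ?\<nu> h
        + a * (250 * C + 64 / (1 - g) ^ 3) * sqrt (real n) * (\<Sum>\<eta>\<in>Configs n. ?\<nu> \<eta> * h \<eta>)"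
      unfolding L chain.energy_def ref_weight_def C_def
      by (rule entropy_production_le[OF n \<gamma> z h a(1) a(2)[unfolded C_def]])
  qed (rule t)
  then show ?thesis unfolding ent[OF t] ent[OF order_refl] int .
qed

theorem theorem2p8:
  fixes \<theta> :: real
  shows "\<exists>a\<^sub>0 > 0. \<exists>c\<^sub>0 :: real. \<forall>a :: real. \<forall>t :: real. \<forall>n :: nat. \<forall>\<mu> :: (nat \<Rightarrow> nat) measure.
    0 < a \<longrightarrow> a \<le> a\<^sub>0 \<longrightarrow> 0 \<le> t \<longrightarrow> 3 \<le> n \<longrightarrow> \<theta>\<^sup>2 < real n \<longrightarrow>
    prob_space \<mu> \<longrightarrow> sets \<mu> = Pow (Configs n) \<longrightarrow>
      rel_entropy (dens \<theta> a n \<mu> t) (ref_measure \<theta> n)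
        + (LBINT s:{0..t}. carre_energy \<theta> a n (dens \<theta> a n \<mu> s) (ref_measure \<theta> n))
      \<le> rel_entropy (dens \<theta> a n \<mu> 0) (ref_measure \<theta> n) + a * c\<^sub>0 * sqrt (real n) * t"
proof -
  obtain g where g: "g < 1" "\<And>n. \<theta>\<^sup>2 < real n \<Longrightarrow> 0 < gam \<theta> n \<and> gam \<theta> n \<le> g"
    using gam_bounds[of \<theta>] by blast
  define C where "C = 24 / (1 - g)\<^sup>2"
  \<comment> \<open>Both witnesses, this bound on \<open>a\<close> and
    \<open>250 * C + 64 / (1 - g) ^ 3\<close>, involve \<theta> only through \<open>g\<close> and so
    precede the choice of n.\<close>
  have "0 < 1 / (1200 * C)" using g(1) by (simp add: C_def)
  moreover have "rel_entropy (dens \<theta> a n \<mu> t) (ref_measure \<theta> n)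
        + (LBINT s:{0..t}. carre_energy \<theta> a n (dens \<theta> a n \<mu> s) (ref_measure \<theta> n))
      \<le> rel_entropy (dens \<theta> a n \<mu> 0) (ref_measure \<theta> n) + a * (250 * C + 64 / (1 - g) ^ 3) * sqrt (real n) * t"
    if "0 < a" "a \<le> 1 / (1200 * C)" "0 \<le> t" "3 \<le> n" "\<theta>\<^sup>2 < real n" "prob_space \<mu>" "sets \<mu> = Pow (Configs n)"
    for a t n \<mu>
    using entropy_bound[of n \<theta> g a t \<mu>] g(1) g(2)[OF that(5)] that by (simp add: C_def)
  ultimately show ?thesis by blast
qed

end
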